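(* Suppose $(n_q,k_q)_{q\ge1}$ is a Stoltz sequence. Then for almost all $x\in\mathbb{R}$ with respect to Lebesgue measure we have $$\lim_{q\to\infty}\frac1{k_q}\sum_{j=1}^{k_q}\log\left|\zeta\left(\tfrac12+\tfrac12 iT^{n_q+j}x\right)\right|=\sum_{\rho:\Re(\rho)>\frac12}\log\left|\frac{\rho}{1-\rho}\right|,$$ where $\rho$ runs over the complex (non-trivial) zeros of the Riemann zeta function $\zeta$ with real part greater than $\frac12$, counted with multiplicity.
   Context: $T:\mathbb{R}\to\mathbb{R}$ is the map $T(x)=\frac12\left(x-\frac1x\right)$ for $x\neq0$, $T(0)=0$, and $T^n$ is its $n$-th iterate; it preserves and is ergodic for the probability measure $\mu(A)=\frac1\pi\int_A\frac{dt}{1+t^2}$. Stoltz sequences. For a set $Z\subseteq\mathbb{Z}\times\mathbb{N}$, put $Z^h=\{(n,k)\in Z:k\ge h\}$, $Z^h_{\alpha}=\{(z,s)\in\mathbb{Z}^2:|z-y|<\alpha(s-r)\text{ for some }(y,r)\in Z^h\}$, and $Z^h_{\alpha}(\lambda)=\{n:(n,\lambda)\in Z^h_{\alpha}\}$ for $\lambda\in\mathbb{N}$. A sequence of pairs of natural numbers $(n_l,k_l)_{l\ge1}$ is Stoltz if there exist a set $Z\subseteq\mathbb{Z}\times\mathbb{N}$ and a function $h=h(t)$ tending to infinity with $t$ such that $(n_l,k_l)\in Z^{h(t)}$ for all $l\ge t$, and there exist $h_0$, $\alpha_0>0$ and $A>0$ such that $|Z^{h_0}_{\alpha_0}(\lambda)|\le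 A\lambda$ for all integers $\lambda>0$. *)

theory Defs
  imports "HOL-Complex_Analysis.Complex_Analysis"
begin

definition T :: "real \<Rightarrow> real" where
  "T x = (if x = 0 then 0 else (x - 1 / x) / 2)"

(* The analytic continuation of the Dirichlet series to the plane punctured at the pole 1. It is
   unique by the identity theorem; the value 0 at the pole is a dummy that makes the description
   definite. *)
definition zeta :: "complex \<Rightarrow> complex" where
  "zeta = (THE f. f holomorphic_on (- {1}) \<and>
                  (\<forall>s. Re s > 1 \<longrightarrow> (\<lambda>m. 1 / of_nat (Suc m) powr s) sums f s) \<and>
                  f 1 = 0)"

(* The condition rho \<noteq> 1 is needed because of the dummy value at the pole. *)
definition nontrivial_zeta_zeros :: "complex set" where
  "nontrivial_zeta_zeros =
     {\<rho>. \<rho> \<noteq> 1 \<and> zeta \<rho> = 0 \<and> \<rho> \<notin> range (\<lambda>m::nat. - 2 * of_nat (Suc m))}"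

definition truncated :: "(int \<times> nat) set \<Rightarrow> real \<Rightarrow> (int \<times> nat) set" where
  "truncated Z h = {(n, k) \<in> Z. real k \<ge> h}"

definition cone :: "(int \<times> nat) set \<Rightarrow> real \<Rightarrow> real \<Rightarrow> (int \<times> int) set" where
  "cone Z h \<alpha> =
     {(z, s). \<exists>(y, r) \<in> truncated Z h. \<bar>of_int z - of_int y\<bar> < \<alpha> * (of_int s - of_nat r)}"

definition cone_section :: "(int \<times> nat) set \<Rightarrow> real \<Rightarrow> real \<Rightarrow> nat \<Rightarrow> int set" where
  "cone_section Z h \<alpha> s = {n. (n, int s) \<in> cone Z h \<alpha>}"

(* Sequences are indexed from 1; their values at index 0 play no role. Finiteness of the sections
   is part of the bound on their size, since card is 0 on infinite sets. *)
definition stoltz :: "(nat \<Rightarrow> nat) \<Rightarrow> (nat \<Rightarrow> nat) \<Rightarrow> bool" where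
  "stoltz n k \<longleftrightarrow>
     (\<exists>(Z :: (int \<times> nat) set) (h :: nat \<Rightarrow> real).
        filterlim h at_top at_top \<and>
        (\<forall>t\<ge>1. \<forall>l\<ge>t. (int (n l), k l) \<in> truncated Z (h t)) \<and>
        (\<exists>h0 \<alpha>0 A. \<alpha>0 > 0 \<and> A > 0 \<and>
           (\<forall>s>0. finite (cone_section Z h0 \<alpha>0 s) \<and>
                  real (card (cone_section Z h0 \<alpha>0 s)) \<le> A * real s)))"

end

(* Put w = 1 - 1/s. This sends the half-plane Re s > 1/2 to the unit disc and the critical line to
   the unit circle, and with w(x) = (x + i)/(x - i), the image of s = 1/2 + ix/2, one has
   w(T x) = w(x)^2. So T becomes the doubling map t -> 2t mod 1 in w = exp(2 pi i t), the Cauchy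
   measure becomes Lebesgue measure on [0,1], and log|zeta(1/2 + ix/2)| = log|G(w(x))| for
   G(w) = w zeta(1/(1-w)), which is holomorphic off w = 1 with G(0) = 1.

   The mean of log|G| over the unit circle is the limit r -> 1 of Jensen's formula. Fatou's lemma
   together with |G(w)| <= C/|1-w| gives one inequality. For the other, the only danger is that mass
   of log(C/(|1-w||G(w)|)) >= 0 escapes to w = 1 as r -> 1; the Poisson kernel at the real point
   1 - d dominates 1/(18 d) on |w - 1| < d, so that mass is at most
   18 d (log C - log d - log|G(1 - d)|), which vanishes with d since |G(x)| >= x.

   The moving averages converge because they do so trivially on constants plus bounded coboundaries,
   which are dense in L^1 by the exponential decay of correlations of intervals under doubling, and
   because the Stoltz condition yields a weak (1,1) maximal inequality by transference of a Vitali
   covering argument on the integers. *)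

theory Submission
  imports Defs "HOL-Real_Asymp.Real_Asymp" "HOL-Probability.Probability_Measure"
begin

section \<open>Analytic continuation of the zeta function\<close>

text \<open>The danger at w = 1 is real: exp((w + 1)/(w - 1)) has no zeros and modulus 1 on the rest
  of the circle, yet the real part of its logarithm is -1 at w = 0. A factor of this kind would
  spoil Jensen's formula on the boundary, and no upper bound on |G| excludes it. It decays
  exponentially along the radius towards 1, which is what |G(x)| >= x forbids; that bound is
  |zeta(s)| >= 1 for real s > 1. On the ergodic side the integrand is unbounded, so it is
  approximated only in L^1, and an error small in L^1 need not stay small along a moving sequence;
  controlling it is the task of the maximal inequality. Ergodicity is not invoked: the decomposition
  into constant and coboundary already exhibits the mean. The convention T 0 = 0 breaks the
  conjugacy with squaring, so orbits through 0 are removed at the end as a countable set of starting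
  points. Since \<open>zeta\<close> is a definite description over the punctured plane, the
  continuation is carried to all of it; the estimates then rest on the first remainder
  series.\<close>

definition dirichlet_zeta :: "complex \<Rightarrow> complex" where
  "dirichlet_zeta s = (\<Sum>m. 1 / of_nat (Suc m) powr s)"

lemma summable_Suc_powr_neg:
  assumes "a > (1::real)"
  shows "summable (\<lambda>m. real (Suc m) powr (- a))"
proof -
  have "summable (\<lambda>m. real m powr (- a))"
    using assms by (subst summable_real_powr_iff) auto
  then show ?thesis
    by (subst (asm) summable_Suc_iff[symmetric]) simp
qed

lemma norm_of_nat_Suc_powr: "norm (of_nat (Suc m) powr (s::complex)) = real (Suc m) powr Re s"
  by (subst norm_powr_real_powr) (auto simp del: of_nat_Suc)

lemma dirichlet_zeta_sums:
  assumes "Re s > 1"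
  shows "(\<lambda>m. 1 / of_nat (Suc m) powr s) sums dirichlet_zeta s"
proof -
  have "summable (\<lambda>m. 1 / of_nat (Suc m) powr s)"
  proof (rule summable_comparison_test)
    show "\<exists>N. \<forall>n\<ge>N. norm (1 / of_nat (Suc n) powr s) \<le> real (Suc n) powr (- Re s)"
      by (auto simp: norm_divide norm_of_nat_Suc_powr powr_minus field_simps simp del: of_nat_Suc)
  qed (use assms summable_Suc_powr_neg in auto)
  then show ?thesis
    unfolding dirichlet_zeta_def by (simp add: summable_sums)
qed

(* Summed over m, the difference (m+1)^(1-s) - m^(1-s) telescopes and the Taylor terms give
   zeta(s), zeta(s+1), ...; the remainder series converges for Re s > 1 - K. So (s-1) zeta(s) extends
   one unit further to the left at each step. *)
definition powr_remainder :: "nat \<Rightarrow> nat \<Rightarrow> complex \<Rightarrow> complex" where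
  "powr_remainder K m s = of_nat (Suc (Suc m)) powr (1 - s) -
     (\<Sum>k\<le>K. ((1 - s) gchoose k) * of_nat (Suc m) powr (1 - s - of_nat k))"

text \<open>\<open>fact i * (c gchoose i)\<close> is the falling factorial c (c - 1) ... (c - i +
  1), the coefficient of the i-th derivative of x^c, so this is the passage from one derivative to
  the next in the Taylor formula.\<close>

lemma fact_gbinomial_Suc:
  fixes c :: complex
  shows "fact i * (c gchoose i) * (c - of_nat i) = fact (Suc i) * (c gchoose (Suc i))"
  by (simp only: gbinomial_mult_fact prod.atLeast0_lessThan_Suc)

text \<open>Taylor's formula for x^(1 - s) on the segment from m + 1 to m + 2, which has length 1.
  The derivative of order K + 1 has modulus a constant times x^-(Re s + K), and the hypothesis makes
  this largest at the left end point. The factor 1 / K! is dropped.\<close>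

lemma norm_powr_remainder_le:
  assumes "Re s + real K \<ge> 0"
  shows "norm (powr_remainder K m s) \<le>
           fact (Suc K) * norm ((1 - s) gchoose (Suc K)) * real (Suc m) powr (- (Re s + real K))"
proof -
  define c where "c = 1 - s"
  define f where "f i x = fact i * (c gchoose i) * x powr (c - of_nat i)" for i and x :: complex
  define a b :: complex where "a = of_nat (Suc m)" and "b = of_nat (Suc (Suc m))"
  define B where "B = fact (Suc K) * norm (c gchoose (Suc K)) * real (Suc m) powr (- (Re s + real K))"
  have seg: "x \<in> \<real> \<and> Re x \<ge> real (Suc m)" if "x \<in> closed_segment a b" for x
  proof -
    have "closed_segment a b = of_real ` closed_segment (real (Suc m)) (real (Suc (Suc m)))"
      unfolding a_def b_def by (metis closed_segment_of_real of_real_of_nat_eq)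
    then show ?thesis
      using that by (auto simp: closed_segment_eq_real_ivl)
  qed
  have "norm (f 0 b - (\<Sum>i\<le>K. f i a * (b - a) ^ i / fact i)) \<le> B * norm (b - a) ^ Suc K / fact K"
  proof (rule complex_Taylor[where S = "closed_segment a b"])
    show "(f i has_field_derivative f (Suc i) x) (at x within closed_segment a b)"
      if "x \<in> closed_segment a b" for i x
    proof -
      have "x \<notin> \<real>\<^sub>\<le>\<^sub>0"
        using seg[OF that] by (auto simp: complex_nonpos_Reals_iff)
      then have "(f i has_field_derivative
          fact i * (c gchoose i) * ((c - of_nat i) * x powr (c - of_nat i - 1))) (at x)"
        unfolding f_def by (intro DERIV_cmult has_field_derivative_powr)
      also have "fact i * (c gchoose i) * ((c - of_nat i) * x powr (c - of_nat i - 1)) = f (Suc i) x"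
        unfolding f_def fact_gbinomial_Suc[symmetric] by (simp add: algebra_simps)
      finally show ?thesis
        by (rule has_field_derivative_at_within)
    qed
    show "norm (f (Suc K) x) \<le> B" if "x \<in> closed_segment a b" for x
    proof -
      have "norm (x powr (c - of_nat (Suc K))) = Re x powr (- (Re s + real K))"
        using seg[OF that] by (subst norm_powr_real_powr) (auto simp: c_def)
      also have "\<dots> \<le> real (Suc m) powr (- (Re s + real K))"
        using seg[OF that] assms by (intro powr_mono2') auto
      finally show ?thesis
        unfolding f_def B_def norm_mult norm_fact by (rule mult_left_mono) auto
    qed
  qed auto
  also have "B * norm (b - a) ^ Suc K / fact K \<le> B"
  proof -
    have "B \<ge> 0" unfolding B_def by auto
    moreover have "norm (b - a) = 1" by (simp add: a_def b_def)
    moreover have "fact K \<ge> (1::real)" by (rule fact_ge_1)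
    ultimately show ?thesis by (simp add: divide_le_eq mult_le_cancel_left1)
  qed
  also have "f 0 b - (\<Sum>i\<le>K. f i a * (b - a) ^ i / fact i) = powr_remainder K m s"
    by (simp add: f_def a_def b_def powr_remainder_def c_def)
  finally show ?thesis
    by (simp only: B_def c_def)
qed


lemma holomorphic_on_gbinomial [holomorphic_intros]:
  fixes f :: "complex \<Rightarrow> complex"
  assumes "f holomorphic_on S"
  shows "(\<lambda>s. f s gchoose k) holomorphic_on S"
  unfolding gbinomial_prod_rev using assms by (intro holomorphic_intros) auto

definition remainder_series :: "nat \<Rightarrow> complex \<Rightarrow> complex" where
  "remainder_series K s = (\<Sum>m. powr_remainder K m s)"

lemma holomorphic_remainder_series:
  "remainder_series K holomorphic_on {s. Re s > 1 - real K}"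
proof -
  define S where "S = {s. Re s > 1 - real K}"
  have opS: "open S"
    unfolding S_def by (rule open_halfspace_Re_gt)
  have hol: "(\<lambda>s. \<Sum>m<n. powr_remainder K m s) holomorphic_on S" for n
    unfolding powr_remainder_def by (intro holomorphic_intros) (auto simp del: of_nat_Suc)
  have "remainder_series K holomorphic_on S"
  proof (rule holomorphic_uniform_sequence[OF opS hol])
    fix x assume x: "x \<in> S"
    \<comment> \<open>Half the distance from x to the line Re s = 1 - K; on the disc of this radius
      the terms are at most a constant times (m + 1)^-(1 + a).\<close>
    define a where "a = (Re x + real K - 1) / 2"
    have a: "a > 0" using x by (auto simp: a_def S_def)
    have Re_ge: "Re s + real K \<ge> 1 + a" if "s \<in> cball x a" for s
    proof -
      have "\<bar>Re (x - s)\<bar> \<le> a"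
        using that abs_Re_le_cmod[of "x - s"] by (auto simp: dist_norm)
      then have "Re x - Re s \<le> a" by simp
      moreover have "2 * a = Re x + real K - 1" by (simp add: a_def)
      ultimately show ?thesis by linarith
    qed
    have sub: "cball x a \<subseteq> S"
      using Re_ge a by (force simp: S_def)
    have "continuous_on (cball x a) (\<lambda>s. (1 - s) gchoose Suc K)"
      by (intro holomorphic_on_imp_continuous_on holomorphic_intros)
    then have "bounded ((\<lambda>s. (1 - s) gchoose Suc K) ` cball x a)"
      by (intro compact_imp_bounded compact_continuous_image compact_cball)
    then obtain M where M: "\<And>s. s \<in> cball x a \<Longrightarrow> norm ((1 - s) gchoose Suc K) \<le> M" and M0: "M > 0"
      unfolding bounded_pos by blast
    have "uniform_limit (cball x a) (\<lambda>n s. \<Sum>m<n. powr_remainder K m s)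
            (\<lambda>s. \<Sum>m. powr_remainder K m s) sequentially"
    proof (rule Weierstrass_m_test)
      show "summable (\<lambda>m. fact (Suc K) * M * real (Suc m) powr (- (1 + a)))"
        using a by (intro summable_mult summable_Suc_powr_neg) auto
      fix m s assume s: "s \<in> cball x a"
      have "norm (powr_remainder K m s) \<le>
          fact (Suc K) * norm ((1 - s) gchoose (Suc K)) * real (Suc m) powr (- (Re s + real K))"
        using Re_ge[OF s] a by (intro norm_powr_remainder_le) auto
      also have "\<dots> \<le> fact (Suc K) * M * real (Suc m) powr (- (1 + a))"
        using M[OF s] M0 Re_ge[OF s] by (intro mult_mono powr_mono) auto
      finally show "norm (powr_remainder K m s) \<le> fact (Suc K) * M * real (Suc m) powr (- (1 + a))" .
    qed
    then show "\<exists>d>0. cball x d \<subseteq> S \<and>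
        uniform_limit (cball x d) (\<lambda>n s. \<Sum>m<n. powr_remainder K m s) (remainder_series K) sequentially"
      using a sub by (intro exI[of _ a]) (auto simp: remainder_series_def[abs_def])
  qed
  then show ?thesis by (simp add: S_def)
qed

text \<open>The leading power and the k = 0 term of the Taylor polynomial telescope to -1; the term
  of order k >= 1 sums to a multiple of zeta(s + k - 1).\<close>

lemma remainder_series_eq:
  assumes s: "Re s > 1"
  shows "remainder_series K s =
           - 1 - (\<Sum>k=1..K. ((1 - s) gchoose k) * dirichlet_zeta (s + of_nat k - 1))"
proof -
  have lim: "(\<lambda>m. of_nat (Suc m) powr (1 - s)) \<longlonglongrightarrow> 0"
  proof (rule tendsto_norm_zero_cancel)
    have "(\<lambda>m. real (Suc m) powr (1 - Re s)) \<longlonglongrightarrow> 0"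
      using s by (intro tendsto_neg_powr filterlim_compose[OF filterlim_real_sequentially filterlim_Suc]) auto
    then show "(\<lambda>m. norm (of_nat (Suc m) powr (1 - s))) \<longlonglongrightarrow> 0"
      by (simp only: norm_of_nat_Suc_powr) simp
  qed
  have 1: "(\<lambda>m. of_nat (Suc (Suc m)) powr (1 - s) - of_nat (Suc m) powr (1 - s)) sums (0 - 1)"
    using telescope_sums[OF lim] by simp
  have 2: "(\<lambda>m. \<Sum>k=1..K. ((1 - s) gchoose k) * (1 / of_nat (Suc m) powr (s + of_nat k - 1))) sums
           (\<Sum>k=1..K. ((1 - s) gchoose k) * dirichlet_zeta (s + of_nat k - 1))"
    using s by (intro sums_sum sums_mult dirichlet_zeta_sums) auto
  have "powr_remainder K m s = of_nat (Suc (Suc m)) powr (1 - s) - of_nat (Suc m) powr (1 - s) -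
      (\<Sum>k=1..K. ((1 - s) gchoose k) * (1 / of_nat (Suc m) powr (s + of_nat k - 1)))" for m
  proof -
    have "of_nat (Suc m) powr (1 - s - of_nat k) = 1 / of_nat (Suc m) powr (s + of_nat k - 1)" for k
      by (subst powr_minus[symmetric, unfolded inverse_eq_divide]) (simp add: algebra_simps)
    moreover have "{..K} = insert 0 {1..K}" by auto
    ultimately have "powr_remainder K m s = of_nat (Suc (Suc m)) powr (1 - s) -
        (((1 - s) gchoose 0) * of_nat (Suc m) powr (1 - s - of_nat 0) +
         (\<Sum>k=1..K. ((1 - s) gchoose k) * (1 / of_nat (Suc m) powr (s + of_nat k - 1))))"
      unfolding powr_remainder_def by (simp only: sum.insert finite_atLeastAtMost) simp
    then show ?thesis by (simp del: of_nat_Suc)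
  qed
  then have "(\<lambda>m. powr_remainder K m s) sums
      (0 - 1 - (\<Sum>k=1..K. ((1 - s) gchoose k) * dirichlet_zeta (s + of_nat k - 1)))"
    using sums_diff[OF 1 2] by simp
  then show ?thesis
    unfolding remainder_series_def by (simp add: sums_iff)
qed

text \<open>The binomial coefficient of order j + 1 yields the factor s + j - 1, exactly the one
  that completes zeta(s + j) to the value of (z - 1) zeta(z) at z = s + j. So the recurrence
  concerns this function alone and the pole never enters.\<close>

lemma dirichlet_zeta_recurrence:
  assumes s: "Re s > 1"
  shows "(s - 1) * dirichlet_zeta s = 1 + remainder_series (Suc K) s -
           (\<Sum>j=1..K. ((1 - s) gchoose j) / of_nat (Suc j) *
               ((s + of_nat j - 1) * dirichlet_zeta (s + of_nat j)))"
proof -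
  have "((1 - s) gchoose Suc j) * dirichlet_zeta (s + of_nat (Suc j) - 1) =
      - (((1 - s) gchoose j) / of_nat (Suc j) * ((s + of_nat j - 1) * dirichlet_zeta (s + of_nat j)))" for j
  proof -
    have "fact (Suc j) * ((1 - s) gchoose Suc j) = fact j * ((1 - s) gchoose j) * (1 - s - of_nat j)"
      by (rule fact_gbinomial_Suc[symmetric])
    then have "((1 - s) gchoose Suc j) = - (((1 - s) gchoose j) / of_nat (Suc j) * (s + of_nat j - 1))"
      by (simp add: fact_Suc mult.assoc del: of_nat_Suc) (simp add: field_simps del: of_nat_Suc)
    then show ?thesis by simp
  qed
  moreover have "(\<Sum>k=1..Suc K. ((1 - s) gchoose k) * dirichlet_zeta (s + of_nat k - 1)) =
      (1 - s) * dirichlet_zeta s +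
      (\<Sum>j=1..K. ((1 - s) gchoose Suc j) * dirichlet_zeta (s + of_nat (Suc j) - 1))"
    by (subst sum.atLeast_Suc_atMost, simp, subst sum.shift_bounds_cl_Suc_ivl) simp
  ultimately have "(\<Sum>k=1..Suc K. ((1 - s) gchoose k) * dirichlet_zeta (s + of_nat k - 1)) =
      (1 - s) * dirichlet_zeta s - (\<Sum>j=1..K. ((1 - s) gchoose j) / of_nat (Suc j) *
               ((s + of_nat j - 1) * dirichlet_zeta (s + of_nat j)))"
    by (simp only: sum_negf) simp
  with remainder_series_eq[OF s, of "Suc K"] show ?thesis
    by (simp only:) (simp add: algebra_simps)
qed

lemma zeta_continuation_halfplane:
  "\<exists>\<xi>. \<xi> holomorphic_on {s. Re s > - real m} \<and> (\<forall>s. Re s > 1 \<longrightarrow> \<xi> s = (s - 1) * dirichlet_zeta s)"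
proof (induction m)
  case 0
  show ?case
    using holomorphic_remainder_series[of 1] dirichlet_zeta_recurrence[of _ 0]
    by (intro exI[of _ "\<lambda>s. 1 + remainder_series 1 s"]) (auto intro!: holomorphic_intros)
next
  case (Suc m)
  then obtain \<xi> where hol: "\<xi> holomorphic_on {s. Re s > - real m}"
    and eq: "\<And>s. Re s > 1 \<Longrightarrow> \<xi> s = (s - 1) * dirichlet_zeta s"
    by auto
  \<comment> \<open>Both parts reach exactly Re s > -(m + 1): the remainder series has order m + 2,
    and the shifts by j >= 1 land in the half-plane of \<xi>.\<close>
  define \<eta> where "\<eta> s = 1 + remainder_series (Suc (Suc m)) s -
      (\<Sum>j=1..Suc m. ((1 - s) gchoose j) / of_nat (Suc j) * \<xi> (s + of_nat j))" for s
  have "\<eta> holomorphic_on {s. Re s > - real (Suc m)}"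
    unfolding \<eta>_def using holomorphic_remainder_series[of "Suc (Suc m)"]
    by (intro holomorphic_intros holomorphic_on_compose_gen[OF _ hol, unfolded o_def])
       (auto simp del: of_nat_Suc)
  moreover have "\<eta> s = (s - 1) * dirichlet_zeta s" if "Re s > 1" for s
    unfolding \<eta>_def using that dirichlet_zeta_recurrence[OF that, of "Suc m"] eq
    by (simp del: of_nat_Suc sum.atLeast_Suc_atMost)
  ultimately show ?case by blast
qed

lemma halfplane_holomorphic_eq:
  assumes "f holomorphic_on {s. Re s > a}" "g holomorphic_on {s. Re s > a}"
    and "\<And>s. Re s > b \<Longrightarrow> f s = g s" "Re z > a"
  shows "f z = g z"
proof (rule analytic_continuation_open[of "{s. Re s > max a b}" "{s. Re s > a}" f g])
  have "Re (of_real (max a b + 1)) > max a b" by simp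
  then show "{s. Re s > max a b} \<noteq> {}" by blast
  show "connected {s. Re s > a}"
    by (intro convex_connected convex_halfspace_Re_gt)
  show "open {s. Re s > max a b}" "open {s. Re s > a}"
    by (rule open_halfspace_Re_gt)+
qed (use assms in auto)

lemma zeta_continuation:
  "\<exists>\<xi>. \<xi> holomorphic_on UNIV \<and> (\<forall>s. Re s > 1 \<longrightarrow> \<xi> s = (s - 1) * dirichlet_zeta s)"
proof -
  obtain X where hol: "\<And>m. X m holomorphic_on {s. Re s > - real m}"
    and eq: "\<And>m s. Re s > 1 \<Longrightarrow> X m s = (s - 1) * dirichlet_zeta s"
    using zeta_continuation_halfplane by metis
  have agree: "X m s = X n s" if "m \<le> n" "Re s > - real m" for m n s
    by (rule halfplane_holomorphic_eq[where a = "- real m" and b = 1])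
       (use that hol eq in \<open>auto intro: holomorphic_on_subset[OF hol]\<close>)
  \<comment> \<open>Any index whose half-plane contains s would do: by \<open>agree\<close> they all
    give the same value, so near s the glued function coincides with the fixed function
    \<open>X (N s)\<close>.\<close>
  define N where "N s = nat (\<lceil>\<bar>Re s\<bar>\<rceil> + 1)" for s
  have N: "Re s > - real (N s)" for s
    unfolding N_def by linarith
  define \<xi> where "\<xi> s = X (N s) s" for s
  have \<xi>: "\<xi> s = X m s" if "Re s > - real m" for m s
    using agree[of m "N s" s, OF _ that] agree[of "N s" m s, OF _ N] unfolding \<xi>_def
    by (metis nle_le)
  have "\<xi> analytic_on {s}" for s
  proof -
    have "X (N s) analytic_on {z. Re z > - real (N s)}"
      using hol open_halfspace_Re_gt[of "- real (N s)"] by (subst analytic_on_open) auto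
    then have "X (N s) analytic_on {s}"
      using N by (rule_tac analytic_on_subset) auto
    moreover have "eventually (\<lambda>z. z \<in> {z. Re z > - real (N s)}) (nhds s)"
      using N by (intro eventually_nhds_in_open open_halfspace_Re_gt) auto
    then have "eventually (\<lambda>z. \<xi> z = X (N s) z) (nhds s)"
      by eventually_elim (use \<xi> in auto)
    ultimately show ?thesis
      by (simp cong: analytic_at_cong)
  qed
  then have "\<xi> analytic_on UNIV"
    using analytic_on_analytic_at by blast
  moreover have "\<xi> s = (s - 1) * dirichlet_zeta s" if "Re s > 1" for s
    using that by (simp add: \<xi>_def eq)
  ultimately show ?thesis
    by (intro exI[of _ \<xi>]) (auto intro: analytic_imp_holomorphic)
qed

text \<open>\<open>zeta\<close> is a definite description, so nothing is known of it before
  existence and uniqueness are settled. Dividing the entire continuation by s - 1 gives existence,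
  with the value 0 at 1 because division by 0 yields 0; uniqueness is the identity theorem on the
  connected punctured plane.\<close>

lemma zeta_characterization:
  shows holomorphic_zeta: "zeta holomorphic_on (- {1})"
    and zeta_sums: "Re s > 1 \<Longrightarrow> (\<lambda>m. 1 / of_nat (Suc m) powr s) sums zeta s"
proof -
  define P where "P f \<longleftrightarrow> f holomorphic_on (- {1}) \<and>
      (\<forall>s. Re s > 1 \<longrightarrow> (\<lambda>m. 1 / of_nat (Suc m) powr s) sums f s) \<and> f 1 = 0" for f :: "complex \<Rightarrow> complex"
  obtain \<xi> where hol: "\<xi> holomorphic_on UNIV"
    and \<xi>: "\<And>s. Re s > 1 \<Longrightarrow> \<xi> s = (s - 1) * dirichlet_zeta s"
    using zeta_continuation by auto
  have ex: "P (\<lambda>s. \<xi> s / (s - 1))"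
    unfolding P_def
  proof (intro conjI allI impI)
    show "(\<lambda>s. \<xi> s / (s - 1)) holomorphic_on - {1}"
      by (intro holomorphic_intros holomorphic_on_subset[OF hol]) auto
    fix s assume "Re s > 1"
    moreover from this have "s \<noteq> 1" by auto
    ultimately show "(\<lambda>m. 1 / of_nat (Suc m) powr s) sums (\<xi> s / (s - 1))"
      using dirichlet_zeta_sums[of s] \<xi>[of s] by simp
  qed auto
  have uniq: "f = g" if "P f" "P g" for f g
  proof
    fix z
    show "f z = g z"
    proof (cases "z = 1")
      case False
      show ?thesis
      proof (rule analytic_continuation_open[of "{s. Re s > 1}" "- {1}" f g])
        have "Re 2 > 1" by simp
        then show "{s. Re s > 1} \<noteq> {}" by blast
        show "connected (- {1 :: complex})"
          by (intro connected_punctured_universe) auto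
        show "f s = g s" if "s \<in> {s. Re s > 1}" for s
          using that \<open>P f\<close> \<open>P g\<close> unfolding P_def by (auto intro: sums_unique2)
      qed (use that False in \<open>auto simp: open_halfspace_Re_gt P_def\<close>)
    qed (use that in \<open>auto simp: P_def\<close>)
  qed
  have "P zeta"
    unfolding zeta_def P_def[symmetric] using ex uniq by (intro theI[of P]) auto
  then show "zeta holomorphic_on (- {1})"
    "Re s > 1 \<Longrightarrow> (\<lambda>m. 1 / of_nat (Suc m) powr s) sums zeta s"
    unfolding P_def by auto
qed

section \<open>Zeta in the half-plane Re s > 0 and bounds there\<close>

lemma zeta_eq_remainder_series:
  assumes "Re s > 0" "s \<noteq> 1"
  shows "(s - 1) * zeta s = 1 + remainder_series 1 s"
proof -
  define U where "U = {s. Re s > 0} - {1 :: complex}"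
  have "(\<lambda>s. (s - 1) * zeta s) s = (\<lambda>s. 1 + remainder_series 1 s) s"
  proof (rule analytic_continuation_open[of "{s. Re s > 1}" U
        "\<lambda>s. (s - 1) * zeta s" "\<lambda>s. 1 + remainder_series 1 s"])
    have "Re 2 > 1" by simp
    then show "{s. Re s > 1} \<noteq> {}" by blast
    show "open U"
      unfolding U_def by (intro open_Diff open_halfspace_Re_gt) auto
    show "connected U"
      unfolding U_def
      by (intro connected_open_delete convex_connected convex_halfspace_Re_gt open_halfspace_Re_gt) auto
    show "(\<lambda>s. (s - 1) * zeta s) holomorphic_on U"
      by (intro holomorphic_intros holomorphic_on_subset[OF holomorphic_zeta]) (auto simp: U_def)
    show "(\<lambda>s. 1 + remainder_series 1 s) holomorphic_on U"
      by (intro holomorphic_intros holomorphic_on_subset[OF holomorphic_remainder_series]) (auto simp: U_def)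
    \<comment> \<open>The recurrence with \<open>K = 0\<close> has an empty sum, so no shifted
      values of zeta appear.\<close>
    show "(\<lambda>s. (s - 1) * zeta s) z = (\<lambda>s. 1 + remainder_series 1 s) z" if "z \<in> {s. Re s > 1}" for z
      using that zeta_sums[of z] dirichlet_zeta_sums[of z] dirichlet_zeta_recurrence[of z 0]
      by (auto dest: sums_unique2)
  qed (use assms in \<open>auto simp: U_def open_halfspace_Re_gt\<close>)
  then show ?thesis by simp
qed

text \<open>At s = 1 the formula for (s - 1) zeta(s) thus takes the value 1, the residue, which
  becomes the value of G at w = 0.\<close>

lemma remainder_series_1_at_1: "remainder_series 1 1 = 0"
proof -
  have "of_nat (Suc m) \<noteq> (0 :: complex)" for m
    by (rule of_nat_neq_0)
  then show ?thesis
    by (simp add: remainder_series_def powr_remainder_def del: of_nat_Suc) simp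
qed

text \<open>The second falling factorial of 1 - s is - s (1 - s), whence the two factors, and Re s +
  1 >= 3/2 gives a summable exponent. In the closed unit disc of w, each of |s| and |1 - s| is at
  most 1 / |1 - w|, and the factor 1 - w of G then leaves a bound of first order.\<close>

lemma norm_remainder_series_1_le:
  "\<exists>C>0. \<forall>s. Re s \<ge> 1/2 \<longrightarrow> norm (remainder_series 1 s) \<le> C * norm (1 - s) * norm s"
proof -
  define C where "C = (\<Sum>m. real (Suc m) powr (- (3/2)))"
  have sm: "summable (\<lambda>m. real (Suc m) powr (- (3/2)))"
    by (rule summable_Suc_powr_neg) auto
  have "norm (remainder_series 1 s) \<le> C * norm (1 - s) * norm s" if s: "Re s \<ge> 1/2" for s
  proof -
    have le: "norm (powr_remainder 1 m s) \<le> (norm (1 - s) * norm s) * real (Suc m) powr (- (3/2))" for m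
    proof -
      have "norm (powr_remainder 1 m s) \<le>
          fact (Suc 1) * norm ((1 - s) gchoose (Suc 1)) * real (Suc m) powr (- (Re s + real 1))"
        using s by (intro norm_powr_remainder_le) auto
      also have "fact (Suc 1) * norm ((1 - s) gchoose (Suc 1)) = norm (fact (Suc 1) * ((1 - s) gchoose (Suc 1)))"
        by (simp add: norm_mult)
      also have "\<dots> = norm (1 - s) * norm s"
        unfolding fact_gbinomial_Suc[symmetric] by (simp add: norm_mult)
      also have "(norm (1 - s) * norm s) * real (Suc m) powr (- (Re s + real 1)) \<le>
          (norm (1 - s) * norm s) * real (Suc m) powr (- (3/2))"
        using s by (intro mult_left_mono powr_mono) auto
      finally show ?thesis .
    qed
    have "norm (remainder_series 1 s) \<le> (\<Sum>m. (norm (1 - s) * norm s) * real (Suc m) powr (- (3/2)))"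
      unfolding remainder_series_def by (rule norm_suminf_le[OF le]) (intro summable_mult sm)
    also have "\<dots> = C * norm (1 - s) * norm s"
      unfolding C_def by (subst suminf_mult) (use sm in auto)
    finally show ?thesis .
  qed
  moreover have "C > 0"
    unfolding C_def by (rule suminf_pos[OF sm]) auto
  ultimately show ?thesis by blast
qed

text \<open>The first term of the Dirichlet series is 1 and the others are positive. Under s = 1 /
  (1 - x) this becomes the lower bound for G along the radius towards w = 1.\<close>

lemma norm_zeta_real_ge_1:
  assumes "x > 1"
  shows "norm (zeta (of_real x)) \<ge> 1"
proof -
  have "(\<lambda>m. 1 / of_nat (Suc m) powr (of_real x :: complex)) sums zeta (of_real x)"
    using assms by (intro zeta_sums) auto
  then have "(\<lambda>m. Re (1 / of_nat (Suc m) powr (of_real x :: complex))) sums Re (zeta (of_real x))"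
    by (rule sums_Re)
  also have "(\<lambda>m. Re (1 / of_nat (Suc m) powr (of_real x :: complex))) = (\<lambda>m. 1 / real (Suc m) powr x)"
  proof
    fix m
    have "of_nat (Suc m) powr (of_real x :: complex) = of_real (real (Suc m) powr x)"
      by (subst powr_of_real[symmetric]) simp_all
    then show "Re (1 / of_nat (Suc m) powr (of_real x :: complex)) = 1 / real (Suc m) powr x"
      by (simp only: Re_divide_of_real complex.sel one_complex.sel)
  qed
  finally have sums: "(\<lambda>m. 1 / real (Suc m) powr x) sums Re (zeta (of_real x))" .
  have "(\<Sum>m\<in>{0}. 1 / real (Suc m) powr x) \<le> Re (zeta (of_real x))"
    unfolding sums_unique[OF sums] by (rule sum_le_suminf) (use sums in \<open>auto simp: sums_iff\<close>)
  then show ?thesis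
    using complex_Re_le_cmod[of "zeta (of_real x)"] by simp
qed

section \<open>The Poisson--Jensen formula\<close>

text \<open>Near a the quotient is the nonvanishing local factor \<open>zor_poly f a\<close>,
  elsewhere it is f / (w - a)^m, and the two open pieces cover S. The point a may also be a nonzero
  of f, with exponent 0.\<close>

lemma holomorphic_factor_zero:
  assumes hol: "f holomorphic_on S" and S: "open S" "connected S" and a: "a \<in> S"
    and nz: "\<exists>w\<in>S. f w \<noteq> 0"
  obtains h where "h holomorphic_on S" "h a \<noteq> 0"
    "\<And>w. w \<in> S \<Longrightarrow> f w = (w - a) ^ nat (zorder f a) * h w"
proof -
  define m where "m = nat (zorder f a)"
  define g where "g = zor_poly f a"
  obtain r where r: "r > 0" "cball a r \<subseteq> S" "g holomorphic_on cball a r"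
    and g: "\<And>w. w \<in> cball a r \<Longrightarrow> f w = g w * (w - a) ^ m \<and> g w \<noteq> 0"
    using zorder_exist_zero[OF hol S a nz] unfolding m_def g_def by blast
  define h where "h w = (if w = a then g a else f w / (w - a) ^ m)" for w
  have h_eq: "h w = g w" if "w \<in> cball a r" for w
    using g[OF that] by (auto simp: h_def)
  have "h holomorphic_on ball a r"
    by (rule holomorphic_transform[of g]) (use r h_eq in \<open>auto intro: holomorphic_on_subset\<close>)
  moreover have "h holomorphic_on S - {a}"
    by (rule holomorphic_transform[of "\<lambda>w. f w / (w - a) ^ m"])
       (use hol in \<open>auto simp: h_def intro!: holomorphic_intros intro: holomorphic_on_subset\<close>)
  ultimately have "h holomorphic_on ball a r \<union> (S - {a})"
    using S by (intro holomorphic_on_Un) auto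
  moreover have "ball a r \<union> (S - {a}) = S"
    using r a by auto
  ultimately show ?thesis
    using that[of h] g[of a] h_eq[of a] r by (auto simp: h_def m_def)
qed

text \<open>The induction divides the previous quotient rather than f. The exponent is still the
  order of f, because orders add and the product P collected so far does not vanish at the new
  point.\<close>

lemma holomorphic_factor_zeros:
  assumes "finite Z" and hol: "f holomorphic_on S" and S: "open S" "connected S" and "Z \<subseteq> S"
    and nz: "\<exists>w\<in>S. f w \<noteq> 0"
  shows "\<exists>h. h holomorphic_on S \<and> (\<forall>a\<in>Z. h a \<noteq> 0) \<and>
           (\<forall>w\<in>S. f w = (\<Prod>a\<in>Z. (w - a) ^ nat (zorder f a)) * h w)"
  using \<open>finite Z\<close> \<open>Z \<subseteq> S\<close>
proof (induction Z rule: finite_induct)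
  case empty
  show ?case using hol by auto
next
  case (insert a Z)
  define P where "P w = (\<Prod>a\<in>Z. (w - a) ^ nat (zorder f a))" for w
  obtain h where h: "h holomorphic_on S" "\<And>a. a \<in> Z \<Longrightarrow> h a \<noteq> 0" "\<And>w. w \<in> S \<Longrightarrow> f w = P w * h w"
    using insert unfolding P_def by auto
  have a: "a \<in> S" and aZ: "a \<notin> Z" using insert by auto
  have nzh: "\<exists>w\<in>S. h w \<noteq> 0" using nz h(3) by auto
  have P: "P holomorphic_on UNIV" "P a \<noteq> 0"
    unfolding P_def using aZ \<open>finite Z\<close> by (auto intro!: holomorphic_intros)
  have "eventually (\<lambda>w. f w \<noteq> 0) (at a)"
  proof -
    obtain \<beta> where "\<beta> \<in> S" "f \<beta> \<noteq> 0" using nz by blast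
    from non_zero_neighbour_alt[OF hol S a this] show ?thesis
      by (auto elim: eventually_mono)
  qed
  moreover have ev: "eventually (\<lambda>w. w \<in> S) (at a)"
    using S a by (intro eventually_at_in_open') auto
  ultimately have "eventually (\<lambda>w. P w * h w \<noteq> 0) (at a)"
    by eventually_elim (use h in auto)
  moreover have "P analytic_on {a}" "h analytic_on {a}"
    using P h(1) S a by (auto simp: analytic_at intro: holomorphic_on_subset)
  ultimately have "zorder (\<lambda>w. P w * h w) a = zorder P a + zorder h a" "zorder P a = 0"
    using P by (auto intro: zorder_times_analytic zorder_eq_0I)
  moreover have "zorder f a = zorder (\<lambda>w. P w * h w) a"
    by (rule zorder_cong) (use ev h(3) in \<open>auto elim: eventually_mono\<close>)
  ultimately have ord: "zorder f a = zorder h a" by simp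
  obtain k where k: "k holomorphic_on S" "k a \<noteq> 0"
      "\<And>w. w \<in> S \<Longrightarrow> h w = (w - a) ^ nat (zorder h a) * k w"
    using holomorphic_factor_zero[OF h(1) S a nzh] by blast
  have "k b \<noteq> 0" if "b \<in> Z" for b
    using h(2)[OF that] k(3)[of b] that insert by auto
  moreover have "f w = (\<Prod>a\<in>insert a Z. (w - a) ^ nat (zorder f a)) * k w" if "w \<in> S" for w
    using h(3)[OF that] k(3)[OF that] insert by (simp add: P_def ord)
  ultimately show ?case
    using k by (intro exI[of _ k]) auto
qed

section \<open>Means over the circle and the Poisson kernel\<close>

definition unit_exp :: "real \<Rightarrow> complex" where
  "unit_exp t = cis (2 * pi * t)"

abbreviation unit_lborel :: "real measure" where
  "unit_lborel \<equiv> restrict_space lborel {0..1}"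

abbreviation circle_mean :: "(real \<Rightarrow> 'a::euclidean_space) \<Rightarrow> 'a" where
  "circle_mean \<equiv> integral\<^sup>L unit_lborel"

lemma norm_unit_exp [simp]: "norm (unit_exp t) = 1"
  by (simp add: unit_exp_def)

lemma unit_exp_nonzero [simp]: "unit_exp t \<noteq> 0"
  by (simp add: unit_exp_def)

lemma continuous_on_unit_exp [continuous_intros]:
  "continuous_on A f \<Longrightarrow> continuous_on A (\<lambda>x. unit_exp (f x))"
  unfolding unit_exp_def by (intro continuous_intros)

lemma borel_measurable_unit_exp [measurable]: "unit_exp \<in> borel_measurable borel"
  by (intro borel_measurable_continuous_onI continuous_intros)

lemma finite_measure_unit_lborel: "finite_measure unit_lborel"
  by (rule finite_measureI) (simp add: emeasure_restrict_space space_restrict_space)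

lemma has_integral_unit_lborel:
  fixes f :: "real \<Rightarrow> 'a::euclidean_space"
  assumes "continuous_on {0..1} f"
  shows integrable_unit_lborel_continuous: "integrable unit_lborel f"
    and integral_unit_lborel_continuous: "circle_mean f = integral {0..1} f"
proof -
  have "set_integrable lborel {0..1} f"
    using assms by (rule borel_integrable_atLeastAtMost')
  then show "integrable unit_lborel f" "circle_mean f = integral {0..1} f"
    using set_borel_integral_eq_integral[of "{0..1}" f]
    by (simp_all add: integrable_restrict_space integral_restrict_space set_integrable_def
        set_lebesgue_integral_def)
qed

definition poisson :: "real \<Rightarrow> complex \<Rightarrow> complex \<Rightarrow> real" where
  "poisson r p w = (r\<^sup>2 - (norm p)\<^sup>2) / (norm (w - p))\<^sup>2"

lemma continuous_on_poisson:
  assumes "norm p < r"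
  shows "continuous_on A (\<lambda>t. poisson r p (of_real r * unit_exp t))"
proof -
  have "of_real r * unit_exp t \<noteq> p" for t
    using assms by (auto simp: norm_mult)
  then show ?thesis
    unfolding poisson_def by (intro continuous_intros) auto
qed

lemma poisson_nonneg: "norm p < r \<Longrightarrow> poisson r p w \<ge> 0"
  unfolding poisson_def by (intro divide_nonneg_nonneg) (auto intro!: power_mono)

lemma poisson_at_0: "r > 0 \<Longrightarrow> poisson r 0 (of_real r * unit_exp t) = 1"
  by (simp add: poisson_def norm_mult)

text \<open>On the circle r^2 = w * cnj w, hence r^2 - cnj p * w = w * cnj (w - p). The left side is
  the Cauchy kernel at p, with the w that comes from dw, times a function holomorphic in the
  disc.\<close>

lemma poisson_kernel_circle:
  assumes "norm w = r" "norm p < r"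
  shows "w * of_real (r\<^sup>2 - (norm p)\<^sup>2) / ((w - p) * (of_real (r\<^sup>2) - cnj p * w)) = of_real (poisson r p w)"
proof -
  have "of_real (r\<^sup>2) = w * cnj w"
    using assms by (metis complex_norm_square of_real_power)
  then have "of_real (r\<^sup>2) - cnj p * w = w * cnj (w - p)"
    by (simp add: algebra_simps)
  moreover have "w \<noteq> 0" "w \<noteq> p" using assms by auto
  moreover have "(w - p) * cnj (w - p) = of_real ((norm (w - p))\<^sup>2)"
    by (metis complex_norm_square of_real_power)
  ultimately show ?thesis
    unfolding poisson_def by (simp add: divide_simps mult_ac)
qed

text \<open>For nonzero a the root r^2 / cnj a is the reflection of a in the circle of radius r and
  lies outside the closed disc.\<close>

lemma blaschke_factor_nonzero:
  assumes r: "0 < r" and "norm w \<le> r" "norm a < r"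
  shows "of_real (r\<^sup>2) - cnj a * w \<noteq> 0"
proof
  assume "of_real (r\<^sup>2) - cnj a * w = 0"
  then have "norm (complex_of_real (r\<^sup>2)) = norm a * norm w"
    by (metis complex_mod_cnj eq_iff_diff_eq_0 norm_mult)
  also have "\<dots> \<le> norm a * r"
    using assms by (intro mult_left_mono) auto
  also have "\<dots> < r * r"
    using assms by (intro mult_strict_right_mono) auto
  finally show False
    using r by (simp add: power2_eq_square norm_mult)
qed

lemma poisson_formula_holomorphic:
  assumes hol: "L holomorphic_on ball 0 R" and r: "0 < r" "r < R" and p: "norm p < r"
  shows "integral\<^sup>L unit_lborel
           (\<lambda>t. poisson r p (of_real r * unit_exp t) *\<^sub>R L (of_real r * unit_exp t)) = L p"
proof -
  let ?w = "\<lambda>t. of_real r * unit_exp t"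
  \<comment> \<open>k equals 1 at p, so Cauchy's formula for L * k returns L p, while on the circle
    k turns the Cauchy kernel into the Poisson kernel.\<close>
  define k where "k w = of_real (r\<^sup>2 - (norm p)\<^sup>2) / (of_real (r\<^sup>2) - cnj p * w)" for w
  have nz: "of_real (r\<^sup>2) - cnj p * w \<noteq> 0" if "norm w \<le> r" for w
    using blaschke_factor_nonzero r(1) that p .
  have k0: "k p = 1"
    using nz[of p] p unfolding k_def
    by (simp add: mult.commute[of "cnj p"] flip: complex_norm_square)
  have hol': "(\<lambda>w. L w * k w) holomorphic_on cball 0 r"
    unfolding k_def using nz r by (intro holomorphic_intros holomorphic_on_subset[OF hol]) auto
  have *: "((\<lambda>w. (L w * k w) / (w - p)) has_contour_integral (2 * of_real pi * \<i> * (L p * k p))) (circlepath 0 r)"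
    using hol' p by (intro Cauchy_integral_circlepath)
      (auto intro: holomorphic_on_imp_continuous_on holomorphic_on_subset)
  have "((\<lambda>t. (L (?w t) * k (?w t)) / (?w t - p) *
      (2 * pi * \<i> * ?w t)) has_integral (2 * of_real pi * \<i> * L p)) {0..1}"
  proof -
    have "circlepath 0 r x = of_real r * unit_exp x" for x
      by (simp add: circlepath unit_exp_def cis_conv_exp mult_ac)
    moreover have "vector_derivative (circlepath 0 r) (at x) = 2 * pi * \<i> * (of_real r * unit_exp x)" for x
      by (simp add: vector_derivative_circlepath unit_exp_def cis_conv_exp mult_ac)
    ultimately show ?thesis
      using * unfolding has_contour_integral by (simp only: k0 mult_1_right)
  qed
  then have "((\<lambda>t. (1 / (2 * pi * \<i>)) * ((L (?w t) * k (?w t)) / (?w t - p) *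
      (2 * pi * \<i> * ?w t))) has_integral (1 / (2 * pi * \<i>)) * (2 * of_real pi * \<i> * L p)) {0..1}"
    by (rule has_integral_mult_right)
  also have "(\<lambda>t. (1 / (2 * pi * \<i>)) * ((L (?w t) * k (?w t)) / (?w t - p) *
      (2 * pi * \<i> * ?w t))) =
      (\<lambda>t. poisson r p (?w t) *\<^sub>R L (?w t))"
  proof
    fix t
    show "(1 / (2 * pi * \<i>)) * ((L (?w t) * k (?w t)) / (?w t - p) *
      (2 * pi * \<i> * ?w t)) =
      poisson r p (?w t) *\<^sub>R L (?w t)"
    proof -
      have cancel: "(1 / x) * ((a * (c / d)) / e * (x * W)) = (W * c / (e * d)) * a"
        if "x \<noteq> 0" for x a c d e W :: complex
        using that by (simp add: mult_ac)
      have "norm (?w t) = r"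
        using r by (simp add: norm_mult)
      note poisson_kernel_circle[OF this p, symmetric]
      then show ?thesis
        unfolding scaleR_conv_of_real k_def by (simp only:) (intro cancel, simp)
    qed
  qed
  finally have "((\<lambda>t. poisson r p (?w t) *\<^sub>R L (?w t))
      has_integral L p) {0..1}"
    by simp
  moreover have "continuous_on {0..1} (\<lambda>t. poisson r p (?w t) *\<^sub>R L (?w t))"
    using r p
    by (intro continuous_intros continuous_on_poisson
        continuous_on_compose2[OF holomorphic_on_imp_continuous_on[OF hol]]) (auto simp: norm_mult)
  ultimately show ?thesis
    by (simp add: integral_unit_lborel_continuous integral_unique)
qed

lemma poisson_formula_ln_norm:
  assumes hol: "H holomorphic_on ball 0 R" and r: "0 < r" "r < R" and p: "norm p < r"
    and nz: "\<And>w. norm w \<le> r \<Longrightarrow> H w \<noteq> 0"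
  shows "integral\<^sup>L unit_lborel
           (\<lambda>t. poisson r p (of_real r * unit_exp t) * ln (norm (H (of_real r * unit_exp t)))) = ln (norm (H p))"
proof -
  \<comment> \<open>H may vanish outside the closed disc of radius r, but compactness leaves a
    slightly larger disc without zeros. There H has a holomorphic logarithm, whose real part is ln
    |H|.\<close>
  define U where "U = {w \<in> ball 0 R. H w \<noteq> 0}"
  have "open U"
    unfolding U_def using continuous_open_preimage[OF holomorphic_on_imp_continuous_on[OF hol], of "- {0}"]
    by (auto simp: vimage_def Int_def)
  moreover have "cball 0 r \<subseteq> U"
    using nz r by (auto simp: U_def)
  ultimately obtain \<epsilon> where \<epsilon>: "\<epsilon> > 0" "(\<Union>x\<in>cball 0 r. cball x \<epsilon>) \<subseteq> U"
    using compact_subset_open_imp_cball_epsilon_subset[of "cball 0 r" U] by auto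
  have sub: "ball 0 (r + \<epsilon>) \<subseteq> U"
  proof
    fix w :: complex assume "w \<in> ball 0 (r + \<epsilon>)"
    then have w: "norm w < r + \<epsilon>" by simp
    show "w \<in> U"
    proof (cases "norm w \<le> r")
      case False
      then have "norm w > 0" using r by linarith
      define x where "x = of_real (r / norm w) * w"
      have x: "x \<in> cball 0 r"
        using \<open>norm w > 0\<close> r by (simp add: x_def norm_mult norm_divide)
      have "x - w = of_real (r / norm w - 1) * w"
        by (simp add: x_def algebra_simps)
      then have "norm (x - w) = \<bar>r / norm w - 1\<bar> * norm w"
        by (simp only: norm_mult norm_of_real)
      moreover have "\<bar>r / norm w - 1\<bar> * norm w = norm w - r"
        using False \<open>norm w > 0\<close> by (simp add: abs_if field_simps)
      ultimately have "w \<in> cball x \<epsilon>"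
        using w by (simp add: dist_norm)
      then show ?thesis
        using \<epsilon> x by blast
    qed (use \<open>cball 0 r \<subseteq> U\<close> in auto)
  qed
  obtain L where L: "L holomorphic_on ball 0 (r + \<epsilon>)" "\<And>w. w \<in> ball 0 (r + \<epsilon>) \<Longrightarrow> exp (L w) = H w"
  proof (rule holomorphic_logarithm_exists[of "ball 0 (r + \<epsilon>)" H 0])
    show "H holomorphic_on ball 0 (r + \<epsilon>)"
      using sub by (intro holomorphic_on_subset[OF hol]) (auto simp: U_def)
    show "\<And>x. x \<in> ball 0 (r + \<epsilon>) \<Longrightarrow> H x \<noteq> 0"
      using sub by (auto simp: U_def)
  qed (use r \<epsilon> in auto)
  have Re_L: "Re (L w) = ln (norm (H w))" if "norm w \<le> r" for w
    using L(2)[of w, symmetric] that \<epsilon> by (simp add: norm_exp_eq_Re)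
  have "integral\<^sup>L unit_lborel
      (\<lambda>t. poisson r p (of_real r * unit_exp t) *\<^sub>R L (of_real r * unit_exp t)) = L p"
    using L r p \<epsilon> by (intro poisson_formula_holomorphic[where R = "r + \<epsilon>"]) auto
  moreover have "integrable unit_lborel (\<lambda>t. poisson r p (of_real r * unit_exp t) *\<^sub>R L (of_real r * unit_exp t))"
    using r p \<epsilon>
    by (intro integrable_unit_lborel_continuous continuous_intros continuous_on_poisson
        continuous_on_compose2[OF holomorphic_on_imp_continuous_on[OF L(1)]]) (auto simp: norm_mult)
  ultimately have "integral\<^sup>L unit_lborel
      (\<lambda>t. Re (poisson r p (of_real r * unit_exp t) *\<^sub>R L (of_real r * unit_exp t))) = Re (L p)"
    by (simp only: integral_Re)
  then show ?thesis
    using Re_L r p by (simp add: norm_mult)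
qed

text \<open>Each zero contributes its multiplicity times the Green function of the disc of radius r,
  taken at p and a. The case p = 0 is Jensen's formula; a general p makes it possible to weigh the
  boundary values near a single point.\<close>

lemma poisson_jensen:
  assumes hol: "G holomorphic_on ball 0 R" and r: "0 < r" "r < R" and p: "norm p < r"
    and nz: "\<And>w. norm w = r \<Longrightarrow> G w \<noteq> 0" and Gp: "G p \<noteq> 0"
  shows "integral\<^sup>L unit_lborel
           (\<lambda>t. poisson r p (of_real r * unit_exp t) * ln (norm (G (of_real r * unit_exp t)))) =
         ln (norm (G p)) +
         (\<Sum>a | norm a < r \<and> G a = 0. of_int (zorder G a) *
             ln (norm (of_real (r\<^sup>2) - cnj a * p) / (r * norm (p - a))))"
proof -
  define Z where "Z = {a. norm a < r \<and> G a = 0}"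
  have R: "p \<in> ball 0 R" using p r by auto
  have nconst: "\<not> G constant_on ball 0 R" if "a \<in> Z" for a
    using that R Gp r by (force simp: constant_on_def Z_def)
  have fin0: "finite {a \<in> cball 0 r. G a = 0}" if "a \<in> Z" for a
    using nconst[OF that] r hol by (intro holomorphic_compact_finite_zeros[where S = "ball 0 R"]) auto
  then have fin: "finite Z"
  proof (cases "Z = {}")
    case False
    moreover have "Z \<subseteq> {a \<in> cball 0 r. G a = 0}" by (auto simp: Z_def)
    ultimately show ?thesis using fin0 by (meson ex_in_conv finite_subset)
  qed auto
  define m where "m a = nat (zorder G a)" for a
  obtain h where h: "h holomorphic_on ball 0 R" "\<And>a. a \<in> Z \<Longrightarrow> h a \<noteq> 0"
    "\<And>w. w \<in> ball 0 R \<Longrightarrow> G w = (\<Prod>a\<in>Z. (w - a) ^ m a) * h w"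
    using holomorphic_factor_zeros[OF fin hol] R Gp r unfolding m_def by (force simp: Z_def)
  (* H has the same modulus as G on the circle, but no zeros inside. *)
  define H where "H w = (\<Prod>a\<in>Z. ((of_real (r\<^sup>2) - cnj a * w) / of_real r) ^ m a) * h w" for w
  have H_hol: "H holomorphic_on ball 0 R"
    unfolding H_def using h r by (auto intro!: holomorphic_intros)
  have h_nz: "h w \<noteq> 0" if "norm w \<le> r" for w
  proof (cases "w \<in> Z")
    case False
    then have "G w \<noteq> 0" using that nz[of w] by (cases "norm w = r") (auto simp: Z_def)
    then show ?thesis using h(3)[of w] that r by auto
  qed (use h in auto)
  have H_nz: "H w \<noteq> 0" if "norm w \<le> r" for w
    using h_nz[OF that] blaschke_factor_nonzero[OF r(1) that] fin r by (auto simp: H_def Z_def)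
  have norm_eq: "norm (H w) = norm (G w)" if "norm w = r" for w
  proof -
    have "norm ((of_real (r\<^sup>2) - cnj a * w) / of_real r) = norm (w - a)" for a
    proof -
      have "of_real (r\<^sup>2) - cnj a * w = w * cnj (w - a)"
        using that by (metis (no_types, lifting) complex_norm_square complex_cnj_diff mult.commute
            of_real_power right_diff_distrib')
      then show ?thesis
        using that r by (simp only: norm_divide norm_mult complex_mod_cnj) simp
    qed
    then have "norm (\<Prod>a\<in>Z. ((of_real (r\<^sup>2) - cnj a * w) / of_real r) ^ m a) = norm (\<Prod>a\<in>Z. (w - a) ^ m a)"
      by (simp only: prod_norm[symmetric] norm_power)
    then show ?thesis
      unfolding H_def using h(3)[of w] that r by (simp only: norm_mult) (simp add: norm_mult)
  qed
  \<comment> \<open>The reciprocal modulus of the Blaschke factor at p: exchanging one factor w - a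
    for its counterpart without zeros in the disc multiplies the modulus at p by
    \<open>q a\<close>.\<close>
  define q where "q a = norm (of_real (r\<^sup>2) - cnj a * p) / (r * norm (p - a))" for a
  have q_pos: "q a > 0" if "a \<in> Z" for a
    using that blaschke_factor_nonzero[of r p a] p r Gp unfolding q_def Z_def by (intro divide_pos_pos mult_pos_pos) auto
  have "norm (H p) = norm (G p) * (\<Prod>a\<in>Z. q a ^ m a)"
  proof -
    have "norm ((of_real (r\<^sup>2) - cnj a * p) / of_real r) = norm (p - a) * q a" if "a \<in> Z" for a
      using that Gp r unfolding q_def by (auto simp: Z_def norm_divide)
    then have "(\<Prod>a\<in>Z. norm ((of_real (r\<^sup>2) - cnj a * p) / of_real r) ^ m a) =
        (\<Prod>a\<in>Z. norm (p - a) ^ m a) * (\<Prod>a\<in>Z. q a ^ m a)"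
      by (simp add: prod.distrib power_mult_distrib)
    then show ?thesis
      unfolding H_def h(3)[OF R] by (simp add: norm_mult norm_power flip: prod_norm)
  qed
  moreover have "ln (\<Prod>a\<in>Z. q a ^ m a) = (\<Sum>a\<in>Z. of_int (zorder G a) * ln (q a))"
  proof -
    have "ln (\<Prod>a\<in>Z. q a ^ m a) = (\<Sum>a\<in>Z. ln (q a ^ m a))"
    proof (rule ln_prod)
      show "q a ^ m a \<noteq> 0" if "a \<in> Z" for a
        using q_pos[OF that] by simp
    qed (fact fin)
    also have "\<dots> = (\<Sum>a\<in>Z. of_int (zorder G a) * ln (q a))"
    proof (rule sum.cong)
      fix a assume a: "a \<in> Z"
      moreover have "\<exists>w\<in>ball 0 R. G w \<noteq> 0" using R Gp by blast
      ultimately have "zorder G a > 0"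
        using zorder_exist_zero[OF hol, of a] r by (auto simp: Z_def)
      then have "real (m a) = of_int (zorder G a)" by (simp add: m_def)
      then show "ln (q a ^ m a) = of_int (zorder G a) * ln (q a)"
        using q_pos[OF a] by (simp add: ln_realpow)
    qed simp
    finally show ?thesis .
  qed
  moreover have "(\<Prod>a\<in>Z. q a ^ m a) > 0"
    using q_pos by (intro prod_pos) auto
  ultimately have "ln (norm (H p)) = ln (norm (G p)) + (\<Sum>a\<in>Z. of_int (zorder G a) * ln (q a))"
    using Gp by (simp add: ln_mult)
  moreover have "integral\<^sup>L unit_lborel
      (\<lambda>t. poisson r p (of_real r * unit_exp t) * ln (norm (H (of_real r * unit_exp t)))) = ln (norm (H p))"
    using H_hol H_nz r p by (intro poisson_formula_ln_norm) auto
  moreover have "norm (of_real r * unit_exp t) = r" for t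
    using r by (simp add: norm_mult)
  ultimately show ?thesis
    unfolding Z_def q_def by (simp add: norm_eq)
qed

section \<open>Passage to the boundary circle\<close>

lemma unit_exp_eq_iff: "unit_exp s = unit_exp t \<longleftrightarrow> (\<exists>k::int. s = t + of_int k)"
proof -
  have "unit_exp s = unit_exp t \<longleftrightarrow> sin (2 * pi * s) = sin (2 * pi * t) \<and> cos (2 * pi * s) = cos (2 * pi * t)"
    by (auto simp: unit_exp_def complex_eq_iff)
  also have "\<dots> \<longleftrightarrow> (\<exists>k::int. 2 * pi * s = 2 * pi * t + 2 * pi * of_int k)"
    by (rule sin_cos_eq_iff)
  also have "\<dots> \<longleftrightarrow> (\<exists>k::int. 2 * pi * s = 2 * pi * (t + of_int k))"
    by (simp add: algebra_simps)
  finally show ?thesis by simp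
qed

lemma countable_unit_exp_vimage:
  assumes "countable N"
  shows "countable {t \<in> {0..1}. unit_exp t \<in> N}"
proof -
  have inj: "inj_on unit_exp {0..<1}"
  proof (rule inj_onI)
    fix s t :: real
    assume st: "s \<in> {0..<1}" "t \<in> {0..<1}" "unit_exp s = unit_exp t"
    then obtain k :: int where "s = t + of_int k" by (auto simp: unit_exp_eq_iff)
    moreover from this have "\<bar>real_of_int k\<bar> < 1" using st by auto
    then have "k = 0" by linarith
    ultimately show "s = t" by simp
  qed
  have "countable {t \<in> {0..<1}. unit_exp t \<in> N}"
  proof (rule countable_image_inj_on)
    show "countable (unit_exp ` {t \<in> {0..<1}. unit_exp t \<in> N})"
      by (rule countable_subset[OF _ assms]) blast
    show "inj_on unit_exp {t \<in> {0..<1}. unit_exp t \<in> N}"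
      by (rule inj_on_subset[OF inj]) blast
  qed
  moreover have "{t \<in> {0..1}. unit_exp t \<in> N} \<subseteq> insert 1 {t \<in> {0..<1}. unit_exp t \<in> N}"
    by force
  ultimately show ?thesis
    by (meson countable_insert countable_subset)
qed

text \<open>The exceptional sets on the circle are all countable: single points such as 1, the zeros
  of G, and the radial projections of finitely many zeros.\<close>

lemma AE_unit_exp_notin_countable:
  assumes "countable N"
  shows "AE t in unit_lborel. unit_exp t \<notin> N"
proof -
  have "AE t in lborel. t \<notin> {t \<in> {0..1}. unit_exp t \<in> N}"
    by (intro AE_not_in countable_imp_null_set_lborel countable_unit_exp_vimage assms)
  then show ?thesis
    by (subst AE_restrict_space_iff) auto
qed

lemma integrable_Fatou:
  fixes v :: "nat \<Rightarrow> 'a \<Rightarrow> real"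
  assumes int: "\<And>n. integrable M (v n)" and nonneg: "\<And>n. AE x in M. v n x \<ge> 0"
    and lim: "AE x in M. (\<lambda>n. v n x) \<longlonglongrightarrow> w x" and [measurable]: "w \<in> borel_measurable M"
    and L: "(\<lambda>n. integral\<^sup>L M (v n)) \<longlonglongrightarrow> L"
  shows "integrable M w" "integral\<^sup>L M w \<le> L"
proof -
  have [measurable]: "v n \<in> borel_measurable M" for n
    using int by auto
  have w_nonneg: "AE x in M. w x \<ge> 0"
  proof -
    have "AE x in M. \<forall>n. v n x \<ge> 0"
      using nonneg by (simp add: AE_all_countable)
    with lim show ?thesis
      by eventually_elim (auto intro: LIMSEQ_le_const)
  qed
  have L0: "L \<ge> 0"
    using L integral_nonneg_AE[OF nonneg] by (auto intro: LIMSEQ_le_const)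
  have "(\<integral>\<^sup>+x. ennreal (w x) \<partial>M) = (\<integral>\<^sup>+x. liminf (\<lambda>n. ennreal (v n x)) \<partial>M)"
    by (rule nn_integral_cong_AE) (use lim in \<open>eventually_elim; metis lim_imp_Liminf sequentially_bot tendsto_ennrealI\<close>)
  also have "\<dots> \<le> liminf (\<lambda>n. \<integral>\<^sup>+x. ennreal (v n x) \<partial>M)"
    by (rule nn_integral_liminf) simp
  also have "(\<lambda>n. \<integral>\<^sup>+x. ennreal (v n x) \<partial>M) = (\<lambda>n. ennreal (integral\<^sup>L M (v n)))"
    using int nonneg by (intro ext nn_integral_eq_integral)
  also have "liminf \<dots> = ennreal L"
    using L by (intro lim_imp_Liminf tendsto_ennrealI) auto
  finally have *: "(\<integral>\<^sup>+x. ennreal (w x) \<partial>M) \<le> ennreal L" .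
  show int: "integrable M w"
    by (rule integrableI_nonneg) (use * w_nonneg in \<open>auto simp: less_top[symmetric] top_unique\<close>)
  show "integral\<^sup>L M w \<le> L"
    using * L0 by (simp add: nn_integral_eq_integral[OF int w_nonneg])
qed

text \<open>As a lies on the unit circle, the radial displacement 1 - r is at most the distance from
  the interior point to a. So the boundary logarithm minus ln 2 is a lower bound at every radius at
  once.\<close>

lemma norm_unit_exp_diff_le:
  assumes "norm a = 1" "0 \<le> r" "r \<le> 1"
  shows "norm (unit_exp t - a) \<le> 2 * norm (of_real r * unit_exp t - a)"
proof -
  have "norm (unit_exp t - a) \<le> norm (of_real r * unit_exp t - a) + norm (of_real (1 - r) * unit_exp t)"
    by (rule order_trans[OF _ norm_triangle_ineq]) (simp add: algebra_simps)
  also have "norm (of_real (1 - r) * unit_exp t) = norm a - norm (of_real r * unit_exp t)"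
    using assms by (simp only: norm_mult norm_of_real norm_unit_exp) simp
  also have "\<dots> \<le> norm (of_real r * unit_exp t - a)"
    by (metis norm_minus_commute norm_triangle_ineq2)
  finally show ?thesis by simp
qed

text \<open>Inside the disc w - a has no zeros, so the mean over every smaller circle is ln |a| = 0.
  The case a = 1 disposes of the pole term of G; other points a serve as majorants for zeros near
  the boundary.\<close>

lemma ln_norm_unit_exp_diff:
  assumes a: "norm a = 1"
  shows integrable_ln_norm_unit_exp_diff: "integrable unit_lborel (\<lambda>t. ln (norm (unit_exp t - a)))"
    and integral_ln_norm_unit_exp_diff: "circle_mean (\<lambda>t. ln (norm (unit_exp t - a))) = 0"
proof -
  define r :: "nat \<Rightarrow> real" where "r n = 1 - 1 / (real n + 2)" for n
  have r: "0 < r n" "r n < 1" for n by (auto simp: r_def field_simps)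
  have r_lim: "r \<longlonglongrightarrow> 1"
    unfolding r_def by real_asymp
  define u where "u n t = ln (norm (of_real (r n) * unit_exp t - a))" for n t
  have nz: "of_real (r n) * unit_exp t \<noteq> a" for n t
  proof
    assume "of_real (r n) * unit_exp t = a"
    then have "norm (of_real (r n) * unit_exp t) = 1" using a by simp
    then show False using r(1)[of n] r(2)[of n] by (simp add: norm_mult)
  qed
  have u_cont: "continuous_on {0..1} (u n)" for n
    unfolding u_def using nz by (intro continuous_intros) auto
  note u_int = integrable_unit_lborel_continuous[OF u_cont]
  have u_0: "circle_mean (u n) = 0" for n
  proof -
    have "circle_mean (\<lambda>t. poisson (r n) 0 (of_real (r n) * unit_exp t) *
        ln (norm (of_real (r n) * unit_exp t - a))) = ln (norm (0 - a))"
    proof (rule poisson_formula_ln_norm[where R = 1 and H = "\<lambda>w. w - a"])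
      show "w - a \<noteq> 0" if "norm w \<le> r n" for w
        using that r(2)[of n] a by auto
    qed (use r in \<open>auto intro!: holomorphic_intros\<close>)
    then show ?thesis
      using r a by (simp add: u_def[abs_def] poisson_at_0)
  qed
  have le2: "norm (of_real (r n) * unit_exp t - a) \<le> 2" for n t
    using norm_triangle_ineq4[of "of_real (r n) * unit_exp t" a] r[of n] a by (simp add: norm_mult)
  have u_le: "u n t \<le> ln 2" for n t
    unfolding u_def using nz[of n t] le2[of n t] by (subst ln_le_cancel_iff) auto
  have AE_ne: "AE t in unit_lborel. unit_exp t \<noteq> a"
    using AE_unit_exp_notin_countable[of "{a}"] by simp
  have lim: "AE t in unit_lborel. (\<lambda>n. u n t) \<longlonglongrightarrow> ln (norm (unit_exp t - a))"
    using AE_ne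
  proof eventually_elim
    case (elim t)
    have "(\<lambda>n. ln (norm (of_real (r n) * unit_exp t - a))) \<longlonglongrightarrow> ln (norm (of_real 1 * unit_exp t - a))"
      using elim by (intro tendsto_intros r_lim) auto
    then show ?case by (simp add: u_def)
  qed
  \<comment> \<open>Fatou's lemma for \<open>ln 2 - u n\<close>, which is nonnegative because the
    distance to a is at most 2, is used for integrability alone; the integrable limit then supplies
    the dominating function for the convergence of the means.\<close>
  have "integrable unit_lborel (\<lambda>t. ln 2 - ln (norm (unit_exp t - a)))"
  proof (rule integrable_Fatou(1)[where v = "\<lambda>n t. ln 2 - u n t" and L = "ln 2"])
    show "AE t in unit_lborel. (\<lambda>n. ln 2 - u n t) \<longlonglongrightarrow> ln 2 - ln (norm (unit_exp t - a))"
      using lim by eventually_elim (intro tendsto_intros)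
    show "(\<lambda>n. circle_mean (\<lambda>t. ln 2 - u n t)) \<longlonglongrightarrow> ln 2"
      using finite_measure_unit_lborel u_int
      by (simp add: u_0 Bochner_Integration.integral_diff finite_measure.integrable_const
          measure_restrict_space space_restrict_space)
  qed (use u_int u_le finite_measure_unit_lborel in \<open>auto simp: finite_measure.integrable_const measurable_restrict_space1\<close>)
  from Bochner_Integration.integrable_diff[OF finite_measure.integrable_const[OF finite_measure_unit_lborel, of "ln 2"] this]
  show int: "integrable unit_lborel (\<lambda>t. ln (norm (unit_exp t - a)))"
    by simp
  have "(\<lambda>n. circle_mean (u n)) \<longlonglongrightarrow> circle_mean (\<lambda>t. ln (norm (unit_exp t - a)))"
  proof (rule integral_dominated_convergence[where w = "\<lambda>t. 2 * ln 2 + \<bar>ln (norm (unit_exp t - a))\<bar>"])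
    show "integrable unit_lborel (\<lambda>t. 2 * ln 2 + \<bar>ln (norm (unit_exp t - a))\<bar>)"
      using int finite_measure_unit_lborel by (auto simp: finite_measure.integrable_const)
    show "AE t in unit_lborel. norm (u n t) \<le> 2 * ln 2 + \<bar>ln (norm (unit_exp t - a))\<bar>" for n
      using AE_ne
    proof eventually_elim
      case (elim t)
      have "ln (norm (unit_exp t - a)) \<le> ln (2 * norm (of_real (r n) * unit_exp t - a))"
        using elim nz[of n t] norm_unit_exp_diff_le[OF a, of "r n" t] r[of n]
        by (subst ln_le_cancel_iff) auto
      also have "\<dots> = ln 2 + u n t"
        using nz[of n t] by (simp add: u_def ln_mult)
      finally show ?case
        using u_le[of n t] unfolding real_norm_def by (smt (verit) ln_ge_zero)
    qed
  qed (use lim u_int int in auto)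
  then show "circle_mean (\<lambda>t. ln (norm (unit_exp t - a))) = 0"
    by (simp add: u_0 LIMSEQ_const_iff)
qed

text \<open>The radii tend to 1 but are not assumed monotone, so J is squeezed: a finite part F of Z
  eventually lies inside the disc of radius r n, where the remaining terms are nonnegative, and
  every term is at most its limit.\<close>

lemma jensen_sums_tendsto:
  fixes m :: "complex \<Rightarrow> real" and r :: "nat \<Rightarrow> real"
  assumes Z: "\<And>a. a \<in> Z \<Longrightarrow> 0 < norm a \<and> norm a < 1" and m: "\<And>a. a \<in> Z \<Longrightarrow> m a \<ge> 0"
    and fin: "\<And>n. finite {a \<in> Z. norm a < r n}"
    and r: "\<And>n. 0 < r n \<and> r n < 1" "r \<longlonglongrightarrow> 1"
    and bound: "\<And>n. (\<Sum>a | a \<in> Z \<and> norm a < r n. m a * ln (r n / norm a)) \<le> B"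
  shows "(\<lambda>a. m a * ln (1 / norm a)) summable_on Z" (is "?c summable_on Z")
    and "(\<lambda>n. \<Sum>a | a \<in> Z \<and> norm a < r n. m a * ln (r n / norm a)) \<longlonglongrightarrow> (\<Sum>\<^sub>\<infinity>a\<in>Z. m a * ln (1 / norm a))"
      (is "?J \<longlonglongrightarrow> _")
proof -
  have c_nonneg: "?c a \<ge> 0" if "a \<in> Z" for a
    using Z[OF that] m[OF that] by (intro mult_nonneg_nonneg ln_ge_zero) auto
  have part: "(\<lambda>n. \<Sum>a\<in>F. m a * ln (r n / norm a)) \<longlonglongrightarrow> (\<Sum>a\<in>F. ?c a)" if "finite F" "F \<subseteq> Z" for F
    using that Z r by (intro tendsto_intros) (auto simp: subset_iff)
  have part_le: "\<forall>\<^sub>F n in sequentially. (\<Sum>a\<in>F. m a * ln (r n / norm a)) \<le> ?J n"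
    if "finite F" "F \<subseteq> Z" for F
  proof -
    have "\<forall>\<^sub>F n in sequentially. \<forall>a\<in>F. norm a < r n"
      using that Z order_tendstoD(1)[OF r(2)] by (intro eventually_ball_finite) (auto simp: subset_iff)
    then show ?thesis
    proof eventually_elim
      case (elim n)
      have "0 \<le> m a * ln (r n / norm a)" if "a \<in> Z" "norm a < r n" for a
        using that Z[OF that(1)] m[OF that(1)] by (intro mult_nonneg_nonneg ln_ge_zero) (auto simp: field_simps)
      then show ?case
        using that elim by (intro sum_mono2 fin) auto
    qed
  qed
  have "(\<Sum>a\<in>F. ?c a) \<le> B" if "finite F" "F \<subseteq> Z" for F
    by (rule tendsto_upperbound[OF part[OF that]])
       (use part_le[OF that] bound in \<open>auto elim!: eventually_mono intro: order_trans\<close>)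
  then show sm: "?c summable_on Z"
    using c_nonneg by (intro nonneg_bdd_above_summable_on) (auto simp: bdd_above_def)
  have J_le: "?J n \<le> infsum ?c Z" for n
  proof -
    have "?J n \<le> (\<Sum>a | a \<in> Z \<and> norm a < r n. ?c a)"
    proof (rule sum_mono)
      fix a assume a: "a \<in> {a \<in> Z. norm a < r n}"
      then have "ln (r n / norm a) \<le> ln (1 / norm a)"
        using Z[of a] r(1)[of n] by (intro ln_mono divide_right_mono divide_pos_pos) auto
      then show "m a * ln (r n / norm a) \<le> ?c a"
        using a m by (intro mult_left_mono) auto
    qed
    also have "\<dots> \<le> infsum ?c Z"
      using fin[of n] c_nonneg by (intro finite_sum_le_infsum sm) auto
    finally show ?thesis .
  qed
  show "?J \<longlonglongrightarrow> infsum ?c Z"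
  proof (rule order_tendstoI)
    fix y assume y: "y < infsum ?c Z"
    have "(?c has_sum infsum ?c Z) Z" using sm by (rule has_sum_infsum)
    then have "\<forall>\<^sub>F F in finite_subsets_at_top Z. y < sum ?c F"
      unfolding has_sum_def using y by (rule order_tendstoD(1))
    then obtain F where F: "finite F" "F \<subseteq> Z" "y < sum ?c F"
      unfolding eventually_finite_subsets_at_top by blast
    have "\<forall>\<^sub>F n in sequentially. y < (\<Sum>a\<in>F. m a * ln (r n / norm a))"
      by (rule order_tendstoD(1)[OF part[OF F(1,2)] F(3)])
    with part_le[OF F(1,2)] show "\<forall>\<^sub>F n in sequentially. y < ?J n"
      by eventually_elim linarith
  next
    fix y assume "infsum ?c Z < y"
    then show "\<forall>\<^sub>F n in sequentially. ?J n < y"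
      using J_le by (auto intro!: always_eventually intro: le_less_trans)
  qed
qed

lemma fsigma_open:
  fixes S :: "'a::euclidean_space set"
  assumes "open S"
  shows "fsigma S"
proof -
  obtain K :: "nat \<Rightarrow> 'a set" where K: "\<And>n. compact (K n)" "\<And>n. K n \<subseteq> S" "\<Union> (range K) = S"
    using open_Union_compact_subsets[OF assms] by metis
  have "fsigma (\<Union> (range K))"
    by (intro fsigma.intros compact_imp_closed K)
  then show ?thesis using K by simp
qed

text \<open>The moduli of the zeros form a countable set, so every interval below 1 contains good
  radii. On circles without zeros the logarithms are continuous and the Poisson-Jensen formula
  applies.\<close>

lemma exists_radii_avoiding_zeros:
  assumes "G holomorphic_on ball 0 1" "G 0 \<noteq> 0"
  obtains r :: "nat \<Rightarrow> real" where "\<And>n. 0 < r n \<and> r n < 1" "r \<longlonglongrightarrow> 1"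
    "\<And>n w. norm w = r n \<Longrightarrow> G w \<noteq> (0::complex)"
proof -
  define B where "B = norm ` {a \<in> ball 0 1. G a = 0}"
  have "countable B"
  proof (cases "\<exists>a\<in>ball 0 1. G a = 0")
    case True
    then have "\<not> G constant_on ball 0 1"
      using assms by (force simp: constant_on_def)
    then show ?thesis
      unfolding B_def using assms(1)
      by (intro countable_image holomorphic_countable_zeros fsigma_open) auto
  next
    case False
    then have "B = {}" by (auto simp: B_def)
    then show ?thesis by simp
  qed
  have "\<exists>x. x \<in> {1 - 1 / (real n + 2)<..<1} - B" for n
  proof -
    have "uncountable ({1 - 1 / (real n + 2)<..<1} - B)"
      by (intro uncountable_minus_countable \<open>countable B\<close>) (simp add: uncountable_open_interval field_simps)
    then show ?thesis
      by (metis countable_empty ex_in_conv)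
  qed
  then obtain r where r: "\<And>n. r n \<in> {1 - 1 / (real n + 2)<..<1} - B"
    by metis
  have gt: "1 - 1 / (real n + 2) < r n" "r n < 1" for n
    using r[of n] by auto
  show ?thesis
  proof (rule that)
    show "0 < r n \<and> r n < 1" for n
    proof -
      have "0 < 1 - 1 / (real n + 2)" by (simp add: field_simps)
      then show ?thesis using gt[of n] by linarith
    qed
    have "(\<lambda>n. 1 - 1 / (real n + 2)) \<longlonglongrightarrow> 1"
      by real_asymp
    then show "r \<longlonglongrightarrow> 1"
      by (rule tendsto_sandwich[rotated 2, OF _ tendsto_const])
         (use gt in \<open>auto intro!: always_eventually less_imp_le\<close>)
    show "G w \<noteq> 0" if "norm w = r n" for n w
    proof
      assume "G w = 0"
      then have "r n \<in> B"
        unfolding B_def using that gt[of n] by (intro image_eqI[of _ _ w]) auto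
      then show False using r[of n] by auto
    qed
  qed
qed

text \<open>The point r sgn a lies at distance | |a| - r | from a, which is at most the distance
  from the circle point to a; dividing by r >= 1/2 turns the factor 2 into 4. A zero is thus
  replaced by its projection to the unit circle, in a bound free of r.\<close>

lemma norm_unit_exp_diff_sgn_le:
  assumes "r \<ge> 1/2" "a \<noteq> 0"
  shows "norm (unit_exp t - sgn a) \<le> 4 * norm (of_real r * unit_exp t - a)"
proof -
  have "r * norm (unit_exp t - sgn a) = norm (of_real r * unit_exp t - of_real r * sgn a)"
    using assms by (simp add: norm_mult flip: right_diff_distrib)
  also have "\<dots> \<le> norm (of_real r * unit_exp t - a) + norm (a - of_real r * sgn a)"
    by (rule order_trans[OF _ norm_triangle_ineq]) simp
  also have "a - of_real r * sgn a = of_real (norm a - r) * sgn a"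
    using assms by (simp add: sgn_eq algebra_simps)
  also have "norm (of_real (norm a - r) * sgn a) = \<bar>norm a - norm (of_real r * unit_exp t)\<bar>"
    using assms by (simp only: norm_mult norm_of_real) (simp add: norm_sgn)
  also have "\<dots> \<le> norm (of_real r * unit_exp t - a)"
    by (metis norm_minus_commute norm_triangle_ineq3)
  finally have "r * norm (unit_exp t - sgn a) \<le> 2 * norm (of_real r * unit_exp t - a)" by simp
  moreover have "(1/2) * norm (unit_exp t - sgn a) \<le> r * norm (unit_exp t - sgn a)"
    using assms by (intro mult_right_mono) auto
  ultimately show ?thesis by simp
qed

text \<open>The numerator is at least \<delta>/2, because r exceeds 1 - \<delta> by that much and
  their sum is at least 1; the denominator is at most (3 \<delta>)^2. The quotient is 1 / (18
  \<delta>).\<close>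

lemma poisson_ge_near_1:
  assumes "0 < \<delta>" "\<delta> \<le> 1/4" "1 - \<delta> / 2 < r" "r < 1" "norm (unit_exp t - 1) < \<delta>"
  shows "poisson r (of_real (1 - \<delta>)) (of_real r * unit_exp t) \<ge> 1 / (18 * \<delta>)"
proof -
  have "of_real r * unit_exp t - of_real (1 - \<delta>) =
      of_real r * (unit_exp t - 1) + of_real (r - (1 - \<delta>))"
    by (simp add: algebra_simps)
  then have "norm (of_real r * unit_exp t - of_real (1 - \<delta>)) \<le>
      norm (of_real r * (unit_exp t - 1)) + norm (complex_of_real (r - (1 - \<delta>)))"
    by (metis norm_triangle_ineq)
  also have "\<dots> = \<bar>r\<bar> * norm (unit_exp t - 1) + \<bar>r - (1 - \<delta>)\<bar>"
    by (simp only: norm_mult norm_of_real)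
  also have "\<dots> \<le> 1 * \<delta> + \<delta>"
    using assms by (intro add_mono mult_mono) auto
  finally have "norm (of_real r * unit_exp t - of_real (1 - \<delta>)) \<le> 3 * \<delta>"
    using assms by simp
  then have le: "(norm (of_real r * unit_exp t - of_real (1 - \<delta>)))\<^sup>2 \<le> (3 * \<delta>)\<^sup>2"
    by (rule power_mono) simp
  have "norm (complex_of_real (1 - \<delta>)) < r"
    using assms by (simp only: norm_of_real)
  then have "of_real r * unit_exp t \<noteq> of_real (1 - \<delta>)"
    using assms by (metis abs_of_nonneg less_irrefl mult.right_neutral norm_mult norm_of_real
        norm_unit_exp le_less_trans less_imp_le norm_ge_zero)
  then have pos: "0 < (norm (of_real r * unit_exp t - of_real (1 - \<delta>)))\<^sup>2"
    by simp
  have "\<delta> / 2 * 1 \<le> (r - (1 - \<delta>)) * (r + (1 - \<delta>))"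
    using assms by (intro mult_mono) auto
  also have "\<dots> = r\<^sup>2 - (norm (complex_of_real (1 - \<delta>)))\<^sup>2"
    by (simp only: norm_of_real power2_abs) (simp add: algebra_simps power2_eq_square)
  finally have num: "\<delta> / 2 \<le> r\<^sup>2 - (norm (complex_of_real (1 - \<delta>)))\<^sup>2"
    by simp
  have "1 / (18 * \<delta>) = (\<delta> / 2) / (3 * \<delta>)\<^sup>2"
    using assms by (simp add: power2_eq_square)
  also have "\<dots> \<le> poisson r (of_real (1 - \<delta>)) (of_real r * unit_exp t)"
    unfolding poisson_def by (rule frac_le[OF _ num pos le]) (use assms num in linarith)
  finally show ?thesis .
qed

lemma norm_circle: "0 \<le> r \<Longrightarrow> norm (of_real r * unit_exp t) = r"
  by (simp add: norm_mult)

lemma circle_neq_1: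
  assumes "0 \<le> r" "r < 1"
  shows "of_real r * unit_exp t \<noteq> 1"
proof
  assume "of_real r * unit_exp t = 1"
  with norm_circle[OF assms(1), of t] assms(2) show False by simp
qed

section \<open>Jensen's formula on the boundary for a function with one singular point on the
  circle\<close>

locale jensen_at_boundary =
  fixes G :: "complex \<Rightarrow> complex" and C :: real
  assumes G_hol: "G holomorphic_on - {1}" and G_0: "G 0 = 1" and C: "C > 0"
    and G_le: "\<And>w. norm w \<le> 1 \<Longrightarrow> w \<noteq> 1 \<Longrightarrow> norm (G w) \<le> C / norm (1 - w)"
    and G_ge: "\<And>x. 0 \<le> x \<Longrightarrow> x < 1 \<Longrightarrow> norm (G (of_real x)) \<ge> x"
begin

definition defect :: "complex \<Rightarrow> real" where
  "defect w = ln C - ln (norm (w - 1)) - ln (norm (G w))"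

lemma defect_nonneg:
  assumes "norm w \<le> 1" "w \<noteq> 1" "G w \<noteq> 0"
  shows "defect w \<ge> 0"
proof -
  have "ln (norm (G w)) \<le> ln (C / norm (w - 1))"
    using assms G_le[OF assms(1,2)] by (subst ln_le_cancel_iff) (auto simp: C norm_minus_commute)
  then show ?thesis
    using assms C by (simp add: defect_def ln_div)
qed

lemma G_hol_ball: "r \<le> 1 \<Longrightarrow> G holomorphic_on ball 0 r"
  by (rule holomorphic_on_subset[OF G_hol]) auto

lemma continuous_on_G_circle:
  assumes "0 \<le> r" "r < 1"
  shows "continuous_on A (\<lambda>t. G (of_real r * unit_exp t))"
  by (rule continuous_on_compose2[OF holomorphic_on_imp_continuous_on[OF G_hol]])
     (use circle_neq_1[OF assms] in \<open>auto intro!: continuous_intros\<close>)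

text \<open>ln |C / (w - 1)| is harmonic in the disc, so its Poisson integral at x is exact. That of
  ln |G| is at least ln |G(x)| >= ln x, since in the Poisson-Jensen formula the zeros only
  add.\<close>

lemma poisson_integral_defect_le:
  assumes r: "0 < r" "r < 1" and nz: "\<And>w. norm w = r \<Longrightarrow> G w \<noteq> 0" and x: "0 < x" "x < r"
  shows "circle_mean (\<lambda>t. poisson r (of_real x) (of_real r * unit_exp t) *
           defect (of_real r * unit_exp t)) \<le> ln C - ln (1 - x) - ln x"
proof -
  let ?w = "\<lambda>t. of_real r * unit_exp t"
  have nw: "norm (?w t) = r" for t using r by (simp add: norm_mult)
  have w1: "?w t \<noteq> 1" for t
    using r by (intro circle_neq_1) auto
  have px: "norm (complex_of_real x) < r" using x by simp
  have Gx: "norm (G (of_real x)) \<ge> x" using G_ge x r by simp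
  have "circle_mean (\<lambda>t. poisson r (of_real x) (?w t) * ln (norm (of_real C / (?w t - 1)))) =
      ln (norm (complex_of_real C / (of_real x - 1)))"
    by (rule poisson_formula_ln_norm[where R = 1 and H = "\<lambda>w. of_real C / (w - 1)"])
       (use r px C in \<open>auto intro!: holomorphic_intros\<close>)
  also have "\<dots> = ln C - ln (1 - x)"
  proof -
    have "norm (complex_of_real x - 1) = 1 - x"
      using x r by (metis abs_minus_commute abs_of_pos diff_gt_0_iff_gt norm_of_real of_real_1 of_real_diff order_less_trans)
    then show ?thesis using C x r by (simp add: norm_divide ln_div)
  qed
  finally have 1: "circle_mean (\<lambda>t. poisson r (of_real x) (?w t) * ln (norm (of_real C / (?w t - 1)))) =
      ln C - ln (1 - x)" .
  have "0 \<le> (\<Sum>a | norm a < r \<and> G a = 0. of_int (zorder G a) *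
             ln (norm (of_real (r\<^sup>2) - cnj a * of_real x) / (r * norm (of_real x - a))))"
  proof (intro sum_nonneg mult_nonneg_nonneg)
    fix a assume a: "a \<in> {a. norm a < r \<and> G a = 0}"
    have "zorder G a > 0"
      using zorder_exist_zero[OF G_hol_ball[of 1], of a] a r G_0 by force
    then show "(0::real) \<le> of_int (zorder G a)" by simp
    have "a \<noteq> of_real x" using a Gx x by auto
    then have pos: "0 < r * norm (of_real x - a)" using r by simp
    \<comment> \<open>This identity is the positivity of the Green function: both factors on its
      right side are nonnegative inside the circle.\<close>
    have "(norm (of_real (r\<^sup>2) - cnj a * of_real x))\<^sup>2 - (r * norm (of_real x - a))\<^sup>2 =
        (r\<^sup>2 - (norm a)\<^sup>2) * (r\<^sup>2 - x\<^sup>2)"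
      unfolding cmod_power2 power_mult_distrib
      by (simp add: power2_eq_square) algebra
    moreover have "(r\<^sup>2 - (norm a)\<^sup>2) * (r\<^sup>2 - x\<^sup>2) \<ge> 0"
      using a x r by (intro mult_nonneg_nonneg) (simp_all add: power_mono)
    ultimately have "(r * norm (of_real x - a))\<^sup>2 \<le> (norm (of_real (r\<^sup>2) - cnj a * of_real x))\<^sup>2"
      by linarith
    then have "r * norm (of_real x - a) \<le> norm (of_real (r\<^sup>2) - cnj a * of_real x)"
      by (rule power2_le_imp_le) (rule norm_ge_zero)
    then show "0 \<le> ln (norm (of_real (r\<^sup>2) - cnj a * of_real x) / (r * norm (of_real x - a)))"
      using pos by (intro ln_ge_zero) (simp add: le_divide_eq)
  qed
  moreover have "circle_mean (\<lambda>t. poisson r (of_real x) (?w t) * ln (norm (G (?w t)))) =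
      ln (norm (G (of_real x))) + (\<Sum>a | norm a < r \<and> G a = 0. of_int (zorder G a) *
             ln (norm (of_real (r\<^sup>2) - cnj a * of_real x) / (r * norm (of_real x - a))))"
    using poisson_jensen[OF G_hol_ball[of 1] r(1) r(2) px nz] Gx x by force
  moreover have "ln x \<le> ln (norm (G (of_real x)))"
    using Gx x by (intro ln_mono) auto
  ultimately have 2: "circle_mean (\<lambda>t. poisson r (of_real x) (?w t) * ln (norm (G (?w t)))) \<ge> ln x"
    by linarith
  have contG: "continuous_on {0..1} (\<lambda>t. G (?w t))"
    using r by (intro continuous_on_G_circle) auto
  have "circle_mean (\<lambda>t. poisson r (of_real x) (?w t) * defect (?w t)) =
      circle_mean (\<lambda>t. poisson r (of_real x) (?w t) * ln (norm (of_real C / (?w t - 1))) -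
         poisson r (of_real x) (?w t) * ln (norm (G (?w t))))"
    using w1 C by (intro Bochner_Integration.integral_cong)
      (auto simp: defect_def norm_divide ln_div right_diff_distrib)
  also have "\<dots> = (ln C - ln (1 - x)) -
      circle_mean (\<lambda>t. poisson r (of_real x) (?w t) * ln (norm (G (?w t))))"
    unfolding 1[symmetric] using w1 nz nw px C contG
    by (intro Bochner_Integration.integral_diff integrable_unit_lborel_continuous
        continuous_intros continuous_on_poisson) auto
  finally show ?thesis using 2 by linarith
qed

lemma integral_defect_near_1_le:
  assumes \<delta>: "0 < \<delta>" "\<delta> \<le> 1/4" and r: "1 - \<delta> / 2 < r" "r < 1"
    and nz: "\<And>w. norm w = r \<Longrightarrow> G w \<noteq> 0"
  shows "circle_mean (\<lambda>t. indicator {t. norm (unit_exp t - 1) < \<delta>} t * defect (of_real r * unit_exp t))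
           \<le> 18 * \<delta> * (ln C - ln \<delta> - ln (1 - \<delta>))"
proof -
  let ?w = "\<lambda>t. of_real r * unit_exp t"
  let ?P = "\<lambda>t. poisson r (of_real (1 - \<delta>)) (?w t)"
  have r0: "r > 0" using \<delta> r by linarith
  have nw: "norm (?w t) = r" for t using r0 by (simp add: norm_mult)
  have w1: "?w t \<noteq> 1" for t
    using r r0 by (intro circle_neq_1) auto
  have px: "norm (complex_of_real (1 - \<delta>)) < r" using \<delta> r by (simp only: norm_of_real)
  have def0: "defect (?w t) \<ge> 0" for t
    using nw w1 r nz by (intro defect_nonneg) auto
  have contG: "continuous_on {0..1} (\<lambda>t. G (?w t))"
    using r r0 by (intro continuous_on_G_circle) auto
  have cont: "continuous_on {0..1} (\<lambda>t. defect (?w t))"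
    unfolding defect_def using w1 nz nw contG by (intro continuous_intros) auto
  have int: "integrable unit_lborel (\<lambda>t. 18 * \<delta> * (?P t * defect (?w t)))"
    by (intro integrable_unit_lborel_continuous continuous_intros continuous_on_poisson cont px)
  have meas: "{t. norm (unit_exp t - 1) < \<delta>} \<in> sets borel"
    by measurable
  have "circle_mean (\<lambda>t. indicator {t. norm (unit_exp t - 1) < \<delta>} t * defect (?w t))
      \<le> circle_mean (\<lambda>t. 18 * \<delta> * (?P t * defect (?w t)))"
  proof (rule integral_mono_AE)
    show "integrable unit_lborel (\<lambda>t. indicator {t. norm (unit_exp t - 1) < \<delta>} t * defect (?w t))"
    proof (rule Bochner_Integration.integrable_bound[OF integrable_unit_lborel_continuous[OF cont]])
      have "(indicator {t. norm (unit_exp t - 1) < \<delta>} :: real \<Rightarrow> real) \<in> borel_measurable unit_lborel"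
        using meas by (intro measurable_restrict_space1) simp
      moreover have "(\<lambda>t. defect (?w t)) \<in> borel_measurable unit_lborel"
        using integrable_unit_lborel_continuous[OF cont] by simp
      ultimately show "(\<lambda>t. indicator {t. norm (unit_exp t - 1) < \<delta>} t * defect (?w t))
          \<in> borel_measurable unit_lborel"
        by (rule borel_measurable_times)
    qed (auto simp: indicator_def)
    show "AE t in unit_lborel. indicator {t. norm (unit_exp t - 1) < \<delta>} t * defect (?w t) \<le>
        18 * \<delta> * (?P t * defect (?w t))"
    proof (rule AE_I2)
      fix t
      show "indicator {t. norm (unit_exp t - 1) < \<delta>} t * defect (?w t) \<le> 18 * \<delta> * (?P t * defect (?w t))"
      proof (cases "norm (unit_exp t - 1) < \<delta>")
        case True
        then have "1 \<le> 18 * \<delta> * ?P t"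
          using poisson_ge_near_1[OF \<delta> r True] \<delta> by (simp add: field_simps)
        then have "1 * defect (?w t) \<le> (18 * \<delta> * ?P t) * defect (?w t)"
          using def0 by (intro mult_right_mono)
        then show ?thesis using True by (simp add: mult.assoc)
      qed (use def0 poisson_nonneg[OF px] \<delta> in auto)
    qed
  qed (rule int)
  also have "\<dots> = 18 * \<delta> * circle_mean (\<lambda>t. ?P t * defect (?w t))"
    by simp
  also have "circle_mean (\<lambda>t. ?P t * defect (?w t)) \<le> ln C - ln (1 - (1 - \<delta>)) - ln (1 - \<delta>)"
    using \<delta> r r0 nz by (intro poisson_integral_defect_le) auto
  finally show ?thesis using \<delta> by simp
qed

lemma not_constant_if_zero:
  assumes "G a = 0" "a \<noteq> 1"
  shows "\<not> G constant_on - {1}"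
  using assms G_0 unfolding constant_on_def by (metis Compl_iff insertE singletonI empty_iff zero_neq_one)

lemma connected_minus_1: "connected (- {1 :: complex})"
  by (intro connected_punctured_universe) auto

lemma countable_zeros: "countable {w \<in> - {1}. G w = 0}"
proof (cases "\<exists>a. a \<noteq> 1 \<and> G a = 0")
  case True
  then show ?thesis
    using not_constant_if_zero
    by (intro holomorphic_countable_zeros G_hol connected_minus_1 fsigma_open) auto
next
  case False
  then have "{w \<in> - {1}. G w = 0} = {}" by auto
  then show ?thesis by (simp only: countable_empty)
qed

lemma AE_unit_exp_nonzero: "AE t in unit_lborel. unit_exp t \<noteq> 1 \<and> G (unit_exp t) \<noteq> 0"
  using AE_unit_exp_notin_countable[OF countable_insert[OF countable_zeros, of 1]]
  by eventually_elim auto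

lemma borel_measurable_G: "G \<in> borel_measurable borel"
proof -
  have "(\<lambda>w. if w \<in> - {1} then G w else G 1) \<in> borel_measurable borel"
    by (rule borel_measurable_continuous_on_if)
       (auto intro!: holomorphic_on_imp_continuous_on G_hol)
  also have "(\<lambda>w. if w \<in> - {1} then G w else G 1) = G"
    by auto
  finally show ?thesis .
qed

lemma borel_measurable_defect [measurable]: "defect \<in> borel_measurable borel"
  unfolding defect_def using borel_measurable_G by measurable

text \<open>Away from w = 1 the defect is large only near zeros of G, of which the compact set K
  contains finitely many. Factoring them out leaves a bounded logarithm, and each zero is majorised
  by the integrable logarithm at its projection to the circle, uniformly in r.\<close>

lemma defect_dominated:
  assumes \<delta>: "0 < \<delta>" "\<delta> \<le> 1/4"
  obtains g where "integrable unit_lborel g"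
    "\<And>r. 1 - \<delta> / 2 < r \<Longrightarrow> r < 1 \<Longrightarrow> (\<And>w. norm w = r \<Longrightarrow> G w \<noteq> 0) \<Longrightarrow>
      AE t in unit_lborel. norm (unit_exp t - 1) \<ge> \<delta> \<longrightarrow> defect (of_real r * unit_exp t) \<le> g t"
proof -
  \<comment> \<open>Contains every point of radius r over an angle at distance at least \<delta>
    from 1, since the radial shift 1 - r is below \<delta>/2. The bound 1/2 keeps zeros away from 0,
    where \<open>sgn\<close> gives no point of the circle.\<close>
  define K where "K = {w :: complex. 1/2 \<le> norm w \<and> norm w \<le> 1 \<and> \<delta> / 2 \<le> norm (w - 1)}"
  have "K = cball 0 1 \<inter> {w. 1/2 \<le> norm w} \<inter> {w. \<delta> / 2 \<le> norm (w - 1)}"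
    by (auto simp: K_def)
  moreover have "closed {w :: complex. 1/2 \<le> norm w}" "closed {w :: complex. \<delta> / 2 \<le> norm (w - 1)}"
    by (intro closed_Collect_le continuous_intros)+
  ultimately have "compact K"
    by (auto intro!: compact_Int_closed)
  have K_sub: "K \<subseteq> - {1}" using \<delta> by (auto simp: K_def)
  define Z where "Z = {a \<in> K. G a = 0}"
  have "finite Z"
  proof (cases "Z = {}")
    case False
    then obtain a where "a \<in> K" "G a = 0" by (auto simp: Z_def)
    then have "\<not> G constant_on - {1}"
      using K_sub by (intro not_constant_if_zero[of a]) auto
    then show ?thesis
      unfolding Z_def using \<open>compact K\<close> K_sub
      by (intro holomorphic_compact_finite_zeros[where S = "- {1}"] G_hol connected_minus_1) auto
  qed simp
  define m where "m a = nat (zorder G a)" for a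
  obtain h where h: "h holomorphic_on - {1}" "\<And>a. a \<in> Z \<Longrightarrow> h a \<noteq> 0"
    "\<And>w. w \<noteq> 1 \<Longrightarrow> G w = (\<Prod>a\<in>Z. (w - a) ^ m a) * h w"
  proof -
    have "\<exists>w\<in>- {1}. G w \<noteq> 0" using G_0 by (intro bexI[of _ 0]) auto
    moreover have "Z \<subseteq> - {1}" using K_sub by (auto simp: Z_def)
    ultimately obtain h where h: "h holomorphic_on - {1}" "\<forall>a\<in>Z. h a \<noteq> 0"
      "\<forall>w\<in>- {1}. G w = (\<Prod>a\<in>Z. (w - a) ^ nat (zorder G a)) * h w"
      using holomorphic_factor_zeros[OF \<open>finite Z\<close> G_hol _ connected_minus_1] by auto
    show ?thesis
      by (rule that[of h]) (use h in \<open>auto simp: m_def\<close>)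
  qed
  have h_nz: "h w \<noteq> 0" if "w \<in> K" for w
  proof (cases "w \<in> Z")
    case False
    moreover have "w \<noteq> 1" using that K_sub by auto
    ultimately show ?thesis using that h(3)[of w] by (auto simp: Z_def)
  qed (use h in auto)
  have "continuous_on K (\<lambda>w. ln (norm (h w)))"
    using h_nz K_sub h(1)
    by (intro continuous_intros holomorphic_on_imp_continuous_on holomorphic_on_subset[OF h(1)]) auto
  then have "bounded ((\<lambda>w. ln (norm (h w))) ` K)"
    by (intro compact_imp_bounded compact_continuous_image \<open>compact K\<close>)
  then obtain M where M: "\<And>w. w \<in> K \<Longrightarrow> \<bar>ln (norm (h w))\<bar> \<le> M"
    unfolding bounded_iff by auto
  define g where "g t = ln C - ln (\<delta> / 2) + M +
      (\<Sum>a\<in>Z. real (m a) * (ln 4 - ln (norm (unit_exp t - sgn a))))" for t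
  have sgnZ: "norm (sgn a) = 1" if "a \<in> Z" for a
    using that by (auto simp: Z_def K_def norm_sgn)
  have "integrable unit_lborel g"
    unfolding g_def using sgnZ
    by (intro Bochner_Integration.integrable_add Bochner_Integration.integrable_diff
        Bochner_Integration.integrable_sum integrable_mult_right integrable_ln_norm_unit_exp_diff
        finite_measure.integrable_const finite_measure_unit_lborel) auto
  moreover have "AE t in unit_lborel. norm (unit_exp t - 1) \<ge> \<delta> \<longrightarrow> defect (of_real r * unit_exp t) \<le> g t"
    if r: "1 - \<delta> / 2 < r" "r < 1" and nz: "\<And>w. norm w = r \<Longrightarrow> G w \<noteq> 0" for r
  proof -
    have "AE t in unit_lborel. unit_exp t \<notin> sgn ` Z"
      using \<open>finite Z\<close> by (intro AE_unit_exp_notin_countable countable_finite) auto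
    then show ?thesis
    proof eventually_elim
      case (elim t)
      show ?case
      proof
        assume ge: "\<delta> \<le> norm (unit_exp t - 1)"
        define w where "w = of_real r * unit_exp t"
        have r0: "r \<ge> 1/2" using r \<delta> by linarith
        have nw: "norm w = r" using r0 by (simp add: w_def norm_mult)
        have "unit_exp t - 1 = (w - 1) + of_real (1 - r) * unit_exp t"
          by (simp add: w_def algebra_simps)
        then have "norm (unit_exp t - 1) \<le> norm (w - 1) + norm (of_real (1 - r) * unit_exp t)"
          by (metis norm_triangle_ineq)
        also have "norm (of_real (1 - r) * unit_exp t) = 1 - r"
          using r by (simp only: norm_mult norm_of_real norm_unit_exp) simp
        finally have w1: "\<delta> / 2 \<le> norm (w - 1)" using ge r by linarith
        have wK: "w \<in> K" using nw r0 r w1 by (auto simp: K_def)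
        have Gw: "G w \<noteq> 0" using nz nw by auto
        then have wa: "w \<noteq> a" if "a \<in> Z" for a using that by (auto simp: Z_def)
        have "w \<noteq> 1" using w1 \<delta> by auto
        have "norm (G w) = (\<Prod>a\<in>Z. norm (w - a) ^ m a) * norm (h w)"
          by (simp add: h(3)[OF \<open>w \<noteq> 1\<close>] norm_mult norm_power flip: prod_norm)
        moreover have "(\<Prod>a\<in>Z. norm (w - a) ^ m a) > 0"
          using wa by (intro prod_pos) auto
        ultimately have "ln (norm (G w)) = ln (\<Prod>a\<in>Z. norm (w - a) ^ m a) + ln (norm (h w))"
          using h_nz[OF wK] by (simp add: ln_mult)
        also have "ln (\<Prod>a\<in>Z. norm (w - a) ^ m a) = (\<Sum>a\<in>Z. ln (norm (w - a) ^ m a))"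
          using wa \<open>finite Z\<close> by (intro ln_prod) auto
        also have "\<dots> = (\<Sum>a\<in>Z. real (m a) * ln (norm (w - a)))"
          using wa by (intro sum.cong) (auto simp: ln_realpow)
        finally have lnG: "ln (norm (G w)) = (\<Sum>a\<in>Z. real (m a) * ln (norm (w - a))) + ln (norm (h w))" .
        have "(\<Sum>a\<in>Z. real (m a) * (ln (norm (unit_exp t - sgn a)) - ln 4)) \<le> (\<Sum>a\<in>Z. real (m a) * ln (norm (w - a)))"
        proof (intro sum_mono mult_left_mono)
          fix a assume a: "a \<in> Z"
          then have "a \<noteq> 0" by (auto simp: Z_def K_def)
          have "ln (norm (unit_exp t - sgn a)) \<le> ln (4 * norm (w - a))"
            using elim a norm_unit_exp_diff_sgn_le[OF r0 \<open>a \<noteq> 0\<close>, of t] by (intro ln_mono) (auto simp: w_def)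
          also have "\<dots> = ln 4 + ln (norm (w - a))"
            using wa[OF a] by (simp add: ln_mult)
          finally show "ln (norm (unit_exp t - sgn a)) - ln 4 \<le> ln (norm (w - a))" by simp
        qed simp
        moreover have "(\<Sum>a\<in>Z. real (m a) * (ln (norm (unit_exp t - sgn a)) - ln 4)) =
            - (\<Sum>a\<in>Z. real (m a) * (ln 4 - ln (norm (unit_exp t - sgn a))))"
          by (simp add: algebra_simps flip: sum_negf)
        moreover have "ln (\<delta> / 2) \<le> ln (norm (w - 1))"
          using w1 \<delta> by (intro ln_mono) auto
        ultimately show "defect (of_real r * unit_exp t) \<le> g t"
          using M[OF wK] unfolding defect_def w_def[symmetric] lnG g_def by linarith
      qed
    qed
  qed
  ultimately show ?thesis by (rule that)
qed

lemma mean_ln_norm_boundary: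
  defines "Z \<equiv> {a. norm a < 1 \<and> G a = 0}"
  shows integrable_ln_norm_boundary: "integrable unit_lborel (\<lambda>t. ln (norm (G (unit_exp t))))"
    and summable_zeros: "(\<lambda>a. of_int (zorder G a) * ln (1 / norm a)) summable_on Z"
    and integral_ln_norm_boundary: "circle_mean (\<lambda>t. ln (norm (G (unit_exp t)))) =
           (\<Sum>\<^sub>\<infinity>a\<in>Z. of_int (zorder G a) * ln (1 / norm a))"
proof -
  obtain r :: "nat \<Rightarrow> real" where r: "\<And>n. 0 < r n \<and> r n < 1" and r_lim: "r \<longlonglongrightarrow> 1"
    and nz: "\<And>n w. norm w = r n \<Longrightarrow> G w \<noteq> 0"
    using exists_radii_avoiding_zeros[OF G_hol_ball[of 1]] G_0 by auto
  have r0: "0 < r n" and r1: "r n < 1" for n using r[of n] by auto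
  let ?w = "\<lambda>n t. of_real (r n) * unit_exp t"
  have nw: "norm (?w n t) = r n" for n t using r0[of n] by (simp add: norm_mult)
  have w1: "?w n t \<noteq> 1" for n t
    using r0 r1 by (intro circle_neq_1) (auto intro: less_imp_le)
  define v where "v n t = defect (?w n t)" for n t
  define v' where "v' t = defect (unit_exp t)" for t
  define J where "J n = (\<Sum>a | a \<in> Z \<and> norm a < r n. of_int (zorder G a) * ln (r n / norm a))" for n
  have contG: "continuous_on {0..1} (\<lambda>t. G (?w n t))" for n
    using r0 r1 by (intro continuous_on_G_circle) (auto intro: less_imp_le)
  have int1: "integrable unit_lborel (\<lambda>t. ln (norm (G (?w n t))))"
    and int2: "integrable unit_lborel (\<lambda>t. ln (norm (?w n t - 1)))" for n
    using w1 nz[OF nw] by (intro integrable_unit_lborel_continuous continuous_intros contG; simp)+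
  have const: "integrable unit_lborel (\<lambda>t. c :: real)" "circle_mean (\<lambda>t. c :: real) = c" for c
    using finite_measure_unit_lborel
    by (auto simp: finite_measure.integrable_const measure_restrict_space space_restrict_space)
  have v_int: "integrable unit_lborel (v n)" for n
    unfolding v_def[abs_def] defect_def by (intro Bochner_Integration.integrable_diff int1 int2 const)
  have v_nonneg: "v n t \<ge> 0" for n t
    unfolding v_def using nw[of n t] r1[of n] w1 nz[OF nw] by (intro defect_nonneg) auto
  \<comment> \<open>The term with w - 1 has mean ln |0 - 1| = 0, and Jensen's formula with G(0) = 1
    leaves only the sum over the zeros.\<close>
  have v_integral: "circle_mean (v n) = ln C - J n" for n
  proof -
    have "circle_mean (\<lambda>t. poisson (r n) 0 (?w n t) * ln (norm (?w n t - 1))) = ln (norm (0 - 1 :: complex))"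
    proof (rule poisson_formula_ln_norm[where R = 1 and H = "\<lambda>w. w - 1"])
      show "w - 1 \<noteq> 0" if "norm w \<le> r n" for w :: complex
        using that r1[of n] by auto
    qed (use r0 r1 in \<open>auto intro!: holomorphic_intros\<close>)
    then have 1: "circle_mean (\<lambda>t. ln (norm (?w n t - 1))) = 0"
      using r0[of n] by (simp add: poisson_at_0)
    have "circle_mean (\<lambda>t. poisson (r n) 0 (?w n t) * ln (norm (G (?w n t)))) =
        ln (norm (G 0)) + (\<Sum>a | norm a < r n \<and> G a = 0. of_int (zorder G a) *
             ln (norm (of_real ((r n)\<^sup>2) - cnj a * 0) / (r n * norm (0 - a))))"
      using r0[of n] r1[of n] nz G_0 by (intro poisson_jensen[where R = 1] G_hol_ball) auto
    also have "\<dots> = J n"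
    proof -
      have "{a. norm a < r n \<and> G a = 0} = {a. a \<in> Z \<and> norm a < r n}"
        using r1[of n] by (auto simp: Z_def)
      moreover have "norm (of_real ((r n)\<^sup>2) - cnj a * 0) / (r n * norm (0 - a)) = r n / norm a" for a
        using r0[of n] by (simp add: norm_mult power2_eq_square)
      ultimately show ?thesis by (simp only: J_def G_0) simp
    qed
    finally have 2: "circle_mean (\<lambda>t. ln (norm (G (?w n t)))) = J n"
      using r0[of n] by (simp add: poisson_at_0)
    show ?thesis
      unfolding v_def[abs_def] defect_def
      by (simp add: Bochner_Integration.integral_diff Bochner_Integration.integrable_diff int1 int2 const 1 2
          measure_restrict_space)
  qed
  \<comment> \<open>Nonnegativity of the defect is what makes the sum over all zeros
    converge.\<close>
  have J_le: "J n \<le> ln C" for n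
  proof -
    have "0 \<le> circle_mean (v n)"
      by (rule integral_nonneg_AE) (simp add: v_nonneg)
    then show ?thesis by (simp add: v_integral)
  qed
  have zorder_nonneg: "zorder G a \<ge> 0" if "a \<in> Z" for a
    using zorder_exist_zero[OF G_hol_ball[of 1], of a] that G_0 by (force simp: Z_def)
  have fin: "finite {a \<in> Z. norm a < r n}" for n
  proof (cases "{a \<in> Z. norm a < r n} = {}")
    case False
    then obtain a where "a \<in> Z" "norm a < 1" by (auto simp: Z_def)
    then have "\<not> G constant_on - {1}"
      by (intro not_constant_if_zero[of a]) (auto simp: Z_def)
    then have "finite {a \<in> cball 0 (r n). G a = 0}"
      using r1[of n] by (intro holomorphic_compact_finite_zeros[OF G_hol _ connected_minus_1]) auto
    then show ?thesis by (rule finite_subset[rotated]) (auto simp: Z_def)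
  qed (simp only: finite.emptyI)
  have Z01: "0 < norm a \<and> norm a < 1" if "a \<in> Z" for a
    using that G_0 by (auto simp: Z_def)
  note sums = jensen_sums_tendsto[OF Z01 _ fin r r_lim J_le[unfolded J_def]]
  show summable: "(\<lambda>a. of_int (zorder G a) * ln (1 / norm a)) summable_on Z"
    by (rule sums(1)) (use zorder_nonneg in auto)
  define S where "S = (\<Sum>\<^sub>\<infinity>a\<in>Z. of_int (zorder G a) * ln (1 / norm a))"
  have J_lim: "J \<longlonglongrightarrow> S"
    unfolding J_def[abs_def] S_def by (rule sums(2)) (use zorder_nonneg in auto)
  have v_lim: "AE t in unit_lborel. (\<lambda>n. v n t) \<longlonglongrightarrow> v' t"
    using AE_unit_exp_nonzero
  proof eventually_elim
    case (elim t)
    have "isCont G (unit_exp t)"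
      using elim holomorphic_on_imp_continuous_on[OF G_hol]
      by (intro continuous_on_interior[of "- {1}"]) (auto simp: interior_complement)
    moreover have w_lim: "(\<lambda>n. ?w n t) \<longlonglongrightarrow> of_real 1 * unit_exp t"
      by (intro tendsto_intros r_lim)
    ultimately have "(\<lambda>n. G (?w n t)) \<longlonglongrightarrow> G (unit_exp t)"
      by (intro isCont_tendsto_compose[of _ G]) auto
    with w_lim show ?case
      unfolding v_def v'_def defect_def using elim by (intro tendsto_intros) auto
  qed
  have v'_meas: "v' \<in> borel_measurable unit_lborel"
    unfolding v'_def[abs_def] by (intro measurable_restrict_space1) measurable
  have v_int_lim: "(\<lambda>n. circle_mean (v n)) \<longlonglongrightarrow> ln C - S"
    unfolding v_integral by (intro tendsto_intros J_lim)
  have v'_int: "integrable unit_lborel v'" and v'_le: "circle_mean v' \<le> ln C - S"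
    using integrable_Fatou[OF v_int _ v_lim v'_meas v_int_lim] v_nonneg by auto
  have v'_nonneg: "AE t in unit_lborel. v' t \<ge> 0"
    using AE_unit_exp_nonzero by eventually_elim (auto simp: v'_def intro!: defect_nonneg)
  \<comment> \<open>Off the arc N the defects are dominated and their integrals converge; on N they
    carry at most the subtracted term, whatever the radius. That term is of order \<delta> ln
    (1/\<delta>).\<close>
  have lower: "ln C - S - 18 * \<delta> * (ln C - ln \<delta> - ln (1 - \<delta>)) \<le> circle_mean v'"
    if \<delta>: "0 < \<delta>" "\<delta> \<le> 1/4" for \<delta>
  proof -
    define N where "N = {t. norm (unit_exp t - 1) < \<delta>}"
    have [measurable]: "N \<in> sets borel" unfolding N_def by measurable
    have indN: "(indicator N :: real \<Rightarrow> real) \<in> borel_measurable unit_lborel"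
      by (intro measurable_restrict_space1) measurable
    obtain g where g: "integrable unit_lborel g"
      "\<And>r. 1 - \<delta> / 2 < r \<Longrightarrow> r < 1 \<Longrightarrow> (\<And>w. norm w = r \<Longrightarrow> G w \<noteq> 0) \<Longrightarrow>
        AE t in unit_lborel. norm (unit_exp t - 1) \<ge> \<delta> \<longrightarrow> defect (of_real r * unit_exp t) \<le> g t"
    proof (rule defect_dominated[OF \<delta>])
      fix g assume "integrable unit_lborel g"
        and "\<And>r. 1 - \<delta> / 2 < r \<Longrightarrow> r < 1 \<Longrightarrow> (\<And>w. norm w = r \<Longrightarrow> G w \<noteq> 0) \<Longrightarrow>
        AE t in unit_lborel. norm (unit_exp t - 1) \<ge> \<delta> \<longrightarrow> defect (of_real r * unit_exp t) \<le> g t"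
      then show thesis by (rule that)
    qed
    have "\<forall>\<^sub>F n in sequentially. 1 - \<delta> / 2 < r n"
      using \<delta> by (intro order_tendstoD(1)[OF r_lim]) auto
    then obtain n0 where n0: "\<And>n. n \<ge> n0 \<Longrightarrow> 1 - \<delta> / 2 < r n"
      unfolding eventually_sequentially by blast
    define f where "f n t = v (n + n0) t - indicator N t * v (n + n0) t" for n t
    have iNv: "integrable unit_lborel (\<lambda>t. indicator N t * w t)"
      if "integrable unit_lborel w" for w :: "real \<Rightarrow> real"
    proof (rule Bochner_Integration.integrable_bound[OF that])
      show "(\<lambda>t. indicator N t * w t) \<in> borel_measurable unit_lborel"
        using that by (intro borel_measurable_times indN) auto
    qed (simp add: indicator_def)
    have f_lim: "(\<lambda>n. circle_mean (f n)) \<longlonglongrightarrow>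
        circle_mean (\<lambda>t. v' t - indicator N t * v' t)"
    proof (rule integral_dominated_convergence[where w = "\<lambda>t. \<bar>g t\<bar>"])
      show "integrable unit_lborel (\<lambda>t. \<bar>g t\<bar>)" using g(1) by simp
      show "(\<lambda>t. v' t - indicator N t * v' t) \<in> borel_measurable unit_lborel"
        using v'_meas indN by measurable
      show "f n \<in> borel_measurable unit_lborel" for n
        unfolding f_def[abs_def] using v_int iNv[OF v_int] by measurable
      show "AE t in unit_lborel. (\<lambda>n. f n t) \<longlonglongrightarrow> v' t - indicator N t * v' t"
        using v_lim unfolding f_def
        by eventually_elim (intro tendsto_intros LIMSEQ_ignore_initial_segment)
      show "AE t in unit_lborel. norm (f n t) \<le> \<bar>g t\<bar>" for n
      proof -
        have "AE t in unit_lborel. norm (unit_exp t - 1) \<ge> \<delta> \<longrightarrow> defect (of_real (r (n + n0)) * unit_exp t) \<le> g t"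
          by (rule g(2)) (use n0 r1 nz in auto)
        then show ?thesis
      proof eventually_elim
        case (elim t)
        show ?case
        proof (cases "t \<in> N")
          case False
          then have "v (n + n0) t \<le> g t" using elim by (auto simp: N_def v_def)
          then show ?thesis using False v_nonneg[of "n + n0" t] by (simp add: f_def)
        qed (simp add: f_def)
      qed
      qed
    qed
    have "ln C - J (n + n0) - 18 * \<delta> * (ln C - ln \<delta> - ln (1 - \<delta>)) \<le> circle_mean (f n)" for n
    proof -
      have "circle_mean (\<lambda>t. indicator N t * v (n + n0) t) \<le> 18 * \<delta> * (ln C - ln \<delta> - ln (1 - \<delta>))"
        unfolding N_def v_def using \<delta> n0 r1 nz by (intro integral_defect_near_1_le) auto
      moreover have "circle_mean (f n) = (ln C - J (n + n0)) -
          circle_mean (\<lambda>t. indicator N t * v (n + n0) t)"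
        unfolding f_def v_integral[symmetric] by (intro Bochner_Integration.integral_diff v_int iNv)
      ultimately show ?thesis by linarith
    qed
    moreover have "(\<lambda>n. ln C - J (n + n0) - 18 * \<delta> * (ln C - ln \<delta> - ln (1 - \<delta>))) \<longlonglongrightarrow>
        ln C - S - 18 * \<delta> * (ln C - ln \<delta> - ln (1 - \<delta>))"
      by (intro tendsto_intros LIMSEQ_ignore_initial_segment J_lim)
    ultimately have "ln C - S - 18 * \<delta> * (ln C - ln \<delta> - ln (1 - \<delta>)) \<le>
        circle_mean (\<lambda>t. v' t - indicator N t * v' t)"
      using f_lim by (intro LIMSEQ_le) auto
    also have "\<dots> \<le> circle_mean v'"
      by (intro integral_mono_AE Bochner_Integration.integrable_diff v'_int iNv)
         (use v'_nonneg in \<open>eventually_elim; simp add: indicator_def\<close>)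
    finally show ?thesis .
  qed
  have "((\<lambda>\<delta>. ln C - S - 18 * \<delta> * (ln C - ln \<delta> - ln (1 - \<delta>))) \<longlongrightarrow> ln C - S) (at_right 0)"
    by real_asymp
  moreover have "\<forall>\<^sub>F \<delta> in at_right 0. ln C - S - 18 * \<delta> * (ln C - ln \<delta> - ln (1 - \<delta>)) \<le> circle_mean v'"
    using eventually_at_right_less[of "0::real"] eventually_at_right_field[of _ "0::real"]
    by (auto intro!: exI[of _ "1/4"] lower)
  ultimately have "ln C - S \<le> circle_mean v'"
    by (rule tendsto_upperbound) simp
  with v'_le have v'_eq: "circle_mean v' = ln C - S" by simp
  \<comment> \<open>True for every t, also where a logarithm takes a dummy value, since the defect
    is this difference by definition. Upon integration ln C cancels and the middle term
    vanishes.\<close>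
  have G_eq: "(\<lambda>t. ln (norm (G (unit_exp t)))) = (\<lambda>t. ln C - ln (norm (unit_exp t - 1)) - v' t)"
    by (simp add: v'_def defect_def)
  have int3: "integrable unit_lborel (\<lambda>t. ln (norm (unit_exp t - 1)))"
    and int4: "circle_mean (\<lambda>t. ln (norm (unit_exp t - 1))) = 0"
    using ln_norm_unit_exp_diff[of 1] by auto
  show "integrable unit_lborel (\<lambda>t. ln (norm (G (unit_exp t))))"
    unfolding G_eq by (intro Bochner_Integration.integrable_diff const int3 v'_int)
  have "circle_mean (\<lambda>t. ln C - ln (norm (unit_exp t - 1)) - v' t) = S"
    by (simp add: Bochner_Integration.integral_diff Bochner_Integration.integrable_diff const int3 int4 v'_int v'_eq
        measure_restrict_space)
  then show "circle_mean (\<lambda>t. ln (norm (G (unit_exp t)))) =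
           (\<Sum>\<^sub>\<infinity>a\<in>Z. of_int (zorder G a) * ln (1 / norm a))"
    unfolding G_eq S_def .
qed

end

section \<open>Moving averages under a measure-preserving map\<close>

(* If an interval (x + n, x + n + k] with (n, k) in W and k <= K meets (c, c + K], then c - x lies in
   the tent over K. *)
definition tent :: "(nat \<times> nat) set \<Rightarrow> nat \<Rightarrow> int set" where
  "tent W K = {m. \<exists>(n, k)\<in>W. k \<le> K \<and> \<bar>m - int n\<bar> < int K}"

text \<open>Linear growth of the tents is the form in which the Stoltz condition enters the covering
  argument. Finiteness is asked for separately because \<open>card\<close> is 0 on infinite sets; k
  > 0 makes every interval nonempty.\<close>

definition tent_bound :: "(nat \<times> nat) set \<Rightarrow> real \<Rightarrow> bool" where
  "tent_bound W B \<longleftrightarrow> (\<forall>(n, k)\<in>W. k > 0) \<and>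
     (\<forall>K>0. finite (tent W K) \<and> real (card (tent W K)) \<le> B * real K)"

lemma tent_mono: "W \<subseteq> W' \<Longrightarrow> tent W K \<subseteq> tent W' K"
  by (force simp: tent_def)

lemma tent_bound_mono:
  assumes "tent_bound W' B" "W \<subseteq> W'"
  shows "tent_bound W B"
  unfolding tent_bound_def
proof (intro conjI allI impI)
  show "\<forall>(n, k)\<in>W. 0 < k" using assms unfolding tent_bound_def by blast
  fix K :: nat assume "K > 0"
  then have *: "finite (tent W' K)" "real (card (tent W' K)) \<le> B * real K"
    using assms(1) unfolding tent_bound_def by auto
  show "finite (tent W K)" using *(1) tent_mono[OF assms(2)] by (rule finite_subset[rotated])
  show "real (card (tent W K)) \<le> B * real K"
    using *(2) card_mono[OF *(1) tent_mono[OF assms(2)]] by (meson of_nat_mono order_trans)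
qed

text \<open>Greedy selection as in Vitali's lemma: take the point x0 with the longest interval. The
  points whose intervals meet it are at most B k(x0) many by the tent bound, and they are paid for
  by the sum over that one interval; the other points are left to the induction.\<close>

lemma covering_bound:
  fixes \<phi> :: "nat \<Rightarrow> real"
  assumes tb: "tent_bound W B" and "finite X" and l: "l > 0"
    and nk: "\<And>x. x \<in> X \<Longrightarrow> (n x, k x) \<in> W \<and> x + n x + k x \<le> L"
    and \<phi>: "\<And>j. \<phi> j \<ge> 0"
    and big: "\<And>x. x \<in> X \<Longrightarrow> (\<Sum>j\<in>{x + n x<..x + n x + k x}. \<phi> j) \<ge> l * real (k x)"
  shows "l * real (card X) \<le> B * (\<Sum>j\<le>L. \<phi> j)"
  using \<open>finite X\<close> nk \<phi> big
proof (induction "card X" arbitrary: X \<phi> rule: less_induct)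
  case less
  have B: "B \<ge> 0"
  proof -
    have "0 \<le> B * real 1" using tb unfolding tent_bound_def
      by (metis (no_types, opaque_lifting) less_numeral_extra(1) of_nat_0_le_iff order_trans)
    then show ?thesis by simp
  qed
  show ?case
  proof (cases "X = {}")
    case True
    then show ?thesis using less.prems B by (auto intro!: mult_nonneg_nonneg sum_nonneg)
  next
    case False
    define I where "I x = {x + n x<..x + n x + k x}" for x
    have "finite (k ` X)" "k ` X \<noteq> {}" using False less.prems by auto
    then obtain x0 where x0: "x0 \<in> X" "k x0 = Max (k ` X)"
      using Max_in by (metis (no_types, lifting) imageE)
    have k_max: "k x \<le> k x0" if "x \<in> X" for x
      using that x0 less.prems by simp
    define X' where "X' = {x \<in> X. I x \<inter> I x0 \<noteq> {}}"
    define c where "c = x0 + n x0"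
    have k0: "k x > 0" if "x \<in> X" for x
      using less.prems(2)[OF that] tb unfolding tent_bound_def by auto
    have fin: "finite X'" "finite (X - X')" using less.prems by (auto simp: X'_def)
    have "I x0 \<noteq> {}" using k0[OF x0(1)] by (auto simp: I_def)
    then have x0X': "x0 \<in> X'" using x0 by (auto simp: X'_def)
    \<comment> \<open>Since no interval is longer than that of x0, one that meets it starts less
      than k x0 away from c on either side.\<close>
    have "(\<lambda>x. int c - int x) ` X' \<subseteq> tent W (k x0)"
    proof
      fix m assume "m \<in> (\<lambda>x. int c - int x) ` X'"
      then obtain x y where x: "x \<in> X" "m = int c - int x" "y \<in> I x" "y \<in> I x0"
        by (auto simp: X'_def)
      have "x + n x < c + k x0" "c < x + n x + k x"
        using x by (auto simp: I_def c_def)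
      with k_max[OF x(1)] have "\<bar>m - int (n x)\<bar> < int (k x0)"
        unfolding x(2) by linarith
      then show "m \<in> tent W (k x0)"
        unfolding tent_def using less.prems(2)[OF x(1)] k_max[OF x(1)] by auto
    qed
    moreover have tent: "finite (tent W (k x0))" "real (card (tent W (k x0))) \<le> B * real (k x0)"
      using tb k0[OF x0(1)] unfolding tent_bound_def by auto
    moreover have "inj_on (\<lambda>x. int c - int x) X'" by (auto intro: inj_onI)
    ultimately have "card X' \<le> card (tent W (k x0))"
      by (metis card_image card_mono)
    then have "real (card X') \<le> B * real (k x0)" using tent(2) by linarith
    then have "l * real (card X') \<le> B * (l * real (k x0))"
      using l by (simp add: mult.left_commute)
    also have "\<dots> \<le> B * (\<Sum>j\<in>I x0. \<phi> j)"
      using less.prems(4)[OF x0(1)] B unfolding I_def by (intro mult_left_mono)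
    finally have 1: "l * real (card X') \<le> B * (\<Sum>j\<in>I x0. \<phi> j)" .
    \<comment> \<open>Erasing \<phi> on the chosen interval prevents its mass from being spent
      twice; the sums over the remaining intervals do not change, as they are disjoint from
      it.\<close>
    define \<psi> where "\<psi> j = (if j \<in> I x0 then 0 else \<phi> j)" for j
    have 2: "l * real (card (X - X')) \<le> B * (\<Sum>j\<le>L. \<psi> j)"
    proof (rule less.hyps)
      show "card (X - X') < card X"
        using x0X' x0(1) less.prems(1) by (intro psubset_card_mono) auto
      show "0 \<le> \<psi> j" for j using less.prems(3) by (simp add: \<psi>_def)
      show "l * real (k x) \<le> (\<Sum>j\<in>{x + n x<..x + n x + k x}. \<psi> j)" if "x \<in> X - X'" for x
      proof -
        have "\<psi> j = \<phi> j" if "j \<in> I x" for j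
          using \<open>x \<in> X - X'\<close> that by (auto simp: \<psi>_def X'_def)
        then have "(\<Sum>j\<in>{x + n x<..x + n x + k x}. \<psi> j) = (\<Sum>j\<in>{x + n x<..x + n x + k x}. \<phi> j)"
          by (intro sum.cong) (auto simp: I_def)
        then show ?thesis using less.prems(4) that by auto
      qed
    qed (use less.prems fin in auto)
    have "I x0 \<subseteq> {..L}" using less.prems(2)[OF x0(1)] by (auto simp: I_def)
    then have "(\<Sum>j\<le>L. \<phi> j) = (\<Sum>j\<le>L. \<psi> j) + (\<Sum>j\<in>I x0. \<phi> j)"
    proof -
      have "(\<Sum>j\<in>I x0. \<phi> j) = (\<Sum>j\<le>L. if j \<in> I x0 then \<phi> j else 0)"
        using \<open>I x0 \<subseteq> {..L}\<close> by (subst sum.inter_restrict[symmetric]) (auto intro!: sum.cong)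
      then show ?thesis
        by (simp add: \<psi>_def flip: sum.distrib) (auto intro!: sum.cong)
    qed
    moreover have "real (card X) = real (card X') + real (card (X - X'))"
    proof -
      have "X = X' \<union> (X - X')" by (auto simp: X'_def)
      then have "card X = card X' + card (X - X')"
        using fin by (metis Diff_disjoint card_Un_disjoint)
      then show ?thesis by simp
    qed
    ultimately show ?thesis using 1 2 by (simp add: distrib_left)
  qed
qed

section \<open>Transference of the covering bound to a measure-preserving map\<close>

locale measure_preserving = prob_space M for M :: "'a measure" +
  fixes S :: "'a \<Rightarrow> 'a"
  assumes S_measurable [measurable]: "S \<in> M \<rightarrow>\<^sub>M M" and distr_S: "distr M M S = M"
begin

lemma S_power_measurable [measurable]: "(S ^^ n) \<in> M \<rightarrow>\<^sub>M M"
  by (induction n) (auto simp: measurable_ident)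

lemma S_power_space: "x \<in> space M \<Longrightarrow> (S ^^ n) x \<in> space M"
  using S_power_measurable by (rule measurable_space)

lemma distr_S_power: "distr M M (S ^^ n) = M"
proof (induction n)
  case (Suc n)
  have "distr M M (S ^^ Suc n) = distr (distr M M (S ^^ n)) M S"
    by (subst distr_distr) (auto simp: o_def)
  then show ?case using Suc distr_S by (simp add: o_def)
qed (simp add: distr_id[unfolded id_def] id_def)

lemma integrable_S_power:
  fixes f :: "'a \<Rightarrow> real"
  assumes "integrable M f"
  shows "integrable M (\<lambda>x. f ((S ^^ n) x))"
  using assms integrable_distr[of "S ^^ n" M M f] by (simp add: distr_S_power)

lemma integral_S_power:
  fixes f :: "'a \<Rightarrow> real"
  assumes [measurable]: "f \<in> borel_measurable M"
  shows "integral\<^sup>L M (\<lambda>x. f ((S ^^ n) x)) = integral\<^sup>L M f"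
  using integral_distr[of "S ^^ n" M M f] by (simp add: distr_S_power)

text \<open>Calderon transference: the covering bound is applied along an orbit, with \<phi> j =
  f(S^j x) and X the times before N at which the orbit is in the bad set. Integration and invariance
  compare N times its probability with N + L + 1 times the integral of f, and N tends to
  infinity.\<close>

lemma maximal_inequality_finite:
  fixes f :: "'a \<Rightarrow> real"
  assumes f: "integrable M f" "\<And>x. f x \<ge> 0" and W: "finite W" "tent_bound W B" and l: "l > 0"
  shows "l * prob {x \<in> space M. \<exists>(n, k)\<in>W. (\<Sum>j=1..k. f ((S ^^ (n + j)) x)) \<ge> l * real k} \<le> B * integral\<^sup>L M f"
proof -
  define E where "E = {x \<in> space M. \<exists>(n, k)\<in>W. (\<Sum>j=1..k. f ((S ^^ (n + j)) x)) \<ge> l * real k}"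
  have [measurable]: "f \<in> borel_measurable M" using f by auto
  have E_eq: "E = (\<Union>p\<in>W. {x \<in> space M. (\<Sum>j=1..snd p. f ((S ^^ (fst p + j)) x)) \<ge> l * real (snd p)})"
    by (auto simp: E_def split_beta)
  have [measurable]: "E \<in> sets M"
    unfolding E_eq using W(1) by (intro sets.finite_UN) measurable
  \<comment> \<open>How far the windows of W reach beyond their starting point; being fixed, this
    overshoot is negligible against N.\<close>
  obtain L where L: "\<And>n k. (n, k) \<in> W \<Longrightarrow> n + k \<le> L"
  proof -
    have "finite ((\<lambda>(n, k). n + k) ` W)" using W by auto
    then show ?thesis
      using that[of "Max ((\<lambda>(n, k). n + k) ` W)"] by (metis (mono_tags, lifting) Max_ge case_prod_conv imageI)
  qed
  have pointwise: "l * (\<Sum>i<N. indicator E ((S ^^ i) x)) \<le> B * (\<Sum>j\<le>N + L. f ((S ^^ j) x))"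
    if x: "x \<in> space M" for x N
  proof -
    define X where "X = {i. i < N \<and> (S ^^ i) x \<in> E}"
    have "\<forall>i\<in>X. \<exists>n k. (n, k) \<in> W \<and> (\<Sum>j=1..k. f ((S ^^ (n + j)) ((S ^^ i) x))) \<ge> l * real k"
      by (auto simp: X_def E_def)
    then obtain n k where nk: "\<And>i. i \<in> X \<Longrightarrow> (n i, k i) \<in> W"
      "\<And>i. i \<in> X \<Longrightarrow> (\<Sum>j=1..k i. f ((S ^^ (n i + j)) ((S ^^ i) x))) \<ge> l * real (k i)"
      by metis
    have "l * real (card X) \<le> B * (\<Sum>j\<le>N + L. f ((S ^^ j) x))"
    proof (rule covering_bound[OF W(2) _ l])
      show "finite X" by (simp add: X_def)
      show "(n i, k i) \<in> W \<and> i + n i + k i \<le> N + L" if "i \<in> X" for i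
        using nk(1)[OF that] L[OF nk(1)[OF that]] that by (auto simp: X_def)
      show "l * real (k i) \<le> (\<Sum>j\<in>{i + n i<..i + n i + k i}. f ((S ^^ j) x))" if "i \<in> X" for i
      proof -
        have "(\<Sum>j\<in>{i + n i<..i + n i + k i}. f ((S ^^ j) x)) = (\<Sum>j=1..k i. f ((S ^^ (i + n i + j)) x))"
          by (rule sum.reindex_bij_witness[of _ "\<lambda>j. i + n i + j" "\<lambda>j. j - (i + n i)"]) auto
        also have "\<dots> = (\<Sum>j=1..k i. f ((S ^^ (n i + j)) ((S ^^ i) x)))"
          by (intro sum.cong refl) (simp add: add_ac flip: funpow_add[THEN fun_cong, unfolded o_apply])
        finally show ?thesis using nk(2)[OF that] by simp
      qed
    qed (rule f)
    moreover have "(\<Sum>i<N. indicator E ((S ^^ i) x)) = real (card X)"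
    proof -
      have "(\<Sum>i<N. indicator E ((S ^^ i) x) :: real) = (\<Sum>i<N. indicator X i)"
        by (intro sum.cong) (auto simp: X_def indicator_def)
      also have "\<dots> = real (card ({..<N} \<inter> X))" by (simp add: indicator_def sum_of_bool_eq)
      also have "{..<N} \<inter> X = X" by (auto simp: X_def)
      finally show ?thesis .
    qed
    ultimately show ?thesis by simp
  qed
  have int_ind: "integrable M (\<lambda>x. indicator E ((S ^^ i) x) :: real)" for i
    by (rule integrable_S_power) (simp add: integrable_indicator_iff less_top[symmetric])
  have bound: "l * prob E * real N \<le> B * integral\<^sup>L M f * (real N + real L + 1)" for N
  proof -
    have "integral\<^sup>L M (\<lambda>x. l * (\<Sum>i<N. indicator E ((S ^^ i) x))) \<le>
        integral\<^sup>L M (\<lambda>x. B * (\<Sum>j\<le>N + L. f ((S ^^ j) x)))"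
      by (intro integral_mono pointwise integrable_mult_right Bochner_Integration.integrable_sum
          int_ind integrable_S_power f)
    also have "integral\<^sup>L M (\<lambda>x. l * (\<Sum>i<N. indicator E ((S ^^ i) x))) =
        l * (\<Sum>i<N. integral\<^sup>L M (\<lambda>x. indicator E ((S ^^ i) x)))"
      by (simp add: Bochner_Integration.integral_sum int_ind)
    also have "(\<Sum>i<N. integral\<^sup>L M (\<lambda>x. indicator E ((S ^^ i) x))) = (\<Sum>i<N. prob E)"
      by (intro sum.cong refl) (subst integral_S_power, auto)
    also have "integral\<^sup>L M (\<lambda>x. B * (\<Sum>j\<le>N + L. f ((S ^^ j) x))) =
        B * (\<Sum>j\<le>N + L. integral\<^sup>L M (\<lambda>x. f ((S ^^ j) x)))"
      by (simp add: Bochner_Integration.integral_sum integrable_S_power f)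
    also have "(\<Sum>j\<le>N + L. integral\<^sup>L M (\<lambda>x. f ((S ^^ j) x))) = (\<Sum>j\<le>N + L. integral\<^sup>L M f)"
      by (simp add: integral_S_power)
    finally show ?thesis by (simp add: algebra_simps)
  qed
  have "l * prob E \<le> B * integral\<^sup>L M f * ((real N + real L + 1) / real N)" if "N > 0" for N
    unfolding times_divide_eq_right using that bound[of N] by (subst pos_le_divide_eq) auto
  then have "\<forall>\<^sub>F N in sequentially. l * prob E \<le> B * integral\<^sup>L M f * ((real N + real L + 1) / real N)"
    by (auto simp: eventually_sequentially intro!: exI[of _ 1])
  moreover have "(\<lambda>N. B * integral\<^sup>L M f * ((real N + real L + 1) / real N)) \<longlonglongrightarrow> B * integral\<^sup>L M f * 1"
  proof (rule tendsto_mult_left)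
    show "(\<lambda>N. (real N + real L + 1) / real N) \<longlonglongrightarrow> 1" by real_asymp
  qed
  ultimately show ?thesis
    unfolding E_def by (intro tendsto_lowerbound) auto
qed

text \<open>Finite parts of the tail increase to the whole tail, and the constant B does not depend
  on the part.\<close>

lemma maximal_inequality:
  fixes f :: "'a \<Rightarrow> real" and n k :: "nat \<Rightarrow> nat"
  assumes f: "integrable M f" "\<And>x. f x \<ge> 0" and tb: "tent_bound ((\<lambda>q. (n q, k q)) ` {q0..}) B" and l: "l > 0"
  defines "E \<equiv> {x \<in> space M. \<exists>q\<ge>q0. (\<Sum>j=1..k q. f ((S ^^ (n q + j)) x)) \<ge> l * real (k q)}"
  shows "E \<in> sets M" "l * prob E \<le> B * integral\<^sup>L M f"
proof -
  have [measurable]: "f \<in> borel_measurable M" using f by auto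
  define F where "F Q = {x \<in> space M. \<exists>q\<in>{q0..Q}. (\<Sum>j=1..k q. f ((S ^^ (n q + j)) x)) \<ge> l * real (k q)}" for Q
  have F_sets: "F Q \<in> sets M" for Q
    unfolding F_def by measurable
  have E_eq: "E = (\<Union>Q. F Q)"
  proof -
    have "x \<in> F q" if "x \<in> space M" "q \<ge> q0" "(\<Sum>j=1..k q. f ((S ^^ (n q + j)) x)) \<ge> l * real (k q)" for x q
      using that unfolding F_def by auto
    then have "E \<subseteq> (\<Union>Q. F Q)" unfolding E_def by blast
    moreover have "(\<Union>Q. F Q) \<subseteq> E" by (auto simp: E_def F_def)
    ultimately show ?thesis by (rule equalityI)
  qed
  show "E \<in> sets M" unfolding E_eq using F_sets by auto
  have "incseq F"
    by (intro incseq_SucI) (auto simp: F_def)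
  then have "(\<lambda>Q. l * prob (F Q)) \<longlonglongrightarrow> l * prob E"
    unfolding E_eq using F_sets by (intro tendsto_mult_left finite_Lim_measure_incseq) auto
  moreover have "l * prob (F Q) \<le> B * integral\<^sup>L M f" for Q
  proof -
    have "F Q = {x \<in> space M. \<exists>(n, k)\<in>(\<lambda>q. (n q, k q)) ` {q0..Q}. (\<Sum>j=1..k. f ((S ^^ (n + j)) x)) \<ge> l * real k}"
      by (auto simp: F_def)
    then show ?thesis
      by (simp only:) (intro maximal_inequality_finite f l tent_bound_mono[OF tb] finite_imageI image_mono; simp)
  qed
  ultimately show "l * prob E \<le> B * integral\<^sup>L M f"
    by (intro LIMSEQ_le_const2) auto
qed

text \<open>The equation is asked for at every point of the space rather than almost everywhere, so
  that it can be summed along an orbit without discarding null sets.\<close>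

definition near_coboundary :: "('a \<Rightarrow> real) \<Rightarrow> real \<Rightarrow> bool" where
  "near_coboundary f \<epsilon> \<longleftrightarrow> (\<exists>g b r. g \<in> borel_measurable M \<and> (\<forall>x\<in>space M. \<bar>g x\<bar> \<le> b) \<and> integrable M r \<and>
     (\<forall>x\<in>space M. f x = integral\<^sup>L M f + g x - g (S x) + r x) \<and> integral\<^sup>L M (\<lambda>x. \<bar>r x\<bar>) \<le> \<epsilon>)"

definition approx_coboundary :: "('a \<Rightarrow> real) \<Rightarrow> bool" where
  "approx_coboundary f \<longleftrightarrow> integrable M f \<and> (\<forall>\<epsilon>>0. near_coboundary f \<epsilon>)"

text \<open>Over a window the coboundary telescopes to at most 2 b, which is negligible once k q is
  large; the average of r is controlled by the maximal inequality for |r|, off a set whose measure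
  is small because r is small in L^1.\<close>

lemma moving_averages_converge:
  fixes n k :: "nat \<Rightarrow> nat"
  assumes f: "approx_coboundary f" and tb: "tent_bound ((\<lambda>q. (n q, k q)) ` {q0..}) B"
    and k: "filterlim k at_top sequentially"
  shows "AE x in M. (\<lambda>q. (\<Sum>j=1..k q. f ((S ^^ (n q + j)) x)) / real (k q)) \<longlonglongrightarrow> integral\<^sup>L M f"
proof -
  define c where "c = integral\<^sup>L M f"
  define A where "A q x = (\<Sum>j=1..k q. f ((S ^^ (n q + j)) x)) / real (k q)" for q x
  have k_pos: "\<forall>\<^sub>F q in sequentially. k q > 0"
    using k by (auto simp: filterlim_at_top dest!: spec[of _ 1] elim!: eventually_mono)
  have ex: "\<exists>E. E \<in> sets M \<and> prob E \<le> \<epsilon> \<and>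
      (\<forall>x\<in>space M. x \<notin> E \<longrightarrow> (\<forall>\<^sub>F q in sequentially. \<bar>A q x - c\<bar> \<le> l))"
    if l: "l > 0" and \<epsilon>: "\<epsilon> > 0" for l \<epsilon>
  proof -
    \<comment> \<open>The L^1 size of r for which the maximal inequality at level l / 2 gives an
      exceptional set of probability at most \<epsilon>. The denominator is positive whatever the
      sign of B.\<close>
    define \<eta> where "\<eta> = \<epsilon> * (l / 2) / (\<bar>B\<bar> + 1)"
    have "\<eta> > 0" using l \<epsilon> by (simp add: \<eta>_def)
    then obtain g b r where g: "g \<in> borel_measurable M" "\<And>x. x \<in> space M \<Longrightarrow> \<bar>g x\<bar> \<le> b"
      and r: "integrable M r" "\<And>x. x \<in> space M \<Longrightarrow> f x = c + g x - g (S x) + r x" "integral\<^sup>L M (\<lambda>x. \<bar>r x\<bar>) \<le> \<eta>"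
      using f unfolding approx_coboundary_def near_coboundary_def c_def by blast
    define E where "E = {x \<in> space M. \<exists>q\<ge>q0. (\<Sum>j=1..k q. \<bar>r ((S ^^ (n q + j)) x)\<bar>) \<ge> l / 2 * real (k q)}"
    have E: "E \<in> sets M" "l / 2 * prob E \<le> B * integral\<^sup>L M (\<lambda>x. \<bar>r x\<bar>)"
      unfolding E_def using r l maximal_inequality[of "\<lambda>x. \<bar>r x\<bar>" n k q0 B "l / 2", OF _ _ tb] by auto
    have "B * integral\<^sup>L M (\<lambda>x. \<bar>r x\<bar>) \<le> (\<bar>B\<bar> + 1) * \<eta>"
      using r(3) by (intro mult_mono) auto
    also have "\<dots> = \<epsilon> * (l / 2)"
    proof -
      have "d * (y / d) = y" if "d \<noteq> 0" for d y :: real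
        using that by simp
      from this[of "\<bar>B\<bar> + 1" "\<epsilon> * (l / 2)"] show ?thesis
        unfolding \<eta>_def by linarith
    qed
    finally have "l / 2 * prob E \<le> l / 2 * \<epsilon>" using E(2) by (simp add: mult.commute)
    then have "prob E \<le> \<epsilon>" using l by simp
    moreover have "\<forall>\<^sub>F q in sequentially. \<bar>A q x - c\<bar> \<le> l" if x: "x \<in> space M" "x \<notin> E" for x
    proof -
      have "(\<lambda>q. 2 * b / real (k q)) \<longlonglongrightarrow> 0"
        by (rule tendsto_divide_0[OF tendsto_const])
           (intro filterlim_at_top_imp_at_infinity filterlim_compose[OF filterlim_real_sequentially k])
      then have "\<forall>\<^sub>F q in sequentially. 2 * b / real (k q) < l / 2"
        using l by (intro order_tendstoD(2)) auto
      with k_pos eventually_ge_at_top[of q0] show ?thesis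
      proof eventually_elim
        case (elim q)
        have sp: "(S ^^ i) x \<in> space M" for i using x S_power_space by auto
        have "(\<Sum>j=1..k q. f ((S ^^ (n q + j)) x)) =
            (\<Sum>j=1..k q. c + (g ((S ^^ (n q + j)) x) - g ((S ^^ (n q + Suc j)) x)) + r ((S ^^ (n q + j)) x))"
          by (intro sum.cong refl) (simp add: r(2)[OF sp])
        also have "\<dots> = real (k q) * c + (\<Sum>j=1..k q. g ((S ^^ (n q + j)) x) - g ((S ^^ (n q + Suc j)) x)) +
            (\<Sum>j=1..k q. r ((S ^^ (n q + j)) x))"
          by (simp only: sum.distrib) simp
        also have "(\<Sum>j=1..k q. g ((S ^^ (n q + j)) x) - g ((S ^^ (n q + Suc j)) x)) =
            g ((S ^^ (n q + 1)) x) - g ((S ^^ (n q + Suc (k q))) x)"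
        proof -
          have "(\<Sum>j=1..m. g ((S ^^ (n q + j)) x) - g ((S ^^ (n q + Suc j)) x)) =
              g ((S ^^ (n q + 1)) x) - g ((S ^^ (n q + Suc m)) x)" for m
            by (induction m) auto
          then show ?thesis .
        qed
        finally have sum_eq: "(\<Sum>j=1..k q. f ((S ^^ (n q + j)) x)) - real (k q) * c =
            g ((S ^^ (n q + 1)) x) - g ((S ^^ (n q + Suc (k q))) x) + (\<Sum>j=1..k q. r ((S ^^ (n q + j)) x))"
          by simp
        have "\<bar>\<Sum>j=1..k q. r ((S ^^ (n q + j)) x)\<bar> \<le> (\<Sum>j=1..k q. \<bar>r ((S ^^ (n q + j)) x)\<bar>)"
          by (rule sum_abs)
        also have "\<dots> < l / 2 * real (k q)"
        proof -
          have "\<not> (\<Sum>j=1..k q. \<bar>r ((S ^^ (n q + j)) x)\<bar>) \<ge> l / 2 * real (k q)"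
            using x elim unfolding E_def by blast
          then show ?thesis by simp
        qed
        finally have "\<bar>(\<Sum>j=1..k q. f ((S ^^ (n q + j)) x)) - real (k q) * c\<bar> \<le> 2 * b + l / 2 * real (k q)"
          unfolding sum_eq using g(2)[OF sp[of "n q + 1"]] g(2)[OF sp[of "n q + Suc (k q)"]] by linarith
        moreover have "A q x - c = ((\<Sum>j=1..k q. f ((S ^^ (n q + j)) x)) - real (k q) * c) / real (k q)"
          using elim by (simp add: A_def field_simps)
        ultimately have "\<bar>A q x - c\<bar> \<le> (2 * b + l / 2 * real (k q)) / real (k q)"
          using elim by (simp add: divide_right_mono)
        also have "\<dots> = 2 * b / real (k q) + l / 2"
          using elim by (simp add: field_simps)
        finally show ?case using elim by linarith
      qed
    qed
    ultimately show ?thesis using E(1) by blast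
  qed
  have AE_l: "AE x in M. \<forall>\<^sub>F q in sequentially. \<bar>A q x - c\<bar> \<le> l" if l: "l > 0" for l
  proof -
    \<comment> \<open>The exceptional sets are only small, not null; for a fixed l the conclusion
      does not mention them, so they can be intersected to a null set.\<close>
    have "\<forall>i. \<exists>E. E \<in> sets M \<and> prob E \<le> 1 / real (Suc i) \<and>
        (\<forall>x\<in>space M. x \<notin> E \<longrightarrow> (\<forall>\<^sub>F q in sequentially. \<bar>A q x - c\<bar> \<le> l))"
      by (intro allI ex l) simp
    then obtain E where E: "\<And>i. E i \<in> sets M" "\<And>i. prob (E i) \<le> 1 / real (Suc i)"
      "\<And>i x. x \<in> space M \<Longrightarrow> x \<notin> E i \<Longrightarrow> \<forall>\<^sub>F q in sequentially. \<bar>A q x - c\<bar> \<le> l"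
      by metis
    define N where "N = (\<Inter>i. E i)"
    have N: "N \<in> sets M" unfolding N_def using E(1) by auto
    have "prob N \<le> 1 / real (Suc i)" for i
      by (rule order_trans[OF finite_measure_mono E(2)[of i]]) (use E in \<open>auto simp: N_def\<close>)
    then have "prob N \<le> 0"
      by (intro LIMSEQ_le_const[OF lim_1_over_n[THEN LIMSEQ_Suc]]) auto
    then have "prob N = 0" by (simp add: measure_le_0_iff)
    then have "emeasure M N = 0" by (simp add: emeasure_eq_measure)
    then show ?thesis
      using N E(3) by (intro AE_I[of _ _ N]) (auto simp: N_def)
  qed
  have "AE x in M. \<forall>i. \<forall>\<^sub>F q in sequentially. \<bar>A q x - c\<bar> \<le> 1 / real (Suc i)"
    unfolding AE_all_countable by (intro allI AE_l) simp
  then show ?thesis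
  proof eventually_elim
    case (elim x)
    have "(\<lambda>q. A q x) \<longlonglongrightarrow> c"
    proof (rule tendstoI)
      fix e :: real assume "e > 0"
      then obtain i where i: "1 / real (Suc i) < e"
        using nat_approx_posE by auto
      from elim have "\<forall>\<^sub>F q in sequentially. \<bar>A q x - c\<bar> \<le> 1 / real (Suc i)" by auto
      then show "\<forall>\<^sub>F q in sequentially. dist (A q x) c < e"
        by eventually_elim (use i in \<open>simp add: dist_real_def\<close>)
    qed
    then show ?case by (simp add: A_def c_def)
  qed
qed

section \<open>Closure properties of approximate coboundaries\<close>

lemma approx_coboundaryD: "approx_coboundary f \<Longrightarrow> integrable M f"
  by (simp add: approx_coboundary_def)

lemma approx_coboundary_const: "approx_coboundary (\<lambda>_. c)"
  unfolding approx_coboundary_def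
proof (intro conjI allI impI)
  fix \<epsilon> :: real assume "\<epsilon> > 0"
  then show "near_coboundary (\<lambda>_. c) \<epsilon>"
    unfolding near_coboundary_def
    by (intro exI[of _ "\<lambda>_. 0"] exI[of _ 0]) (auto simp: prob_space)
qed simp

lemma approx_coboundary_add:
  assumes "approx_coboundary f1" "approx_coboundary f2"
  shows "approx_coboundary (\<lambda>x. f1 x + f2 x)"
  unfolding approx_coboundary_def
proof (intro conjI allI impI)
  have int: "integrable M f1" "integrable M f2"
    using assms by (auto dest: approx_coboundaryD)
  then show "integrable M (\<lambda>x. f1 x + f2 x)" by simp
  fix \<epsilon> :: real assume "\<epsilon> > 0"
  then have "\<epsilon> / 2 > 0" by simp
  note ex = assms[unfolded approx_coboundary_def near_coboundary_def, THEN conjunct2, rule_format, OF this]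
  obtain g1 b1 r1 where
    1: "g1 \<in> borel_measurable M" "\<forall>x\<in>space M. \<bar>g1 x\<bar> \<le> b1" "integrable M r1"
      "\<forall>x\<in>space M. f1 x = expectation f1 + g1 x - g1 (S x) + r1 x" "expectation (\<lambda>x. \<bar>r1 x\<bar>) \<le> \<epsilon> / 2"
    using ex(1) by blast
  obtain g2 b2 r2 where
    2: "g2 \<in> borel_measurable M" "\<forall>x\<in>space M. \<bar>g2 x\<bar> \<le> b2" "integrable M r2"
      "\<forall>x\<in>space M. f2 x = expectation f2 + g2 x - g2 (S x) + r2 x" "expectation (\<lambda>x. \<bar>r2 x\<bar>) \<le> \<epsilon> / 2"
    using ex(2) by blast
  show "near_coboundary (\<lambda>x. f1 x + f2 x) \<epsilon>"
    unfolding near_coboundary_def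
  proof (intro exI conjI ballI)
    show "(\<lambda>x. g1 x + g2 x) \<in> borel_measurable M" "integrable M (\<lambda>x. r1 x + r2 x)"
      using 1 2 by auto
    fix x assume x: "x \<in> space M"
    show "\<bar>g1 x + g2 x\<bar> \<le> b1 + b2"
      using bspec[OF 1(2) x] bspec[OF 2(2) x] by linarith
    show "f1 x + f2 x = expectation (\<lambda>x. f1 x + f2 x) + (g1 x + g2 x) - (g1 (S x) + g2 (S x)) + (r1 x + r2 x)"
      using bspec[OF 1(4) x] bspec[OF 2(4) x] int by simp
  next
    have "expectation (\<lambda>x. \<bar>r1 x + r2 x\<bar>) \<le> expectation (\<lambda>x. \<bar>r1 x\<bar> + \<bar>r2 x\<bar>)"
      using 1(3) 2(3) by (intro integral_mono) auto
    also have "\<dots> \<le> \<epsilon>" using 1 2 by simp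
    finally show "expectation (\<lambda>x. \<bar>r1 x + r2 x\<bar>) \<le> \<epsilon>" .
  qed
qed

lemma approx_coboundary_scale:
  assumes "approx_coboundary f"
  shows "approx_coboundary (\<lambda>x. a * f x)"
  unfolding approx_coboundary_def
proof (intro conjI allI impI)
  have int: "integrable M f"
    using assms by (auto dest: approx_coboundaryD)
  then show "integrable M (\<lambda>x. a * f x)" by simp
  fix \<epsilon> :: real assume \<epsilon>: "\<epsilon> > 0"
  then have "\<epsilon> / (\<bar>a\<bar> + 1) > 0" by simp
  with assms obtain g b r where
    g: "g \<in> borel_measurable M" "\<forall>x\<in>space M. \<bar>g x\<bar> \<le> b" "integrable M r"
      "\<forall>x\<in>space M. f x = expectation f + g x - g (S x) + r x" "expectation (\<lambda>x. \<bar>r x\<bar>) \<le> \<epsilon> / (\<bar>a\<bar> + 1)"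
    unfolding approx_coboundary_def near_coboundary_def by blast
  show "near_coboundary (\<lambda>x. a * f x) \<epsilon>"
    unfolding near_coboundary_def
  proof (intro exI conjI ballI)
    show "(\<lambda>x. a * g x) \<in> borel_measurable M" "integrable M (\<lambda>x. a * r x)"
      using g by auto
    fix x assume x: "x \<in> space M"
    show "\<bar>a * g x\<bar> \<le> \<bar>a\<bar> * b"
      using g(2) x by (simp add: abs_mult mult_left_mono)
    have "f x = expectation f + g x - g (S x) + r x" using g(4) x by blast
    then have "a * f x = a * (expectation f + g x - g (S x) + r x)" by (rule arg_cong)
    then show "a * f x = expectation (\<lambda>x. a * f x) + (a * g x) - (a * g (S x)) + (a * r x)"
      by (simp add: algebra_simps)
  next
    have "expectation (\<lambda>x. \<bar>a * r x\<bar>) = \<bar>a\<bar> * expectation (\<lambda>x. \<bar>r x\<bar>)"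
      by (simp add: abs_mult)
    also have "\<dots> \<le> \<bar>a\<bar> * (\<epsilon> / (\<bar>a\<bar> + 1))"
      using g by (intro mult_left_mono) auto
    also have "\<dots> \<le> \<epsilon>" using \<epsilon> by (simp add: divide_le_eq mult.commute)
    finally show "expectation (\<lambda>x. \<bar>a * r x\<bar>) \<le> \<epsilon>" .
  qed
qed

lemma approx_coboundary_closed:
  assumes f: "integrable M f"
    and ex: "\<And>\<epsilon>. \<epsilon> > 0 \<Longrightarrow> \<exists>f'. approx_coboundary f' \<and> expectation (\<lambda>x. \<bar>f x - f' x\<bar>) \<le> \<epsilon>"
  shows "approx_coboundary f"
  unfolding approx_coboundary_def
proof (intro conjI allI impI f)
  fix \<epsilon> :: real assume "\<epsilon> > 0"
  then have \<epsilon>3: "\<epsilon> / 3 > 0" by simp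
  obtain f' where f': "approx_coboundary f'" "expectation (\<lambda>x. \<bar>f x - f' x\<bar>) \<le> \<epsilon> / 3"
    using ex[OF \<epsilon>3] by auto
  then have int': "integrable M f'" by (auto dest: approx_coboundaryD)
  from f'(1) \<epsilon>3 obtain g b r where
    g: "g \<in> borel_measurable M" "\<forall>x\<in>space M. \<bar>g x\<bar> \<le> b" "integrable M r"
      "\<forall>x\<in>space M. f' x = expectation f' + g x - g (S x) + r x" "expectation (\<lambda>x. \<bar>r x\<bar>) \<le> \<epsilon> / 3"
    unfolding approx_coboundary_def near_coboundary_def by blast
  \<comment> \<open>The decomposition of f' comes with the mean of f'; the difference of the means
    is a constant that joins the remainder.\<close>
  define d where "d = expectation f' - expectation f"
  have "\<bar>d\<bar> \<le> \<epsilon> / 3"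
  proof -
    have "\<bar>d\<bar> = \<bar>expectation (\<lambda>x. f x - f' x)\<bar>" using f int' by (simp add: d_def)
    also have "\<dots> \<le> expectation (\<lambda>x. \<bar>f x - f' x\<bar>)" by (rule integral_abs_bound)
    finally show ?thesis using f'(2) by simp
  qed
  show "near_coboundary f \<epsilon>"
    unfolding near_coboundary_def
  proof (intro exI conjI)
    show "\<forall>x\<in>space M. f x = expectation f + g x - g (S x) + (r x + (f x - f' x) + d)"
      using g(4) by (simp add: d_def)
    show "integrable M (\<lambda>x. r x + (f x - f' x) + d)"
      using g(3) f int' by simp
    have "expectation (\<lambda>x. \<bar>r x + (f x - f' x) + d\<bar>) \<le> expectation (\<lambda>x. \<bar>r x\<bar> + \<bar>f x - f' x\<bar> + \<bar>d\<bar>)"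
      using g(3) f int' by (intro integral_mono) auto
    also have "\<dots> = expectation (\<lambda>x. \<bar>r x\<bar>) + expectation (\<lambda>x. \<bar>f x - f' x\<bar>) + \<bar>d\<bar>"
      using g(3) f int' by (simp add: prob_space)
    also have "\<dots> \<le> \<epsilon>" using g(5) f'(2) \<open>\<bar>d\<bar> \<le> \<epsilon> / 3\<close> by simp
    finally show "expectation (\<lambda>x. \<bar>r x + (f x - f' x) + d\<bar>) \<le> \<epsilon>" .
  qed (use g in auto)
qed

section \<open>Approximate coboundaries from decay of correlations\<close>

lemma abs_birkhoff_sum_le:
  fixes f :: "'a \<Rightarrow> real"
  assumes "\<And>x. x \<in> space M \<Longrightarrow> \<bar>f x\<bar> \<le> b" "x \<in> space M"
  shows "\<bar>\<Sum>i<N. f ((S ^^ i) x)\<bar> \<le> real N * b"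
proof -
  have "\<bar>\<Sum>i<N. f ((S ^^ i) x)\<bar> \<le> (\<Sum>i<N. \<bar>f ((S ^^ i) x)\<bar>)" by (rule sum_abs)
  also have "\<dots> \<le> (\<Sum>i<N. b)" using assms S_power_space by (intro sum_mono) auto
  finally show ?thesis by simp
qed

text \<open>Since F (N + 1) = f + F N o S, invariance shows that one more term adds the integral of
  f^2, at most K, and twice a sum of correlations bounded by K (1/2 + 1/4 + ...) <= K.\<close>

lemma second_moment_birkhoff_sum_le:
  fixes f :: "'a \<Rightarrow> real"
  assumes [measurable]: "f \<in> borel_measurable M" and b: "\<And>x. x \<in> space M \<Longrightarrow> \<bar>f x\<bar> \<le> b"
    and corr: "\<And>j. \<bar>expectation (\<lambda>x. f x * f ((S ^^ j) x))\<bar> \<le> K * (1/2) ^ j"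
  shows "expectation (\<lambda>x. (\<Sum>i<N. f ((S ^^ i) x))\<^sup>2) \<le> 3 * K * real N"
proof (induction N)
  case (Suc N)
  define F where "F N x = (\<Sum>i<N. f ((S ^^ i) x))" for N x
  have F_meas [measurable]: "F N \<in> borel_measurable M" for N
    unfolding F_def[abs_def] by measurable
  have F_bound: "\<bar>F i x\<bar> \<le> real i * b" if "x \<in> space M" for i x
    unfolding F_def using abs_birkhoff_sum_le[OF b that] .
  have bdd_int: "integrable M h" if "h \<in> borel_measurable M" "\<And>x. x \<in> space M \<Longrightarrow> \<bar>h x\<bar> \<le> c"
    for h :: "'a \<Rightarrow> real" and c
    using that by (intro integrable_const_bound[of _ c]) auto
  have mult_int: "integrable M (\<lambda>x. h1 x * h2 x)"
    if "h1 \<in> borel_measurable M" "\<And>x. x \<in> space M \<Longrightarrow> \<bar>h1 x\<bar> \<le> c1"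
      "h2 \<in> borel_measurable M" "\<And>x. x \<in> space M \<Longrightarrow> \<bar>h2 x\<bar> \<le> c2" for h1 h2 :: "'a \<Rightarrow> real" and c1 c2
  proof (rule bdd_int[of _ "c1 * c2"])
    fix x assume "x \<in> space M"
    then have "\<bar>h1 x\<bar> \<le> c1" "\<bar>h2 x\<bar> \<le> c2" using that by auto
    moreover from this have "0 \<le> c1" by linarith
    ultimately show "\<bar>h1 x * h2 x\<bar> \<le> c1 * c2" unfolding abs_mult by (intro mult_mono) auto
  qed (use that in auto)
  have Sx: "S x \<in> space M" if "x \<in> space M" for x
    using that S_measurable by (rule measurable_space[rotated])
  have F_Suc: "F (Suc N) x = f x + F N (S x)" for x
    unfolding F_def by (subst sum.lessThan_Suc_shift) (simp add: funpow_swap1)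
  have corr_sum: "expectation (\<lambda>x. f x * F N (S x)) = (\<Sum>i<N. expectation (\<lambda>x. f x * f ((S ^^ Suc i) x)))"
  proof -
    have "expectation (\<lambda>x. f x * F N (S x)) = expectation (\<lambda>x. \<Sum>i<N. f x * f ((S ^^ Suc i) x))"
      by (simp add: F_def sum_distrib_left funpow_swap1)
    also have "\<dots> = (\<Sum>i<N. expectation (\<lambda>x. f x * f ((S ^^ Suc i) x)))"
    proof (intro Bochner_Integration.integral_sum mult_int[of _ b _ b])
      show "\<bar>f ((S ^^ Suc i) x)\<bar> \<le> b" if "x \<in> space M" for i x
        by (rule b[OF S_power_space[OF that]])
      show "(\<lambda>x. f ((S ^^ Suc i) x)) \<in> borel_measurable M" for i
        by measurable
    qed (use b in auto)
    finally show ?thesis .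
  qed
  have "K \<ge> 0" using corr[of 0] by (simp add: abs_le_iff) (metis abs_ge_zero corr[of 0] mult.right_neutral order_trans power_0)
  have "(\<Sum>i<N. expectation (\<lambda>x. f x * f ((S ^^ Suc i) x))) \<le> (\<Sum>i<N. K * (1/2) ^ Suc i)"
    using corr by (intro sum_mono) (metis abs_le_D1)
  also have "\<dots> = K * (1 - (1/2) ^ N)"
    by (induction N) (simp_all add: algebra_simps)
  also have "\<dots> \<le> K" using \<open>K \<ge> 0\<close> by (simp add: algebra_simps)
  finally have cross: "expectation (\<lambda>x. f x * F N (S x)) \<le> K" unfolding corr_sum .
  have sq: "expectation (\<lambda>x. f x * f x) \<le> K" using corr[of 0] by simp
  have "expectation (\<lambda>x. (F (Suc N) x)\<^sup>2) =
      expectation (\<lambda>x. f x * f x + 2 * (f x * F N (S x)) + F N (S x) * F N (S x))"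
    unfolding F_Suc by (simp add: power2_eq_square algebra_simps)
  also have "\<dots> = expectation (\<lambda>x. f x * f x) + 2 * expectation (\<lambda>x. f x * F N (S x)) +
      expectation (\<lambda>x. F N (S x) * F N (S x))"
  proof -
    have "integrable M (\<lambda>x. f x * f x)" "integrable M (\<lambda>x. f x * F N (S x))"
      "integrable M (\<lambda>x. F N (S x) * F N (S x))"
      using b F_bound Sx by (intro mult_int[of _ b _ b] mult_int[of _ b _ "real N * b"]
          mult_int[of _ "real N * b" _ "real N * b"]; measurable)+
    then show ?thesis by simp
  qed
  also have "expectation (\<lambda>x. F N (S x) * F N (S x)) = expectation (\<lambda>x. F N x * F N x)"
    using integral_S_power[of "\<lambda>x. F N x * F N x" 1] by simp
  also have "\<dots> \<le> 3 * K * real N" using Suc.IH by (simp add: F_def power2_eq_square)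
  finally show ?case using cross sq by (simp add: F_def algebra_simps)
qed simp

text \<open>The Birkhoff average F N / N is the remainder: F i - F i o S = f - f o S^i, so averaging
  over i < N writes f - F N / N as a bounded coboundary. Its second moment is at most 3 K /
  N.\<close>

lemma approx_coboundary_correlation:
  fixes f :: "'a \<Rightarrow> real"
  assumes [measurable]: "f \<in> borel_measurable M" and b: "\<And>x. x \<in> space M \<Longrightarrow> \<bar>f x\<bar> \<le> b"
    and mean: "expectation f = 0"
    and corr: "\<And>j. \<bar>expectation (\<lambda>x. f x * f ((S ^^ j) x))\<bar> \<le> K * (1/2) ^ j"
  shows "approx_coboundary f"
  unfolding approx_coboundary_def
proof (intro conjI allI impI)
  show "integrable M f"
    using b by (intro integrable_const_bound[of _ b]) auto
  fix \<epsilon> :: real assume \<epsilon>: "\<epsilon> > 0"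
  obtain N :: nat where N: "real N > 3 * K / (\<epsilon> * \<epsilon>)" "N > 0"
    using reals_Archimedean2[of "max 0 (3 * K / (\<epsilon> * \<epsilon>))"] by auto
  define F where "F i x = (\<Sum>l<i. f ((S ^^ l) x))" for i x
  have F_meas [measurable]: "F i \<in> borel_measurable M" for i
    unfolding F_def[abs_def] by measurable
  have F_bound: "\<bar>F i x\<bar> \<le> real i * b" if "x \<in> space M" for i x
    unfolding F_def using abs_birkhoff_sum_le[OF b that] .
  define g where "g x = (\<Sum>i<N. F i x) / real N" for x
  define r where "r x = F N x / real N" for x
  have F_diff: "F i x - F i (S x) = f x - f ((S ^^ i) x)" for i x
    by (induction i) (auto simp: F_def funpow_swap1)
  have eq: "f x = g x - g (S x) + r x" for x
  proof -
    have "g x - g (S x) = (\<Sum>i<N. f x - f ((S ^^ i) x)) / real N"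
      by (simp add: g_def flip: diff_divide_distrib sum_subtractf F_diff)
    also have "\<dots> = f x - r x"
      using N by (simp add: r_def F_def sum_subtractf field_simps)
    finally show ?thesis by simp
  qed
  have r_int: "integrable M r" "integrable M (\<lambda>x. (r x)\<^sup>2)"
  proof -
    have r_bound: "\<bar>r x\<bar> \<le> b" if "x \<in> space M" for x
      using F_bound[OF that, of N] N by (simp add: r_def divide_le_eq mult.commute)
    have [measurable]: "r \<in> borel_measurable M" unfolding r_def[abs_def] by measurable
    show "integrable M r" using r_bound by (intro integrable_const_bound[of _ b]) auto
    show "integrable M (\<lambda>x. (r x)\<^sup>2)"
      using r_bound by (intro integrable_const_bound[of _ "b\<^sup>2"])
        (auto simp flip: abs_le_square_iff intro: abs_ge_self order_trans)
  qed
  have "expectation (\<lambda>x. (r x)\<^sup>2) = expectation (\<lambda>x. (F N x)\<^sup>2) / (real N)\<^sup>2"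
    by (simp add: r_def power_divide)
  also have "\<dots> \<le> 3 * K * real N / (real N)\<^sup>2"
    using second_moment_birkhoff_sum_le[OF assms(1) b corr, of N] unfolding F_def
    by (intro divide_right_mono) auto
  also have "\<dots> = 3 * K / real N" using N by (simp add: power2_eq_square)
  also have "\<dots> \<le> \<epsilon> * \<epsilon>"
    using N \<epsilon> by (simp add: divide_less_eq divide_le_eq mult.commute less_imp_le)
  finally have r2: "expectation (\<lambda>x. (r x)\<^sup>2) \<le> \<epsilon> * \<epsilon>" .
  \<comment> \<open>A pointwise passage from the second moment to the L^1 norm; the weight
    \<epsilon> balances the two terms when the second moment is \<epsilon>^2.\<close>
  have young: "\<bar>y\<bar> \<le> \<epsilon> / 2 + y\<^sup>2 / (2 * \<epsilon>)" for y :: real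
  proof -
    have "0 \<le> (\<bar>y\<bar> - \<epsilon>)\<^sup>2 / (2 * \<epsilon>)" using \<epsilon> by auto
    also have "\<dots> = \<epsilon> / 2 + y\<^sup>2 / (2 * \<epsilon>) - \<bar>y\<bar>"
      using \<epsilon> by (simp add: power2_diff field_simps power2_eq_square)
    finally show ?thesis by simp
  qed
  have "expectation (\<lambda>x. \<bar>r x\<bar>) \<le> expectation (\<lambda>x. \<epsilon> / 2 + (r x)\<^sup>2 / (2 * \<epsilon>))"
    using r_int young by (intro integral_mono) auto
  also have "\<dots> = \<epsilon> / 2 + expectation (\<lambda>x. (r x)\<^sup>2) / (2 * \<epsilon>)"
    using r_int by (simp add: prob_space)
  also have "\<dots> \<le> \<epsilon> / 2 + \<epsilon> * \<epsilon> / (2 * \<epsilon>)"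
    using r2 \<epsilon> by (intro add_left_mono divide_right_mono) auto
  also have "\<dots> = \<epsilon>" using \<epsilon> by simp
  finally have r1: "expectation (\<lambda>x. \<bar>r x\<bar>) \<le> \<epsilon>" .
  show "near_coboundary f \<epsilon>"
    unfolding near_coboundary_def
  proof (intro exI conjI ballI)
    show "g \<in> borel_measurable M" unfolding g_def[abs_def] by measurable
    show "f x = expectation f + g x - g (S x) + r x" for x using eq[of x] mean by simp
    show "\<bar>g x\<bar> \<le> (\<Sum>i<N. real i * b) / real N" if "x \<in> space M" for x
      unfolding g_def using F_bound[OF that]
      by (auto intro!: divide_right_mono order_trans[OF sum_abs] sum_mono)
  qed (use r_int r1 in auto)
qed

text \<open>Dynkin's lemma extends the property from the generator to all measurable sets; linearity
  and closedness in L^1 then give simple functions and their limits.\<close>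

lemma approx_coboundary_integrable:
  assumes G: "Int_stable G" "G \<subseteq> Pow (space M)" "sets M = sigma_sets (space M) G"
    and basic: "\<And>A. A \<in> G \<Longrightarrow> approx_coboundary (indicator A)"
    and f: "integrable M f"
  shows "approx_coboundary f"
proof -
  have ind: "approx_coboundary (indicator A)" if "A \<in> sigma_sets (space M) G" for A
    using G(1,2) that
  proof (induction rule: sigma_sets_induct_disjoint)
    case (compl A)
    \<comment> \<open>This function agrees with the indicator of the complement only on
      \<open>space M\<close>; equality as functions fails outside, hence the closure argument at
      distance 0.\<close>
    have "approx_coboundary (\<lambda>x. 1 + (- 1) * indicator A x)"
      by (intro approx_coboundary_add approx_coboundary_const approx_coboundary_scale compl)
    have "approx_coboundary (indicator (space M - A))"
    proof (rule approx_coboundary_closed)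
      have "A \<in> sets M" using compl G by simp
      then show "integrable M (indicator (space M - A) :: 'a \<Rightarrow> real)"
        by (auto simp: integrable_indicator_iff less_top[symmetric])
      fix \<epsilon> :: real assume "\<epsilon> > 0"
      have "expectation (\<lambda>x. \<bar>indicator (space M - A) x - (1 + (- 1) * indicator A x)\<bar>) = expectation (\<lambda>x. 0 :: real)"
        by (intro Bochner_Integration.integral_cong) (auto split: split_indicator)
      then show "\<exists>f'. approx_coboundary f' \<and> expectation (\<lambda>x. \<bar>indicator (space M - A) x - f' x\<bar>) \<le> \<epsilon>"
        using \<open>\<epsilon> > 0\<close> \<open>approx_coboundary (\<lambda>x. 1 + (- 1) * indicator A x)\<close>
        by (intro exI[of _ "\<lambda>x. 1 + (- 1) * indicator A x"]) auto
    qed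
    then show ?case .
  next
    case (union A)
    have A: "A i \<in> sets M" for i using union G by auto
    have sums: "approx_coboundary (\<lambda>x. \<Sum>i<n. indicator (A i) x)" for n
      by (induction n) (auto intro: approx_coboundary_const approx_coboundary_add union)
    show ?case
    proof (rule approx_coboundary_closed)
      show "integrable M (indicator (\<Union>i. A i) :: 'a \<Rightarrow> real)"
        using A by (auto simp: integrable_indicator_iff less_top[symmetric])
      fix \<epsilon> :: real assume "\<epsilon> > 0"
      have ind_sum: "(\<Sum>i<n. indicator (A i) x :: real) = indicator (\<Union>i<n. A i) x" for n x
        by (subst indicator_UN_disjoint) (use union in \<open>auto intro: disjoint_family_on_mono\<close>)
      have "(\<lambda>n. prob (\<Union>i<n. A i)) \<longlonglongrightarrow> prob (\<Union>n. \<Union>i<n. A i)"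
        using A by (intro finite_Lim_measure_incseq incseq_SucI) (auto simp: lessThan_Suc)
      also have "(\<Union>n. \<Union>i<n. A i) = (\<Union>i. A i)" by auto
      finally have "\<forall>\<^sub>F n in sequentially. prob (\<Union>i. A i) - \<epsilon> < prob (\<Union>i<n. A i)"
        using \<open>\<epsilon> > 0\<close> by (intro order_tendstoD(1)) auto
      then obtain n where n: "prob (\<Union>i. A i) - \<epsilon> < prob (\<Union>i<n. A i)"
        unfolding eventually_sequentially by auto
      have "expectation (\<lambda>x. \<bar>indicator (\<Union>i. A i) x - (\<Sum>i<n. indicator (A i) x)\<bar> :: real) =
          expectation (indicator ((\<Union>i. A i) - (\<Union>i<n. A i)))"
        unfolding ind_sum by (intro Bochner_Integration.integral_cong) (auto simp: indicator_def)
      also have "\<dots> = prob ((\<Union>i. A i) - (\<Union>i<n. A i))"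
      proof -
        have "(\<Union>i. A i) - (\<Union>i<n. A i) \<in> sets M" using A by auto
        then show ?thesis by (simp add: Int_absorb2[OF sets.sets_into_space])
      qed
      also have "\<dots> = prob (\<Union>i. A i) - prob (\<Union>i<n. A i)"
        using A by (intro finite_measure_Diff) auto
      finally show "\<exists>f'. approx_coboundary f' \<and> expectation (\<lambda>x. \<bar>indicator (\<Union>i. A i) x - f' x\<bar>) \<le> \<epsilon>"
        using n sums by (intro exI[of _ "\<lambda>x. \<Sum>i<n. indicator (A i) x"]) auto
    qed
  next
    case empty
    have "indicator {} = (\<lambda>_::'a. 0 :: real)" by auto
    then show ?case by (simp only: approx_coboundary_const)
  qed (rule basic)
  from f show ?thesis
  proof (induction rule: integrable_induct)
    case (base A c)
    then have "approx_coboundary (\<lambda>x. c * indicator A x)"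
      using ind G by (intro approx_coboundary_scale) auto
    then show ?case by (simp add: mult.commute)
  next
    case (add f g)
    then show ?case by (intro approx_coboundary_add)
  next
    case (lim f s)
    show ?case
    proof (rule approx_coboundary_closed)
      show "integrable M f" by (rule lim)
      fix \<epsilon> :: real assume "\<epsilon> > 0"
      have "(\<lambda>i. expectation (\<lambda>x. \<bar>f x - s i x\<bar>)) \<longlonglongrightarrow> expectation (\<lambda>x. 0)"
      proof (rule integral_dominated_convergence[where w = "\<lambda>x. 3 * \<bar>f x\<bar>"])
        show "AE x in M. (\<lambda>i. \<bar>f x - s i x\<bar>) \<longlonglongrightarrow> 0"
        proof (rule AE_I2)
          fix x assume "x \<in> space M"
          then have "(\<lambda>i. \<bar>f x - s i x\<bar>) \<longlonglongrightarrow> \<bar>f x - f x\<bar>"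
            using lim by (intro tendsto_intros) auto
          then show "(\<lambda>i. \<bar>f x - s i x\<bar>) \<longlonglongrightarrow> 0" by simp
        qed
        show "AE x in M. norm \<bar>f x - s i x\<bar> \<le> 3 * \<bar>f x\<bar>" for i
        proof (rule AE_I2)
          fix x assume "x \<in> space M"
          then have "\<bar>s i x\<bar> \<le> 2 * \<bar>f x\<bar>" using lim by auto
          then show "norm \<bar>f x - s i x\<bar> \<le> 3 * \<bar>f x\<bar>"
            using abs_triangle_ineq4[of "f x" "s i x"] by simp
        qed
      qed (use lim in auto)
      then have "\<forall>\<^sub>F i in sequentially. expectation (\<lambda>x. \<bar>f x - s i x\<bar>) < \<epsilon>"
        using \<open>\<epsilon> > 0\<close> by (intro order_tendstoD(2)) auto
      then obtain i where "expectation (\<lambda>x. \<bar>f x - s i x\<bar>) < \<epsilon>"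
        unfolding eventually_sequentially by auto
      then show "\<exists>f'. approx_coboundary f' \<and> expectation (\<lambda>x. \<bar>f x - f' x\<bar>) \<le> \<epsilon>"
        using lim by (intro exI[of _ "s i"]) auto
    qed
  qed
qed

end

section \<open>The doubling map\<close>

text \<open>Half-open intervals tile without overlap, and [0, 1) is where \<open>frac\<close> takes
  its values; the end point 1 is a null set.\<close>

lemma integral_unit_lborel_eq:
  fixes f :: "real \<Rightarrow> real"
  assumes [measurable]: "f \<in> borel_measurable borel"
  shows "circle_mean f = integral\<^sup>L lborel (\<lambda>t. indicator {0..<1} t * f t)"
proof -
  have "circle_mean f = integral\<^sup>L lborel (\<lambda>t. indicator {0..1} t *\<^sub>R f t)"
    by (rule integral_restrict_space) simp
  also have "\<dots> = integral\<^sup>L lborel (\<lambda>t. indicator {0..<1} t * f t)"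
    by (rule integral_cong_AE)
       (use AE_lborel_singleton[of "1::real"] in \<open>auto simp: indicator_def elim!: eventually_mono\<close>)
  finally show ?thesis .
qed

lemma integrable_indicator_interval_times:
  fixes h :: "real \<Rightarrow> real"
  assumes [measurable]: "h \<in> borel_measurable borel" and b: "\<And>t. \<bar>h t\<bar> \<le> b"
  shows "integrable lborel (\<lambda>t. indicator {a..<c} t * h t)"
proof (rule Bochner_Integration.integrable_bound[of lborel "\<lambda>t. b * indicator {a..<c} t"])
  show "integrable lborel (\<lambda>t. b * indicator {a..<c} t)"
    by (intro integrable_mult_right integrable_real_indicator emeasure_bounded_finite) auto
  show "AE t in lborel. norm (indicator {a..<c} t * h t) \<le> norm (b * indicator {a..<c} t)"
    using b by (auto intro!: AE_I2 order_trans[OF _ abs_ge_self] simp: indicator_def)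
qed simp

lemma frac_measurable [measurable]: "(frac :: real \<Rightarrow> real) \<in> borel_measurable borel"
  unfolding frac_def[abs_def] by measurable

lemma integral_frac_period:
  fixes f :: "real \<Rightarrow> real"
  assumes "N > (0::nat)"
  shows "integral\<^sup>L lborel (\<lambda>t. indicator {real l / real N..<real (Suc l) / real N} t * f (frac (real N * t))) =
         (1 / real N) * integral\<^sup>L lborel (\<lambda>t. indicator {0..<1} t * f t)"
proof -
  let ?I = "{real l / real N..<real (Suc l) / real N}"
  have "integral\<^sup>L lborel (\<lambda>t. indicator ?I t * f (frac (real N * t))) =
      \<bar>1 / real N\<bar> *\<^sub>R integral\<^sup>L lborel (\<lambda>u. indicator ?I (real l / real N + 1 / real N * u) *
          f (frac (real N * (real l / real N + 1 / real N * u))))"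
    using assms by (intro lborel_integral_real_affine) auto
  also have "(\<lambda>u. indicator ?I (real l / real N + 1 / real N * u) *
          f (frac (real N * (real l / real N + 1 / real N * u)))) = (\<lambda>t. indicator {0..<1} t * f t)"
  proof
    fix u :: real
    have 1: "real N * (real l / real N + 1 / real N * u) = u + of_int (int l)"
      using assms by (simp add: field_simps)
    have "real l / real N + 1 / real N * u = (real l + u) / real N"
      by (simp add: add_divide_distrib)
    then have "real l / real N + 1 / real N * u \<in> ?I \<longleftrightarrow> u \<in> {0..<1}"
      using assms by (simp add: divide_le_cancel divide_less_cancel)
    moreover have "frac (u + of_int (int l)) = u" if "u \<in> {0..<1}"
      using that by (simp add: frac_eq frac_unique_iff)
    ultimately show "indicator ?I (real l / real N + 1 / real N * u) *
          f (frac (real N * (real l / real N + 1 / real N * u))) = indicator {0..<1} u * f u"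
      unfolding 1 by (auto simp: indicator_def)
  qed
  finally show ?thesis by simp
qed

text \<open>Whole periods counted from 0 serve two purposes: with i = N = 2 they give the invariance
  of the measure, and for f of mean zero they show that complete periods contribute nothing to a
  correlation.\<close>

lemma integral_frac_periods:
  fixes f :: "real \<Rightarrow> real"
  assumes N: "N > (0::nat)" and [measurable]: "f \<in> borel_measurable borel" and b: "\<And>t. \<bar>f t\<bar> \<le> b"
  shows "integral\<^sup>L lborel (\<lambda>t. indicator {0..<real i / real N} t * f (frac (real N * t))) =
         (real i / real N) * integral\<^sup>L lborel (\<lambda>t. indicator {0..<1} t * f t)"
proof (induction i)
  case (Suc i)
  have "integral\<^sup>L lborel (\<lambda>t. indicator {0..<real (Suc i) / real N} t * f (frac (real N * t))) =
      integral\<^sup>L lborel (\<lambda>t. indicator {0..<real i / real N} t * f (frac (real N * t)) +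
        indicator {real i / real N..<real (Suc i) / real N} t * f (frac (real N * t)))"
  proof (intro Bochner_Integration.integral_cong refl)
    fix t :: real
    have "real i / real N \<le> real (Suc i) / real N" "0 \<le> real i / real N"
      using N by (auto intro: divide_right_mono)
    moreover have "indicator {0..<q} t = indicator {0..<p} t + (indicator {p..<q} t :: real)"
      if "p \<le> q" "0 \<le> p" for p q
      using that by (auto simp: indicator_def)
    ultimately have "indicator {0..<real (Suc i) / real N} t =
        indicator {0..<real i / real N} t + (indicator {real i / real N..<real (Suc i) / real N} t :: real)"
      by blast
    then show "indicator {0..<real (Suc i) / real N} t * f (frac (real N * t)) =
        indicator {0..<real i / real N} t * f (frac (real N * t)) +
        indicator {real i / real N..<real (Suc i) / real N} t * f (frac (real N * t))"
      by (simp only: distrib_right)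
  qed
  also have "\<dots> = (real i / real N) * integral\<^sup>L lborel (\<lambda>t. indicator {0..<1} t * f t) +
      (1 / real N) * integral\<^sup>L lborel (\<lambda>t. indicator {0..<1} t * f t)"
    unfolding Suc.IH[symmetric] integral_frac_period[OF N, of i, symmetric]
    by (intro Bochner_Integration.integral_add integrable_indicator_interval_times[where b = b];
        (rule b | measurable))
  finally show ?case by (simp add: add_divide_distrib distrib_right)
qed simp

definition doubling :: "real \<Rightarrow> real" where
  "doubling t = frac (2 * t)"

lemma doubling_measurable [measurable]: "doubling \<in> borel_measurable borel"
  unfolding doubling_def[abs_def] by measurable

lemma doubling_measurable_unit [measurable]: "doubling \<in> unit_lborel \<rightarrow>\<^sub>M unit_lborel"
  by (intro measurable_restrict_space3) (auto simp: doubling_def frac_lt_1 less_imp_le)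

lemma frac_eq_iff_int_diff: "frac x = frac y \<longleftrightarrow> (\<exists>k::int. (x::real) = y + of_int k)"
proof
  assume "frac x = frac y"
  then have "x = y + of_int (\<lfloor>x\<rfloor> - \<lfloor>y\<rfloor>)" by (simp add: frac_def)
  then show "\<exists>k::int. x = y + of_int k" ..
next
  assume "\<exists>k::int. x = y + of_int k"
  then show "frac x = frac y" by (auto simp: frac_def)
qed

text \<open>For successors only: the zeroth power is the identity, which differs from
  \<open>frac\<close> at the end point 1.\<close>

lemma doubling_power: "(doubling ^^ Suc j) t = frac (2 ^ Suc j * t)"
proof (induction j)
  case (Suc j)
  have "(doubling ^^ Suc (Suc j)) t = doubling ((doubling ^^ Suc j) t)" by simp
  also have "\<dots> = frac (2 * frac (2 ^ Suc j * t))"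
    unfolding Suc by (simp only: doubling_def)
  also have "\<dots> = frac (2 ^ Suc (Suc j) * t)"
  proof -
    have "2 * frac (2 ^ Suc j * t) = 2 ^ Suc (Suc j) * t + of_int (- 2 * \<lfloor>2 ^ Suc j * t\<rfloor>)"
      by (simp add: frac_def algebra_simps)
    then show ?thesis unfolding frac_eq_iff_int_diff by blast
  qed
  finally show ?case .
qed (simp add: doubling_def)

lemma prob_space_unit_lborel: "prob_space unit_lborel"
  by (rule prob_spaceI) (simp add: emeasure_restrict_space space_restrict_space)

lemma distr_doubling: "distr unit_lborel unit_lborel doubling = unit_lborel"
proof (rule measure_eqI)
  interpret prob_space unit_lborel by (rule prob_space_unit_lborel)
  fix A assume "A \<in> sets (distr unit_lborel unit_lborel doubling)"
  then have A: "A \<in> sets unit_lborel" by simp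
  then have [measurable]: "A \<in> sets borel" and A_sub: "A \<subseteq> {0..1}"
    by (auto simp: sets_restrict_space)
  have meas_ind: "measure unit_lborel B = circle_mean (indicator B)" if "B \<in> sets unit_lborel" for B
    using sets.sets_into_space[OF that] by (simp add: Int_absorb2)
  have B: "doubling -` A \<inter> space unit_lborel \<in> sets unit_lborel"
    using A by measurable
  have "measure unit_lborel (doubling -` A \<inter> space unit_lborel) =
      circle_mean (\<lambda>t. indicator A (doubling t))"
    unfolding meas_ind[OF B] by (intro Bochner_Integration.integral_cong) (auto simp: indicator_def)
  also have "\<dots> = integral\<^sup>L lborel (\<lambda>t. indicator {0..<real 2 / real 2} t * indicator A (frac (real 2 * t)))"
    by (subst integral_unit_lborel_eq) (simp_all add: doubling_def)
  also have "\<dots> = (real 2 / real 2) * integral\<^sup>L lborel (\<lambda>t. indicator {0..<1} t * indicator A t)"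
    by (rule integral_frac_periods[of _ _ 1]) (auto simp: indicator_def)
  also have "\<dots> = measure unit_lborel A"
    unfolding meas_ind[OF A] by (subst integral_unit_lborel_eq) simp_all
  finally show "emeasure (distr unit_lborel unit_lborel doubling) A = emeasure unit_lborel A"
    using A by (simp add: emeasure_distr emeasure_eq_measure)
qed simp

interpretation doubling: measure_preserving unit_lborel doubling
  using prob_space_unit_lborel distr_doubling
  by (auto intro!: measure_preserving.intro simp: measure_preserving_axioms_def)

text \<open>The composed function has period 1 / N with N = 2^j and mean zero over each period. The
  interval [0, a) consists of i whole periods, which contribute nothing, and a rest of length at
  most 1 / N, which alone bounds the correlation.\<close>

lemma correlation_interval_doubling:
  assumes a: "0 < a" "a \<le> 1"
  defines "f \<equiv> \<lambda>t. indicator {0..<a} t - a"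
  shows "\<bar>circle_mean (\<lambda>t. f t * f ((doubling ^^ j) t))\<bar> \<le> 1 * (1/2) ^ j"
    and "circle_mean f = 0"
proof -
  have [measurable]: "f \<in> borel_measurable borel" unfolding f_def by measurable
  have f_bound: "\<bar>f t\<bar> \<le> 1" for t using a by (auto simp: f_def indicator_def)
  have "circle_mean f = integral\<^sup>L lborel (\<lambda>t. indicator {0..<a} t - a * indicator {0..<1} t)"
    using a by (subst integral_unit_lborel_eq) (auto intro!: Bochner_Integration.integral_cong simp: f_def indicator_def)
  also have "\<dots> = a - a"
    using a by (subst Bochner_Integration.integral_diff)
      (auto intro!: integrable_mult_right integrable_real_indicator emeasure_bounded_finite)
  finally show mean: "circle_mean f = 0" by simp
  have mean': "integral\<^sup>L lborel (\<lambda>t. indicator {0..<1} t * f t) = 0"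
    using mean by (subst (asm) integral_unit_lborel_eq) simp_all
  show "\<bar>circle_mean (\<lambda>t. f t * f ((doubling ^^ j) t))\<bar> \<le> 1 * (1/2) ^ j"
  proof (cases j)
    case 0
    have ff: "\<bar>f t * f t\<bar> \<le> 1" for t
      using f_bound[of t] by (simp only: abs_mult mult_le_one abs_ge_zero)
    have "\<bar>circle_mean (\<lambda>t. f t * f t)\<bar> \<le> circle_mean (\<lambda>t. 1)"
    proof (rule integral_abs_bound_integral)
      show "integrable unit_lborel (\<lambda>t. f t * f t)"
      proof (rule doubling.integrable_const_bound[of _ 1])
        show "AE t in unit_lborel. norm (f t * f t) \<le> 1" using ff by (intro AE_I2) simp
      qed (intro measurable_restrict_space1, measurable)
    qed (use ff in simp_all)
    then show ?thesis using 0 doubling.prob_space by simp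
  next
    case (Suc j')
    define N :: nat where "N = 2 ^ j"
    have N: "N > 0" by (simp add: N_def)
    have S: "(doubling ^^ j) t = frac (real N * t)" for t
      unfolding Suc doubling_power by (simp add: N_def Suc)
    define i where "i = nat \<lfloor>real N * a\<rfloor>"
    have i_le: "real i \<le> real N * a" "real N * a < real i + 1"
      using a N unfolding i_def by (auto simp: of_nat_nat)
    have iN: "real i / real N \<le> a" "a - real i / real N \<le> 1 / real N" "0 \<le> real i / real N"
    proof -
      show "real i / real N \<le> a" using i_le N by (simp add: pos_divide_le_eq mult.commute)
      have "a \<le> (real i + 1) / real N" using i_le N by (simp add: pos_le_divide_eq mult.commute)
      then show "a - real i / real N \<le> 1 / real N" by (simp add: add_divide_distrib)
    qed simp
    let ?g = "\<lambda>t. f (frac (real N * t))"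
    have g_bound: "\<bar>?g t\<bar> \<le> 1" for t using f_bound .
    have g_meas [measurable]: "?g \<in> borel_measurable borel" by measurable
    have full: "integral\<^sup>L lborel (\<lambda>t. indicator {0..<1} t * ?g t) = 0"
      using integral_frac_periods[OF N \<open>f \<in> _\<close> f_bound, of N] N mean' by simp
    have part: "integral\<^sup>L lborel (\<lambda>t. indicator {0..<real i / real N} t * ?g t) = 0"
      using integral_frac_periods[OF N \<open>f \<in> _\<close> f_bound, of i] mean' by simp
    have "circle_mean (\<lambda>t. f t * ?g t) =
        integral\<^sup>L lborel (\<lambda>t. indicator {0..<real i / real N} t * ?g t +
          indicator {real i / real N..<a} t * ?g t - a * (indicator {0..<1} t * ?g t))"
    proof -
      \<comment> \<open>The first factor is split into the whole periods, the rest of [0, a), and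
        the constant - a; only the middle part can have a nonzero integral.\<close>
      have "indicator {0..<1} t * (f t * y) = indicator {0..<p} t * y + indicator {p..<a} t * y - a * (indicator {0..<1} t * y)"
        if "0 \<le> p" "p \<le> a" for t y p
        using that a by (auto simp: f_def indicator_def algebra_simps)
      note eq = this[OF iN(3,1)]
      have m: "(\<lambda>t. f t * ?g t) \<in> borel_measurable borel" by measurable
      show ?thesis unfolding integral_unit_lborel_eq[OF m] eq ..
    qed
    also have "\<dots> = integral\<^sup>L lborel (\<lambda>t. indicator {real i / real N..<a} t * ?g t)"
      using integrable_indicator_interval_times[OF g_meas g_bound] full part by simp
    finally have "\<bar>circle_mean (\<lambda>t. f t * ?g t)\<bar> \<le>
        integral\<^sup>L lborel (indicator {real i / real N..<a})"
    proof (simp only:, intro integral_abs_bound_integral)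
      show "integrable lborel (indicator {real i / real N..<a} :: real \<Rightarrow> real)"
        by (intro integrable_real_indicator emeasure_bounded_finite) auto
      show "\<bar>indicator {real i / real N..<a} t * ?g t\<bar> \<le> indicator {real i / real N..<a} t" for t
        using g_bound[of t] by (auto simp: indicator_def)
    qed (rule integrable_indicator_interval_times[OF g_meas g_bound])
    also have "\<dots> = a - real i / real N"
      using iN by simp
    also have "\<dots> \<le> 1 / real N" by (rule iN)
    finally show ?thesis unfolding S by (simp add: N_def power_one_over)
  qed
qed

lemma approx_coboundary_doubling:
  assumes "integrable unit_lborel f"
  shows "doubling.approx_coboundary f"
proof (rule doubling.approx_coboundary_integrable[OF _ _ _ _ assms])
  \<comment> \<open>Initial pieces are stable under intersection and, apart from the empty set and
    the whole interval, are the half-open intervals whose correlations decay.\<close>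
  let ?G = "(\<inter>) {0..1::real} ` range lessThan"
  show "Int_stable ?G"
  proof (rule Int_stableI_image)
    have "({0..1::real} \<inter> {..<a}) \<inter> ({0..1} \<inter> {..<b}) = {0..1} \<inter> {..<min a b}" for a b
      by auto
    then show "\<exists>k\<in>range lessThan. ({0..1::real} \<inter> i) \<inter> ({0..1} \<inter> j) = {0..1} \<inter> k"
      if "i \<in> range lessThan" "j \<in> range lessThan" for i j
      using that by (metis imageE rangeI)
  qed
  show "?G \<subseteq> Pow (space unit_lborel)" by (auto simp: space_restrict_space)
  have "sets unit_lborel = (\<inter>) {0..1::real} ` sigma_sets UNIV (range lessThan)"
    by (simp add: sets_restrict_space borel_Iio)
  also have "\<dots> = sigma_sets {0..1} ?G"
  proof (rule sigma_sets_Int)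
    have "{0..1::real} \<in> sets borel" by simp
    then show "{0..1::real} \<in> sigma_sets UNIV (range lessThan)"
      by (simp add: borel_Iio)
  qed simp
  finally show "sets unit_lborel = sigma_sets (space unit_lborel) ?G"
    by (simp add: space_restrict_space)
  fix A assume "A \<in> ?G"
  then obtain a where A: "A = {0..1} \<inter> {..<a}" by auto
  have [measurable]: "A \<in> sets unit_lborel" by (auto simp: A sets_restrict_space)
  consider "a \<le> 0" | "0 < a" "a \<le> 1" | "a > 1" by linarith
  then show "doubling.approx_coboundary (indicator A)"
  proof cases
    case 1
    then have "indicator A = (\<lambda>_. 0 :: real)" by (auto simp: A indicator_def)
    then show ?thesis by (simp only: doubling.approx_coboundary_const)
  next
    case 2
    define g where "g = (\<lambda>t. indicator {0..<a} t - a)"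
    have "A = {0..<a}" using 2 by (auto simp: A)
    then have "indicator A = (\<lambda>t. g t + a)" by (simp add: g_def fun_eq_iff)
    moreover have "doubling.approx_coboundary g"
      using correlation_interval_doubling[OF 2] 2 unfolding g_def
      by (intro doubling.approx_coboundary_correlation[of _ 1 1])
         (auto simp: indicator_def intro!: measurable_restrict_space1)
    ultimately show ?thesis
      by (simp only:) (intro doubling.approx_coboundary_add doubling.approx_coboundary_const)
  next
    case 3
    then have "A = {0..1}" by (auto simp: A)
    \<comment> \<open>The indicator equals 1 only on the interval itself, hence the detour through
      an approximation at distance 0.\<close>
    show ?thesis
    proof (rule doubling.approx_coboundary_closed)
      show "integrable unit_lborel (indicator A :: real \<Rightarrow> real)"
        by (rule integrable_real_indicator) (simp_all add: less_top[symmetric])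
      have "circle_mean (\<lambda>x. \<bar>indicator A x - 1\<bar> :: real) = circle_mean (\<lambda>x. 0)"
        using \<open>A = {0..1}\<close> by (intro Bochner_Integration.integral_cong) (auto simp: space_restrict_space)
      then show "\<exists>f'. doubling.approx_coboundary f' \<and> circle_mean (\<lambda>x. \<bar>indicator A x - f' x\<bar>) \<le> \<epsilon>"
        if "\<epsilon> > 0" for \<epsilon>
        using that by (intro exI[of _ "\<lambda>_. 1"]) (auto simp: doubling.approx_coboundary_const)
    qed
  qed
qed

section \<open>The zeta function on the critical line\<close>

text \<open>The point w = 0 is the pole s = 1. There the product would give 0, whereas the removable
  singularity has the residue 1 as its value.\<close>

definition zeta_disc :: "complex \<Rightarrow> complex" where
  "zeta_disc w = (if w = 0 then 1 else w * zeta (1 / (1 - w)))"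

text \<open>From s - 1 = w / (1 - w) it follows that w zeta(s) is 1 - w times (s - 1) zeta(s). At w
  = 0 the vanishing remainder gives the same formula.\<close>

lemma zeta_disc_eq_remainder:
  assumes "Re (1 / (1 - w)) > 0" "w \<noteq> 1"
  shows "zeta_disc w = (1 - w) * (1 + remainder_series 1 (1 / (1 - w)))"
proof (cases "w = 0")
  case False
  have eq: "1 / (1 - w) - 1 = w / (1 - w)" using assms by (simp add: field_simps)
  have "1 / (1 - w) \<noteq> 1" using assms False by (auto simp: field_simps)
  from zeta_eq_remainder_series[OF assms(1) this]
  have "w / (1 - w) * zeta (1 / (1 - w)) = 1 + remainder_series 1 (1 / (1 - w))"
    unfolding eq .
  then show ?thesis
    using False assms by (simp add: zeta_disc_def field_simps)
qed (use remainder_series_1_at_1 in \<open>simp add: zeta_disc_def\<close>)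

lemma Re_inverse_disc:
  assumes "norm w \<le> 1" "w \<noteq> 1"
  shows "Re (1 / (1 - w)) \<ge> 1/2"
proof -
  have "(norm w)\<^sup>2 \<le> 1" using assms by (simp add: power_le_one)
  then have "(norm (1 - w))\<^sup>2 \<le> 2 * Re (1 - w)"
    unfolding cmod_power2 by (simp add: power2_eq_square algebra_simps)
  moreover have "(norm (1 - w))\<^sup>2 > 0" using assms by simp
  moreover have "Re (1 / (1 - w)) = Re (1 - w) / (norm (1 - w))\<^sup>2"
    unfolding Re_divide by (simp add: cmod_power2)
  ultimately show ?thesis by (simp only: le_divide_eq) auto
qed

text \<open>In the unit disc holomorphy comes from the remainder formula, which is regular at 0; off
  0 and 1 it comes from zeta itself. The two open sets cover everything but 1.\<close>

lemma holomorphic_zeta_disc: "zeta_disc holomorphic_on - {1}"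
proof -
  have "(\<lambda>w. (1 - w) * (1 + remainder_series 1 (1 / (1 - w)))) holomorphic_on ball 0 1"
  proof -
    have "(\<lambda>w. 1 / (1 - w)) ` ball 0 1 \<subseteq> {s. Re s > 1 - real 1}"
    proof safe
      fix w :: complex assume "w \<in> ball 0 1"
      then have "norm w \<le> 1" "w \<noteq> 1" by auto
      from Re_inverse_disc[OF this] show "Re (1 / (1 - w)) > 1 - real 1" by simp
    qed
    then show ?thesis
      by (intro holomorphic_intros holomorphic_on_compose_gen[OF _ holomorphic_remainder_series, unfolded o_def]) auto
  qed
  then have 1: "zeta_disc holomorphic_on ball 0 1"
  proof (rule holomorphic_transform)
    fix w :: complex assume "w \<in> ball 0 1"
    then have w: "norm w \<le> 1" "w \<noteq> 1" by auto
    show "(1 - w) * (1 + remainder_series 1 (1 / (1 - w))) = zeta_disc w"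
      using Re_inverse_disc[OF w] w by (intro zeta_disc_eq_remainder[symmetric]) auto
  qed
  have "(\<lambda>w. w * zeta (1 / (1 - w))) holomorphic_on - {0, 1}"
    by (intro holomorphic_intros holomorphic_on_compose_gen[OF _ holomorphic_zeta, unfolded o_def])
       (auto simp: field_simps)
  then have 2: "zeta_disc holomorphic_on - {0, 1}"
    by (rule holomorphic_transform) (auto simp: zeta_disc_def)
  have "zeta_disc holomorphic_on ball 0 1 \<union> - {0, 1}"
    using 1 2 by (intro holomorphic_on_Un) (auto intro: finite_imp_closed)
  moreover have "ball 0 1 \<union> - {0, 1} = - {1 :: complex}" by auto
  ultimately show ?thesis by simp
qed

lemma zeta_disc_bound:
  obtains C where "C > 0" "\<And>w. norm w \<le> 1 \<Longrightarrow> w \<noteq> 1 \<Longrightarrow> norm (zeta_disc w) \<le> C / norm (1 - w)"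
proof -
  obtain C where C: "C > 0" "\<And>s. Re s \<ge> 1/2 \<Longrightarrow> norm (remainder_series 1 s) \<le> C * norm (1 - s) * norm s"
    using norm_remainder_series_1_le by blast
  have "norm (zeta_disc w) \<le> (4 + C) / norm (1 - w)" if w: "norm w \<le> 1" "w \<noteq> 1" for w
  proof -
    define s where "s = 1 / (1 - w)"
    define d where "d = norm (1 - w)"
    have d: "d > 0" "d \<le> 2"
      using w norm_triangle_ineq4[of 1 w] by (auto simp: d_def)
    have Re_s: "Re s \<ge> 1/2" unfolding s_def by (rule Re_inverse_disc[OF w])
    have ns: "norm s = 1 / d" by (simp add: s_def d_def norm_divide)
    have "1 - s = - w / (1 - w)" using w by (simp add: s_def field_simps)
    then have "norm (1 - s) \<le> 1 / d"
      using w d by (simp add: norm_divide d_def divide_right_mono)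
    then have "C * norm (1 - s) * norm s \<le> C * (1 / d) * (1 / d)"
      unfolding ns using C d by (intro mult_mono) auto
    then have rem: "norm (remainder_series 1 s) \<le> C * (1 / d) * (1 / d)"
      using C(2)[OF Re_s] by linarith
    have "norm (zeta_disc w) = d * norm (1 + remainder_series 1 s)"
      using Re_s w by (subst zeta_disc_eq_remainder) (auto simp: s_def d_def norm_mult)
    also have "\<dots> \<le> d * (1 + C * (1 / d) * (1 / d))"
      using rem d norm_triangle_ineq[of 1 "remainder_series 1 s"] by (intro mult_left_mono) auto
    also have "\<dots> = (d * d + C) / d" using d by (simp add: field_simps)
    also have "\<dots> \<le> (4 + C) / d"
    proof -
      have "d * d \<le> 2 * 2" using d by (intro mult_mono) auto
      then show ?thesis using d by (intro divide_right_mono) auto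
    qed
    finally show ?thesis by (simp add: d_def)
  qed
  moreover have "4 + C > 0" using C by simp
  ultimately show ?thesis using that by blast
qed

lemma zeta_disc_ge:
  assumes "0 \<le> x" "x < 1"
  shows "norm (zeta_disc (of_real x)) \<ge> x"
proof (cases "x = 0")
  case False
  then have "1 / (1 - x) > 1" using assms by simp
  then have "norm (zeta (of_real (1 / (1 - x)))) \<ge> 1" by (rule norm_zeta_real_ge_1)
  then have "x * 1 \<le> x * norm (zeta (1 / (1 - of_real x)))"
    using assms by (intro mult_left_mono) auto
  then show ?thesis using False assms by (simp add: zeta_disc_def norm_mult)
qed (simp add: zeta_disc_def)

text \<open>With s = 1 / (1 - w) one has s - \<rho> = (w - a) / ((1 - w) (1 - a)), so the power of s
  - \<rho> in zeta becomes the same power of w - a; all other factors, including w, are nonzero at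
  a.\<close>

lemma zorder_zeta_disc:
  assumes a: "norm a < 1" "a \<noteq> 0"
  shows "zorder zeta_disc a = zorder zeta (1 / (1 - a))"
proof -
  define \<rho> where "\<rho> = 1 / (1 - a)"
  have a1: "a \<noteq> 1" using a by auto
  have \<rho>1: "\<rho> \<noteq> 1" using a a1 by (auto simp: \<rho>_def field_simps)
  define m where "m = nat (zorder zeta \<rho>)"
  have nz: "\<exists>w\<in>- {1}. zeta w \<noteq> 0"
    using norm_zeta_real_ge_1[of 2] by (intro bexI[of _ 2]) auto
  have conn: "connected (- {1 :: complex})"
    by (intro connected_punctured_universe) auto
  obtain h where h: "h holomorphic_on - {1}" "h \<rho> \<noteq> 0"
      "\<And>w. w \<in> - {1} \<Longrightarrow> zeta w = (w - \<rho>) ^ m * h w"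
    using holomorphic_factor_zero[OF holomorphic_zeta _ conn, of \<rho>] nz \<rho>1 unfolding m_def by auto
  have zorder_nonneg: "zorder zeta \<rho> \<ge> 0"
    using zorder_exist_zero[OF holomorphic_zeta open_Compl[OF closed_singleton] conn _ nz, of \<rho>] \<rho>1 by (auto split: if_splits)
  define g where "g w = w * h (1 / (1 - w)) / ((1 - w) * (1 - a)) ^ m" for w
  have "zorder zeta_disc a = int m"
  proof (rule zorder_eqI[of "- {0, 1}" _ g])
    have "1 / (1 - w) \<noteq> 1" if "w \<in> - {0, 1}" for w :: complex
      using that by (auto simp: field_simps)
    then show "g holomorphic_on - {0, 1}"
      unfolding g_def using a1
      by (intro holomorphic_intros holomorphic_on_compose_gen[OF _ h(1), unfolded o_def]) auto
    show "g a \<noteq> 0" using h(2) a a1 by (simp add: g_def \<rho>_def)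
    show "zeta_disc w = g w * (w - a) powi int m" if "w \<in> - {0, 1}" for w
    proof -
      have w: "w \<noteq> 0" "w \<noteq> 1" using that by auto
      have "1 / (1 - w) \<noteq> 1" using w by (auto simp: field_simps)
      then have "zeta_disc w = w * ((1 / (1 - w) - \<rho>) ^ m * h (1 / (1 - w)))"
        using w h(3)[of "1 / (1 - w)"] by (simp add: zeta_disc_def)
      also have "1 / (1 - w) - \<rho> = (w - a) / ((1 - w) * (1 - a))"
        using w a1 by (simp add: \<rho>_def field_simps)
      finally have "zeta_disc w = w * ((w - a) ^ m / ((1 - w) * (1 - a)) ^ m * h (1 / (1 - w)))"
        by (simp only: power_divide)
      moreover have "w * (x / D * y) = w * y / D * x" for x y D :: complex by simp
      ultimately show ?thesis by (simp only: g_def power_int_of_nat)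
    qed
  qed (use a a1 in \<open>auto intro: finite_imp_closed\<close>)
  then show ?thesis using zorder_nonneg by (simp add: m_def \<rho>_def)
qed

text \<open>The dummy value at the pole creates no spurious pair: w = 0 is no zero of
  \<open>zeta_disc\<close>, and s = 1 is excluded on the other side. The trivial zeros have negative
  real part.\<close>

lemma bij_betw_disc_zeros:
  "bij_betw (\<lambda>a. 1 / (1 - a)) {a. norm a < 1 \<and> zeta_disc a = 0}
     {\<rho> \<in> nontrivial_zeta_zeros. Re \<rho> > 1/2}"
proof (rule bij_betwI[where g = "\<lambda>\<rho>. 1 - 1 / \<rho>"])
  show "(\<lambda>a. 1 / (1 - a)) \<in> {a. norm a < 1 \<and> zeta_disc a = 0} \<rightarrow> {\<rho> \<in> nontrivial_zeta_zeros. Re \<rho> > 1/2}"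
  proof safe
    fix a :: complex assume a: "norm a < 1" "zeta_disc a = 0"
    have a0: "a \<noteq> 0" and a1: "a \<noteq> 1" using a by (auto simp: zeta_disc_def)
    have z: "zeta (1 / (1 - a)) = 0" using a a0 by (simp add: zeta_disc_def)
    have "(norm a)\<^sup>2 < 1" using a by (simp add: power_less_one_iff)
    then have "(norm (1 - a))\<^sup>2 < 2 * Re (1 - a)"
      unfolding cmod_power2 by (simp add: power2_eq_square algebra_simps)
    moreover have "(norm (1 - a))\<^sup>2 > 0" using a1 by simp
    moreover have "Re (1 / (1 - a)) = Re (1 - a) / (norm (1 - a))\<^sup>2"
      unfolding Re_divide by (simp add: cmod_power2)
    ultimately show Re: "Re (1 / (1 - a)) > 1/2" by (simp only: less_divide_eq) auto
    have "1 / (1 - a) \<noteq> 1" using a0 a1 by (auto simp: field_simps)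
    moreover have "1 / (1 - a) \<noteq> - 2 * of_nat (Suc m)" for m :: nat
    proof
      assume eq: "1 / (1 - a) = - 2 * of_nat (Suc m)"
      have "Re (- 2 * of_nat (Suc m) :: complex) \<le> 0" by simp
      with Re show False unfolding eq by linarith
    qed
    ultimately show "1 / (1 - a) \<in> nontrivial_zeta_zeros"
      unfolding nontrivial_zeta_zeros_def using z by auto
  qed
  show "(\<lambda>\<rho>. 1 - 1 / \<rho>) \<in> {\<rho> \<in> nontrivial_zeta_zeros. Re \<rho> > 1/2} \<rightarrow> {a. norm a < 1 \<and> zeta_disc a = 0}"
  proof safe
    fix \<rho> assume \<rho>: "\<rho> \<in> nontrivial_zeta_zeros" "Re \<rho> > 1/2"
    then have \<rho>0: "\<rho> \<noteq> 0" and \<rho>1: "\<rho> \<noteq> 1" and z: "zeta \<rho> = 0"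
      by (auto simp: nontrivial_zeta_zeros_def)
    have "(norm (\<rho> - 1))\<^sup>2 < (norm \<rho>)\<^sup>2"
      using \<rho>(2) unfolding cmod_power2 by (simp add: power2_eq_square algebra_simps)
    then have "norm (\<rho> - 1) < norm \<rho>" by (rule power2_less_imp_less) simp
    moreover have "1 - 1 / \<rho> = (\<rho> - 1) / \<rho>" using \<rho>0 by (simp add: field_simps)
    ultimately show "norm (1 - 1 / \<rho>) < 1"
      using \<rho>0 by (simp add: norm_divide)
    have "1 - 1 / \<rho> \<noteq> 0" using \<rho>0 \<rho>1 by (auto simp: field_simps)
    then show "zeta_disc (1 - 1 / \<rho>) = 0" using z \<rho>0 by (simp add: zeta_disc_def)
  qed
  show "1 - 1 / (1 / (1 - a)) = a" for a :: complex by simp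
  show "1 / (1 - (1 - 1 / \<rho>)) = \<rho>" for \<rho> :: complex by simp
qed

lemma zeta_boundary_mean:
  shows integrable_zeta_boundary: "integrable unit_lborel (\<lambda>t. ln (norm (zeta_disc (unit_exp t))))"
    and summable_zeta_zeros: "(\<lambda>\<rho>. of_int (zorder zeta \<rho>) * ln (norm (\<rho> / (1 - \<rho>))))
           summable_on {\<rho> \<in> nontrivial_zeta_zeros. Re \<rho> > 1/2}"
    and integral_zeta_boundary: "circle_mean (\<lambda>t. ln (norm (zeta_disc (unit_exp t)))) =
      (\<Sum>\<^sub>\<infinity>\<rho> | \<rho> \<in> nontrivial_zeta_zeros \<and> Re \<rho> > 1/2.
                    of_int (zorder zeta \<rho>) * ln (norm (\<rho> / (1 - \<rho>))))"
proof -
  obtain C where C: "C > 0" "\<And>w. norm w \<le> 1 \<Longrightarrow> w \<noteq> 1 \<Longrightarrow> norm (zeta_disc w) \<le> C / norm (1 - w)"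
    using zeta_disc_bound by blast
  interpret jensen_at_boundary zeta_disc C
    by unfold_locales (use C zeta_disc_ge holomorphic_zeta_disc in \<open>auto simp: zeta_disc_def[of 0]\<close>)
  show "integrable unit_lborel (\<lambda>t. ln (norm (zeta_disc (unit_exp t))))"
    by (rule integrable_ln_norm_boundary)
  let ?Z = "{a. norm a < 1 \<and> zeta_disc a = 0}"
  let ?c = "\<lambda>\<rho>. of_int (zorder zeta \<rho>) * ln (norm (\<rho> / (1 - \<rho>)))"
  \<comment> \<open>With \<rho> = 1 / (1 - a) one has \<rho> / (1 - \<rho>) = - 1 / a, so the
    weights of corresponding zeros agree.\<close>
  have eq: "?c (1 / (1 - a)) = of_int (zorder zeta_disc a) * ln (1 / norm a)" if "a \<in> ?Z" for a
  proof -
    have a0: "a \<noteq> 0" "a \<noteq> 1" using that by (auto simp: zeta_disc_def)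
    then have "(1 / (1 - a)) / (1 - 1 / (1 - a)) = - 1 / a" by (simp add: field_simps)
    then have "norm ((1 / (1 - a)) / (1 - 1 / (1 - a))) = 1 / norm a"
      by (simp only: norm_divide norm_minus_cancel norm_one)
    then show ?thesis using zorder_zeta_disc[of a] that a0 by simp
  qed
  have "?c summable_on {\<rho> \<in> nontrivial_zeta_zeros. Re \<rho> > 1/2} \<longleftrightarrow> (\<lambda>a. ?c (1 / (1 - a))) summable_on ?Z"
    by (rule summable_on_reindex_bij_betw[OF bij_betw_disc_zeros, symmetric])
  also have "\<dots> \<longleftrightarrow> (\<lambda>a. of_int (zorder zeta_disc a) * ln (1 / norm a)) summable_on ?Z"
    by (rule summable_on_cong) (rule eq)
  finally show "?c summable_on {\<rho> \<in> nontrivial_zeta_zeros. Re \<rho> > 1/2}"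
    using summable_zeros by simp
  have "infsum ?c {\<rho> \<in> nontrivial_zeta_zeros. Re \<rho> > 1/2} = (\<Sum>\<^sub>\<infinity>a\<in>?Z. ?c (1 / (1 - a)))"
    by (rule infsum_reindex_bij_betw[OF bij_betw_disc_zeros, symmetric])
  also have "\<dots> = (\<Sum>\<^sub>\<infinity>a\<in>?Z. of_int (zorder zeta_disc a) * ln (1 / norm a))"
    by (rule infsum_cong) (rule eq)
  finally show "circle_mean (\<lambda>t. ln (norm (zeta_disc (unit_exp t)))) =
      infsum ?c {\<rho>. \<rho> \<in> nontrivial_zeta_zeros \<and> Re \<rho> > 1/2}"
    by (simp add: integral_ln_norm_boundary)
qed

section \<open>The Cayley transform and the conjugacy of T with doubling\<close>

definition cayley :: "real \<Rightarrow> complex" where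
  "cayley x = (of_real x + \<i>) / (of_real x - \<i>)"

lemma of_real_neq_i: "complex_of_real x \<noteq> \<i>" "complex_of_real x \<noteq> - \<i>"
  by (auto simp: complex_eq_iff)

lemma norm_cayley: "norm (cayley x) = 1"
proof -
  have "norm (of_real x + \<i>) = norm (of_real x - \<i>)"
    by (simp add: cmod_def)
  moreover have "of_real x - \<i> \<noteq> 0" using of_real_neq_i by simp
  ultimately show ?thesis by (simp add: cayley_def norm_divide)
qed

text \<open>Because T x + i = (x + i)^2 / (2 x) and T x - i = (x - i)^2 / (2 x). At x = 0 it fails:
  the transform of T 0 = 0 is -1, whose square is 1.\<close>

lemma cayley_T:
  assumes "x \<noteq> 0"
  shows "cayley (T x) = (cayley x)\<^sup>2"
proof -
  define z where "z = complex_of_real x"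
  have z: "z \<noteq> 0" "z \<noteq> \<i>" using assms of_real_neq_i by (auto simp: z_def)
  have T: "complex_of_real (T x) = (z\<^sup>2 - 1) / (2 * z)"
    using assms by (simp add: T_def z_def power2_eq_square field_simps)
  have "of_real (T x) + \<i> = (z + \<i>)\<^sup>2 / (2 * z)" "of_real (T x) - \<i> = (z - \<i>)\<^sup>2 / (2 * z)"
    unfolding T using z by (simp_all add: power2_eq_square field_simps)
  then show ?thesis
    unfolding cayley_def z_def[symmetric] using z by (simp add: power_divide)
qed

text \<open>The factor w of \<open>zeta_disc\<close> has modulus 1 here and drops out, so the
  logarithm is that of zeta alone.\<close>

lemma ln_norm_zeta_disc_cayley:
  "ln (norm (zeta_disc (cayley x))) = ln (norm (zeta (1/2 + 1/2 * \<i> * of_real x)))"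
proof -
  define z where "z = complex_of_real x"
  have z: "z - \<i> \<noteq> 0" using of_real_neq_i by (simp add: z_def)
  have "1 - cayley x = - 2 * \<i> / (z - \<i>)"
    using z by (simp add: cayley_def z_def field_simps)
  then have "1 / (1 - cayley x) = (z - \<i>) / (- 2 * \<i>)" by simp
  also have "\<dots> = 1/2 + 1/2 * \<i> * z" by (simp add: field_simps)
  finally have "1 / (1 - cayley x) = 1/2 + 1/2 * \<i> * z" .
  moreover have "cayley x \<noteq> 0" using norm_cayley[of x] by auto
  ultimately show ?thesis
    by (simp add: zeta_disc_def norm_mult norm_cayley z_def)
qed

text \<open>Multiplying numerator and denominator by the sine leaves exp(i pi t) / exp(- i pi t);
  the cotangent of pi t is the inverse Cayley transform in terms of the angle.\<close>

lemma cayley_cot: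
  assumes "0 < t" "t < 1"
  shows "cayley (cos (pi * t) / sin (pi * t)) = unit_exp t"
proof -
  have s: "sin (pi * t) > 0" using assms by (intro sin_gt_zero) auto
  define c s' where "c = complex_of_real (cos (pi * t))" and "s' = complex_of_real (sin (pi * t))"
  have s0: "s' \<noteq> 0" using s by (simp add: s'_def)
  have "c + \<i> * s' = cis (pi * t)" "c - \<i> * s' = cis (- (pi * t))"
    by (auto simp: c_def s'_def complex_eq_iff)
  moreover have "cayley (cos (pi * t) / sin (pi * t)) = (c + \<i> * s') / (c - \<i> * s')"
  proof -
    have "c / s' + \<i> = (c + \<i> * s') / s'" "c / s' - \<i> = (c - \<i> * s') / s'"
      using s0 by (simp_all add: field_simps)
    then show ?thesis using s0 by (simp add: cayley_def c_def[symmetric] s'_def[symmetric])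
  qed
  ultimately show ?thesis
    by (simp add: unit_exp_def cis_divide algebra_simps)
qed

lemma unit_exp_doubling_power: "unit_exp ((doubling ^^ j) t) = unit_exp t ^ (2 ^ j)"
proof (induction j)
  case (Suc j)
  have "unit_exp (doubling s) = unit_exp s ^ 2" for s
  proof -
    have "unit_exp (doubling s) = unit_exp (2 * s)"
      unfolding unit_exp_eq_iff doubling_def frac_def by (intro exI[of _ "- \<lfloor>2 * s\<rfloor>"]) simp
    also have "\<dots> = unit_exp s ^ 2"
      by (simp add: unit_exp_def power2_eq_square cis_mult algebra_simps)
    finally show ?thesis .
  qed
  then show ?case using Suc by (simp add: power_mult[symmetric] mult.commute)
qed simp

lemma cayley_T_power:
  assumes "\<And>i. (T ^^ i) x \<noteq> 0"
  shows "cayley ((T ^^ j) x) = cayley x ^ (2 ^ j)"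
proof (induction j)
  case (Suc j)
  have "cayley ((T ^^ Suc j) x) = (cayley ((T ^^ j) x))\<^sup>2"
    using cayley_T[OF assms[of j]] by simp
  then show ?case using Suc by (simp add: power_mult[symmetric] mult.commute)
qed simp

text \<open>Besides 0, a value y has only the preimages y + sqrt(y^2 + 1) and y - sqrt(y^2 + 1), the
  roots of x^2 - 2 x y = 1, so preimages of countable sets stay countable.\<close>

lemma countable_T_hits_0: "countable {x. \<exists>i. (T ^^ i) x = 0}"
proof -
  have vimage: "countable (T -` B)" if "countable B" for B
  proof -
    have "T -` B \<subseteq> insert 0 ((\<lambda>y. y + sqrt (y\<^sup>2 + 1)) ` B \<union> (\<lambda>y. y - sqrt (y\<^sup>2 + 1)) ` B)"
    proof
      fix x assume x: "x \<in> T -` B"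
      show "x \<in> insert 0 ((\<lambda>y. y + sqrt (y\<^sup>2 + 1)) ` B \<union> (\<lambda>y. y - sqrt (y\<^sup>2 + 1)) ` B)"
      proof (cases "x = 0")
        case False
        define y where "y = T x"
        have "2 * y * x = x\<^sup>2 - 1"
          using False by (simp add: y_def T_def power2_eq_square field_simps)
        then have "(x - y)\<^sup>2 = y\<^sup>2 + 1"
          by (simp add: power2_eq_square algebra_simps)
        then have "\<bar>x - y\<bar> = sqrt (y\<^sup>2 + 1)"
          by (metis real_sqrt_abs)
        then have "x = y + sqrt (y\<^sup>2 + 1) \<or> x = y - sqrt (y\<^sup>2 + 1)" by linarith
        moreover have "y \<in> B" using x by (simp add: y_def)
        ultimately show ?thesis by blast
      qed simp
    qed
    moreover have "countable (insert 0 ((\<lambda>y. y + sqrt (y\<^sup>2 + 1)) ` B \<union> (\<lambda>y. y - sqrt (y\<^sup>2 + 1)) ` B))"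
      using that by auto
    ultimately show ?thesis by (rule countable_subset)
  qed
  have "countable {x. (T ^^ i) x = 0}" for i
  proof (induction i)
    case (Suc i)
    have "{x. (T ^^ Suc i) x = 0} = T -` {x. (T ^^ i) x = 0}"
      by (auto simp: funpow_swap1)
    then show ?case using vimage[OF Suc] by simp
  qed simp
  then have "countable (\<Union>i. {x. (T ^^ i) x = 0})" by auto
  then show ?thesis by (simp add: Collect_ex_eq)
qed

section \<open>From the Stoltz condition to tents, and transport of null sets\<close>

lemma stoltz_tent_bound:
  assumes "stoltz n k"
  obtains q0 B where "tent_bound ((\<lambda>q. (n q, k q)) ` {q0..}) B" "filterlim k at_top sequentially"
proof -
  obtain Z :: "(int \<times> nat) set" and h :: "nat \<Rightarrow> real" and h0 \<alpha> A where
    h: "filterlim h at_top at_top" and mem: "\<And>t l. t \<ge> 1 \<Longrightarrow> l \<ge> t \<Longrightarrow> (int (n l), k l) \<in> truncated Z (h t)"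
    and \<alpha>: "\<alpha> > 0" and A: "A > 0"
    and sec: "\<And>s. s > 0 \<Longrightarrow> finite (cone_section Z h0 \<alpha> s) \<and> real (card (cone_section Z h0 \<alpha> s)) \<le> A * real s"
    using assms unfolding stoltz_def by metis
  have k_ge: "real (k l) \<ge> h l" if "l \<ge> 1" for l
    using mem[OF that order_refl] by (simp add: truncated_def)
  have "filterlim (\<lambda>l. real (k l)) at_top sequentially"
    by (rule filterlim_at_top_mono[OF h])
       (use k_ge in \<open>auto simp: eventually_sequentially intro!: exI[of _ 1]\<close>)
  then have k_lim: "filterlim k at_top sequentially"
    by (simp add: filterlim_sequentially_iff_filterlim_real)
  have "\<forall>\<^sub>F l in sequentially. h l \<ge> max h0 1"
    by (rule h[unfolded filterlim_at_top, rule_format])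
  then obtain N where N: "\<And>l. l \<ge> N \<Longrightarrow> h l \<ge> max h0 1"
    unfolding eventually_sequentially by blast
  \<comment> \<open>From q0 on, h >= h0 puts the pairs into the truncation under the cone and h >= 1
    makes k positive; the outer 1 is where the indexing starts. Dropping finitely many pairs does
    not affect the limit.\<close>
  define q0 where "q0 = max N 1"
  have k1: "k q > 0" and inZ: "(int (n q), k q) \<in> truncated Z h0" if "q \<ge> q0" for q
    using N[of q] k_ge[of q] mem[of q q] that by (auto simp: q0_def truncated_def)
  define W where "W = (\<lambda>q. (n q, k q)) ` {q0..}"
  \<comment> \<open>The cone is cut at a height s <= K + K / \<alpha> + 1, which is at most (2 + 1 /
    \<alpha>) K since K >= 1.\<close>
  define B where "B = A * (2 + 1 / \<alpha>)"
  have "tent_bound W B"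
    unfolding tent_bound_def
  proof (intro conjI allI impI)
    show "\<forall>(n, k)\<in>W. 0 < k" using k1 by (auto simp: W_def)
    fix K :: nat assume K: "K > 0"
    (* At this height the aperture of the cone above a pair of height at most K is at least K. *)
    define s where "s = K + nat \<lceil>real K / \<alpha>\<rceil>"
    have s0: "s > 0" using K by (simp add: s_def)
    have ceil: "real (nat \<lceil>real K / \<alpha>\<rceil>) \<ge> real K / \<alpha>" "real (nat \<lceil>real K / \<alpha>\<rceil>) \<le> real K / \<alpha> + 1"
      using \<alpha> by (auto simp: of_nat_nat)
    have sub: "tent W K \<subseteq> cone_section Z h0 \<alpha> s"
    proof
      fix m assume "m \<in> tent W K"
      then obtain q where q: "q \<ge> q0" "k q \<le> K" "\<bar>m - int (n q)\<bar> < int K"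
        by (auto simp: tent_def W_def)
      have "\<bar>real_of_int m - real_of_int (int (n q))\<bar> < real K"
        using q(3) by linarith
      also have "real K = \<alpha> * (real K / \<alpha>)" using \<alpha> by simp
      also have "\<dots> \<le> \<alpha> * (real s - real (k q))"
      proof (rule mult_left_mono)
        show "real K / \<alpha> \<le> real s - real (k q)"
          using ceil(1) q(2) unfolding s_def of_nat_add by linarith
      qed (use \<alpha> in simp)
      finally have "\<bar>real_of_int m - real_of_int (int (n q))\<bar> < \<alpha> * (real_of_int (int s) - real (k q))"
        by simp
      then show "m \<in> cone_section Z h0 \<alpha> s"
        unfolding cone_section_def cone_def using inZ[OF q(1)] by blast
    qed
    note sec_s = sec[OF s0]
    show "finite (tent W K)" using finite_subset[OF sub] sec_s by blast
    have "real (card (tent W K)) \<le> A * real s"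
      using card_mono[OF _ sub] sec_s by (meson of_nat_mono order_trans)
    also have "real s \<le> real K + (real K / \<alpha> + 1)" using ceil by (simp add: s_def)
    also have "\<dots> \<le> (2 + 1 / \<alpha>) * real K" using K \<alpha> by (simp add: algebra_simps)
    finally show "real (card (tent W K)) \<le> B * real K"
      using A by (simp add: B_def mult.assoc)
  qed
  then show ?thesis using that k_lim unfolding W_def by blast
qed

text \<open>Only null sets have to be transported, so no density is computed: a differentiable map
  sends null sets to null sets, and every real x is the cotangent of pi t for t = 1/2 - arctan x /
  pi in (0, 1).\<close>

lemma AE_lebesgue_cotangent:
  assumes "AE t in unit_lborel. P (cos (pi * t) / sin (pi * t))"
  shows "AE x in lebesgue. P x"
proof -
  let ?c = "\<lambda>t. cos (pi * t) / sin (pi * t)"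
  have "AE t in lborel. t \<in> {0..1} \<longrightarrow> P (?c t)"
    using assms by (subst (asm) AE_restrict_space_iff) auto
  then obtain N where N: "N \<in> null_sets lborel" "{t. \<not> (t \<in> {0..1} \<longrightarrow> P (?c t))} \<subseteq> N"
    by (auto elim!: AE_E simp: null_sets_def)
  have "negligible N"
    using N(1) by (simp add: negligible_iff_null_sets null_sets_completionI)
  then have "negligible (N \<inter> {0<..<1})" by (rule negligible_subset) auto
  moreover have "?c differentiable_on (N \<inter> {0<..<1})"
    unfolding differentiable_on_def
  proof
    fix t assume "t \<in> N \<inter> {0<..<1}"
    then have "sin (pi * t) > 0" by (intro sin_gt_zero) auto
    then have "?c differentiable (at t)"
      unfolding real_differentiable_def by (intro exI) (auto intro!: derivative_eq_intros)
    then show "?c differentiable (at t within N \<inter> {0<..<1})"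
      by (rule differentiable_at_withinI)
  qed
  ultimately have "negligible (?c ` (N \<inter> {0<..<1}))"
    by (intro negligible_differentiable_image_negligible) auto
  then have null: "?c ` (N \<inter> {0<..<1}) \<in> null_sets lebesgue"
    by (simp add: negligible_iff_null_sets)
  show ?thesis
  proof (rule AE_I'[OF null], safe)
    fix x assume x: "\<not> P x"
    define t where "t = 1/2 - arctan x / pi"
    have t: "0 < t" "t < 1"
      using arctan_lbound[of x] arctan_ubound[of x] by (auto simp: t_def field_simps)
    have "pi * t = pi / 2 - arctan x" by (simp add: t_def algebra_simps)
    then have "?c t = sin (arctan x) / cos (arctan x)"
      by (simp add: sin_diff cos_diff)
    then have "?c t = x" by (metis tan_arctan tan_def)
    then show "x \<in> ?c ` (N \<inter> {0<..<1})"
      using x t N(2) by (intro image_eqI[of _ _ t]) auto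
  qed
qed

theorem theorem7p4:
  fixes n k :: "nat \<Rightarrow> nat"
  assumes "stoltz n k"
  shows "(\<lambda>\<rho>. of_int (zorder zeta \<rho>) * ln (norm (\<rho> / (1 - \<rho>))))
           summable_on {\<rho> \<in> nontrivial_zeta_zeros. Re \<rho> > 1/2} \<and>
         (AE x in lebesgue.
           (\<lambda>q. (1 / real (k q)) *
                  (\<Sum>j=1..k q. ln (norm (zeta (1/2 + 1/2 * \<i> * of_real ((T ^^ (n q + j)) x))))))
             \<longlonglongrightarrow> (\<Sum>\<^sub>\<infinity>\<rho> | \<rho> \<in> nontrivial_zeta_zeros \<and> Re \<rho> > 1/2.
                    of_int (zorder zeta \<rho>) * ln (norm (\<rho> / (1 - \<rho>)))))"
proof
  define F where "F t = ln (norm (zeta_disc (unit_exp t)))" for t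
  define c where "c = (\<Sum>\<^sub>\<infinity>\<rho> | \<rho> \<in> nontrivial_zeta_zeros \<and> Re \<rho> > 1/2.
                    of_int (zorder zeta \<rho>) * ln (norm (\<rho> / (1 - \<rho>))))"
  show "(\<lambda>\<rho>. of_int (zorder zeta \<rho>) * ln (norm (\<rho> / (1 - \<rho>))))
           summable_on {\<rho> \<in> nontrivial_zeta_zeros. Re \<rho> > 1/2}"
    by (rule summable_zeta_zeros)
  obtain q0 B where tb: "tent_bound ((\<lambda>q. (n q, k q)) ` {q0..}) B" and k: "filterlim k at_top sequentially"
    using stoltz_tent_bound[OF assms] by blast
  have "doubling.approx_coboundary F"
    unfolding F_def[abs_def] by (intro approx_coboundary_doubling integrable_zeta_boundary)
  from doubling.moving_averages_converge[OF this tb k]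
  have conv: "AE t in unit_lborel. (\<lambda>q. (\<Sum>j=1..k q. F ((doubling ^^ (n q + j)) t)) / real (k q)) \<longlonglongrightarrow> c"
    unfolding c_def integral_zeta_boundary[symmetric] F_def[abs_def] .
  \<comment> \<open>Orbits through 0 are exempted here, because the conjugacy requires nonzero
    iterates; their starting points are discarded on the line afterwards.\<close>
  let ?P = "\<lambda>x. (\<forall>i. (T ^^ i) x \<noteq> 0) \<longrightarrow> (\<lambda>q. (1 / real (k q)) *
      (\<Sum>j=1..k q. ln (norm (zeta (1/2 + 1/2 * \<i> * of_real ((T ^^ (n q + j)) x)))))) \<longlonglongrightarrow> c"
  \<comment> \<open>Removes both end points t = 0 and t = 1, where the sine in the cotangent
    vanishes.\<close>
  have "AE t in unit_lborel. unit_exp t \<notin> {1}"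
    by (rule AE_unit_exp_notin_countable) simp
  moreover have "AE t in unit_lborel. t \<in> {0..1}"
    by (rule AE_I2) (simp add: space_restrict_space)
  ultimately have "AE t in unit_lborel. ?P (cos (pi * t) / sin (pi * t))"
    using conv
  proof eventually_elim
    case (elim t)
    have "unit_exp 0 = 1" "unit_exp 1 = 1" by (simp_all add: unit_exp_def)
    with elim have "t \<noteq> 0" "t \<noteq> 1" by auto
    with elim have t: "0 < t" "t < 1" by auto
    define x where "x = cos (pi * t) / sin (pi * t)"
    have x: "cayley x = unit_exp t" unfolding x_def by (rule cayley_cot[OF t])
    have "?P x"
    proof
      assume nz: "\<forall>i. (T ^^ i) x \<noteq> 0"
      have "F ((doubling ^^ i) t) = ln (norm (zeta (1/2 + 1/2 * \<i> * of_real ((T ^^ i) x))))" for i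
        unfolding ln_norm_zeta_disc_cayley[symmetric] F_def unit_exp_doubling_power
          cayley_T_power[OF nz[rule_format]] x ..
      then show "(\<lambda>q. (1 / real (k q)) *
          (\<Sum>j=1..k q. ln (norm (zeta (1/2 + 1/2 * \<i> * of_real ((T ^^ (n q + j)) x)))))) \<longlonglongrightarrow> c"
        using elim by simp
    qed
    then show ?case unfolding x_def .
  qed
  then have "AE x in lebesgue. ?P x" by (rule AE_lebesgue_cotangent)
  moreover have "AE x in lebesgue. x \<notin> {x. \<exists>i. (T ^^ i) x = 0}"
  proof (rule AE_not_in)
    show "{x. \<exists>i. (T ^^ i) x = 0} \<in> null_sets lebesgue"
      by (intro null_sets_completionI countable_imp_null_set_lborel countable_T_hits_0)
  qed
  ultimately show "AE x in lebesgue.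
      (\<lambda>q. (1 / real (k q)) *
             (\<Sum>j=1..k q. ln (norm (zeta (1/2 + 1/2 * \<i> * of_real ((T ^^ (n q + j)) x))))))
        \<longlonglongrightarrow> (\<Sum>\<^sub>\<infinity>\<rho> | \<rho> \<in> nontrivial_zeta_zeros \<and> Re \<rho> > 1/2.
               of_int (zorder zeta \<rho>) * ln (norm (\<rho> / (1 - \<rho>))))"
    unfolding c_def by eventually_elim auto
qed



end
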